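(* Let $(X,d)$ be a compact metric space and let $f:X\to X$ be a continuous map such that the entropy function $\mu\mapsto h_\mu(f)$ is upper semi-continuous on $\mathcal{M}(f)$. Suppose that there are continuous functions $\psi,\phi:X\to\mathbb{R}$ and $\alpha\in\mathbb{R}$ such that: (1) $\psi+t\phi\in\mathcal{V}(f,\psi)$ for every real $t\ge 0$; (2) $P_\mu(\psi)\le\alpha$ for every maximizing measure $\mu$ for $\phi$. Then $$\{P_\mu(\psi):\mu\in\mathcal{M}_e(f)\}\supset[\alpha,P(\psi)].$$
   Context: $C(X)$ is the space of continuous functions $X\to\mathbb{R}$. $\mathcal{M}(f)$ is the set of all $f$-invariant Borel probability measures on $X$ with the weak-$*$ topology, and $\mathcal{M}_e(f)\subset\mathcal{M}(f)$ is the subset of ergodic measures. $h_\mu(f)$ is the metric (Kolmogorov–Sinai) entropy. For $\phi\in C(X)$ and $\mu\in\mathcal{M}(f)$, $P_\mu(\phi)=h_\mu(f)+\int\phi\,d\mu$; $P(\phi)$ is the topological pressure of $(X,f,\phi)$, which by the Variational Principle equals $\sup\{P_\mu(\phi):\mu\in\mathcal{M}(f)\}$. The set of equilibrium states for $\phi$ is $\mathcal{E}(\phi)=\{\mu\in\mathcal{M}(f):P_\mu(\phi)=P(\phi)\}$; it is nonempty for every $\phi\in C(X)$ when the entropy function is upper semi-continuous. For $\psi\in C(X)$, $\mathcal{V}(f,\psi)$ is the set of all $\phi\in C(X)$ such that $P_\mu(\psi)$ takes the same value for all $\mu\in\mathcal{E}(\phi)$. A maximizing measure for $\phi$ is a measure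 $\mu\in\mathcal{M}(f)$ such that $\int\phi\,d\mu=\sup_{\nu\in\mathcal{M}(f)}\int\phi\,d\nu$. *)

theory Defs
  imports "HOL-Probability.Probability"
begin

section \<open>Invariant measures\<close>

definition invariant_measures :: "('a::topological_space \<Rightarrow> 'a) \<Rightarrow> 'a measure set" where
  "invariant_measures f =
     {\<mu>. sets \<mu> = sets borel \<and> prob_space \<mu> \<and>
         (\<forall>A\<in>sets borel. measure \<mu> (f -` A) = measure \<mu> A)}"

definition ergodic_measures :: "('a::topological_space \<Rightarrow> 'a) \<Rightarrow> 'a measure set" where
  "ergodic_measures f =
     {\<mu>\<in>invariant_measures f.
        \<forall>A\<in>sets borel. f -` A = A \<longrightarrow> measure \<mu> A = 0 \<or> measure \<mu> A = 1}"

text \<open>The coarsest topology on the invariant measures for which integration against every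
  continuous real function is continuous.\<close>

definition weak_star_topology :: "('a::topological_space \<Rightarrow> 'a) \<Rightarrow> 'a measure topology" where
  "weak_star_topology f = topology_generated_by
     {{\<mu>\<in>invariant_measures f. integral\<^sup>L \<mu> \<phi> \<in> U} | \<phi> U.
        continuous_on UNIV \<phi> \<and> open (U :: real set)}"

definition upper_semicontinuous_map :: "'b topology \<Rightarrow> ('b \<Rightarrow> ereal) \<Rightarrow> bool" where
  "upper_semicontinuous_map T h \<longleftrightarrow> (\<forall>c. openin T {x\<in>topspace T. h x < c})"

section \<open>Kolmogorov--Sinai entropy\<close>

definition borel_partitions :: "'a::topological_space set set set" where
  "borel_partitions = {\<xi>. finite \<xi> \<and> partition_on UNIV \<xi> \<and> \<xi> \<subseteq> sets borel}"

text \<open>Since \<^term>\<open>ln (0::real) = 0\<close>, null cells contribute \<open>0\<close>.\<close>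

definition partition_entropy :: "'a measure \<Rightarrow> 'a set set \<Rightarrow> real" where
  "partition_entropy \<mu> \<xi> = - (\<Sum>A\<in>\<xi>. measure \<mu> A * ln (measure \<mu> A))"

text \<open>The join of the pullbacks of \<open>\<xi>\<close> under \<open>f\<^sup>0, \<dots>, f\<^sup>n\<^sup>-\<^sup>1\<close>; empty cells are dropped.\<close>

definition iterated_join :: "('a \<Rightarrow> 'a) \<Rightarrow> nat \<Rightarrow> 'a set set \<Rightarrow> 'a set set" where
  "iterated_join f n \<xi> =
     common_refinement ((\<lambda>i. (\<lambda>A. (f ^^ i) -` A) ` \<xi> - {{}}) ` {..<n})"

definition entropy_wrt_partition :: "('a \<Rightarrow> 'a) \<Rightarrow> 'a measure \<Rightarrow> 'a set set \<Rightarrow> real" where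
  "entropy_wrt_partition f \<mu> \<xi> = lim (\<lambda>n. partition_entropy \<mu> (iterated_join f n \<xi>) / real n)"

definition metric_entropy :: "('a::topological_space \<Rightarrow> 'a) \<Rightarrow> 'a measure \<Rightarrow> ereal" where
  "metric_entropy f \<mu> = (SUP \<xi>\<in>borel_partitions. ereal (entropy_wrt_partition f \<mu> \<xi>))"

section \<open>Pressure and equilibrium states\<close>

definition measure_pressure ::
    "('a::topological_space \<Rightarrow> 'a) \<Rightarrow> 'a measure \<Rightarrow> ('a \<Rightarrow> real) \<Rightarrow> ereal" where
  "measure_pressure f \<mu> \<phi> = metric_entropy f \<mu> + ereal (integral\<^sup>L \<mu> \<phi>)"

definition dyn_separated :: "('a::metric_space \<Rightarrow> 'a) \<Rightarrow> nat \<Rightarrow> real \<Rightarrow> 'a set \<Rightarrow> bool" where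
  "dyn_separated f n \<epsilon> E \<longleftrightarrow>
     (\<forall>x\<in>E. \<forall>y\<in>E. x \<noteq> y \<longrightarrow> (\<exists>i<n. dist ((f ^^ i) x) ((f ^^ i) y) > \<epsilon>))"

text \<open>On a compact space with \<open>f\<close> continuous, all separated sets are finite, of bounded
  cardinality for given \<open>n\<close> and \<open>\<epsilon>\<close>, so the supremum below is over a bounded set of reals
  whenever \<open>\<phi>\<close> is continuous.\<close>

definition separated_partition_function ::
    "('a::metric_space \<Rightarrow> 'a) \<Rightarrow> ('a \<Rightarrow> real) \<Rightarrow> nat \<Rightarrow> real \<Rightarrow> real" where
  "separated_partition_function f \<phi> n \<epsilon> =
     (SUP E\<in>{E. finite E \<and> dyn_separated f n \<epsilon> E}. \<Sum>x\<in>E. exp (\<Sum>i<n. \<phi> ((f ^^ i) x)))"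

definition topological_pressure ::
    "('a::metric_space \<Rightarrow> 'a) \<Rightarrow> ('a \<Rightarrow> real) \<Rightarrow> ereal" where
  "topological_pressure f \<phi> =
     Lim (at_right 0)
       (\<lambda>\<epsilon>. limsup (\<lambda>n. ereal (ln (separated_partition_function f \<phi> n \<epsilon>) / real n)))"

definition equilibrium_states ::
    "('a::metric_space \<Rightarrow> 'a) \<Rightarrow> ('a \<Rightarrow> real) \<Rightarrow> 'a measure set" where
  "equilibrium_states f \<phi> =
     {\<mu>\<in>invariant_measures f. measure_pressure f \<mu> \<phi> = topological_pressure f \<phi>}"

text \<open>The set \<open>\<V>(f, \<psi>)\<close>.\<close>

definition constant_pressure_potentials ::
    "('a::metric_space \<Rightarrow> 'a) \<Rightarrow> ('a \<Rightarrow> real) \<Rightarrow> ('a \<Rightarrow> real) set" where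
  "constant_pressure_potentials f \<psi> =
     {\<phi>. continuous_on UNIV \<phi> \<and>
         (\<forall>\<mu>\<in>equilibrium_states f \<phi>. \<forall>\<nu>\<in>equilibrium_states f \<phi>.
            measure_pressure f \<mu> \<psi> = measure_pressure f \<nu> \<psi>)}"

definition maximizing_measures ::
    "('a::topological_space \<Rightarrow> 'a) \<Rightarrow> ('a \<Rightarrow> real) \<Rightarrow> 'a measure set" where
  "maximizing_measures f \<phi> =
     {\<mu>\<in>invariant_measures f. integral\<^sup>L \<mu> \<phi> = (SUP \<nu>\<in>invariant_measures f. integral\<^sup>L \<nu> \<phi>)}"

end

theory Submission
  imports Defs
begin

text \<open>
  Write \<open>p(\<mu>)\<close> for the pressure \<open>P\<^sub>\<mu>(\<psi>)\<close> and \<open>a(\<mu>)\<close> for the integral of \<open>\<phi>\<close>. The equilibrium states for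
  \<open>\<psi> + t \<phi>\<close> are the maximisers of \<open>p + t a\<close> over the invariant measures. The invariant measures are
  weakly sequentially compact, \<open>p\<close> is upper semicontinuous, \<open>a\<close> is continuous, and both are affine.
  By hypothesis \<open>p\<close> has a constant value \<open>g(t)\<close> on the set \<open>E(t)\<close> of equilibrium states for
  \<open>\<psi> + t \<phi>\<close>. If \<open>\<mu>\<^sub>n \<in> E(t\<^sub>n)\<close> and \<open>t\<^sub>n \<rightarrow> t\<close>, then every limit \<open>\<mu>\<close> of these measures lies in \<open>E(t)\<close>
  and \<open>p(\<mu>\<^sub>n) \<rightarrow> p(\<mu>)\<close> along the corresponding subsequence. So \<open>g\<close> is continuous, and \<open>g(0) = P(\<psi>)\<close>.

  Let \<open>b\<close> lie between \<open>\<alpha>\<close> and \<open>P(\<psi>)\<close>. Either \<open>g(n) \<le> b\<close> for some \<open>n\<close>, and then \<open>g(t) = b\<close> for some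
  \<open>t\<close> by the intermediate value theorem. Or the limits of measures in \<open>E(n)\<close> as \<open>n \<rightarrow> \<infinity>\<close> are
  maximizing for \<open>\<phi>\<close> and have \<open>p \<ge> b\<close>, which forces \<open>b = \<alpha>\<close>. In the first case \<open>E(t)\<close>, in the second
  the set of maximizing measures with \<open>p \<ge> \<alpha>\<close>, is a nonempty closed face of the set of invariant
  measures, and \<open>p = b\<close> on it. Every nonempty closed face contains an ergodic measure
  (\<open>closed_face_contains_ergodic\<close>): maximise the integrals of a countable determining family of
  continuous functions one after the other, until a single measure is left. It is an extreme point, so
  no invariant set splits it.

  That \<open>E(t)\<close> is nonempty (\<open>equilibrium_states_nonempty\<close>) rests on the variational principle. For the
  bound of \<open>P\<^sub>\<mu>\<close> by the topological pressure (\<open>measure_pressure_le_topological_pressure\<close>), the cells of a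
  partition are shrunk to closed cores with positive distance, so that a small ball
  meets at most one core; applied to blocks of length \<open>N\<close>, the loss per unit of time is of order
  \<open>1 / N\<close>.
  In the other direction (\<open>pressure_at_le_measure_pressure\<close>), weighted averages along the orbits of
  separated sets converge to invariant measures of large pressure.

  Two devices keep the foundations short. Partitions are represented by functions with finitely
  many values and iterated joins by itineraries. Weak compactness
  (\<open>weak_sequential_compactness\<close>) is transferred from the real line, where it is Helly's theorem, by a
  Borel coding with a continuous left inverse (\<open>real_coding\<close>).
\<close>

section \<open>Entropy of finite labellings\<close>

text \<open>The Shannon entropy of the partition into the fibres of \<open>c\<close>. Functions with finitely many
  values replace partitions throughout, because the join of two partitions is then a pair of
  functions and the pullback of a partition is a composition.\<close>
definition label_entropy :: "'a measure \<Rightarrow> ('a \<Rightarrow> 'b) \<Rightarrow> real" where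
  "label_entropy M c = - (\<Sum>v\<in>range c. measure M (c -` {v}) * ln (measure M (c -` {v})))"

locale prob_on_UNIV = prob_space M for M :: "'a measure" +
  assumes space_UNIV [simp]: "space M = UNIV"
begin

lemma finite_range_label: "simple_function M c \<Longrightarrow> finite (range c)"
  using simple_functionD(1)[of M c] by simp

lemma fibre_sets: "simple_function M c \<Longrightarrow> c -` A \<in> sets M"
  using simple_functionD(2)[of M c A] by simp

lemma prob_fibre_sum:
  assumes c: "simple_function M c"
  shows "prob ((\<lambda>x. g (c x)) -` {w}) = (\<Sum>v\<in>{v\<in>range c. g v = w}. prob (c -` {v}))"
proof -
  have "(\<lambda>x. g (c x)) -` {w} = (\<Union>v\<in>{v\<in>range c. g v = w}. c -` {v})" by auto
  then show ?thesis
    using finite_range_label[OF c] fibre_sets[OF c]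
    by (simp only:) (intro finite_measure_finite_Union, auto simp: disjoint_family_on_def)
qed

text \<open>Two entropies are compared by writing both as sums over the fibres of one common refinement
  \<open>c\<close>; this change of variables makes that possible.\<close>
lemma marginal_sum:
  fixes F :: "'c \<Rightarrow> real"
  assumes c: "simple_function M c"
  shows "(\<Sum>v\<in>range c. prob (c -` {v}) * F (g v))
       = (\<Sum>w\<in>range (\<lambda>x. g (c x)). prob ((\<lambda>x. g (c x)) -` {w}) * F w)"
proof -
  have "(\<Sum>v\<in>range c. prob (c -` {v}) * F (g v))
      = (\<Sum>w\<in>g ` range c. \<Sum>v\<in>{v\<in>range c. g v = w}. prob (c -` {v}) * F (g v))"
    by (rule sum.image_gen[OF finite_range_label[OF c]])
  also have "\<dots> = (\<Sum>w\<in>g ` range c. (\<Sum>v\<in>{v\<in>range c. g v = w}. prob (c -` {v})) * F w)"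
    by (simp add: sum_distrib_right)
  also have "\<dots> = (\<Sum>w\<in>range (\<lambda>x. g (c x)). prob ((\<lambda>x. g (c x)) -` {w}) * F w)"
    by (simp add: prob_fibre_sum[OF c] image_image)
  finally show ?thesis .
qed

lemma sum_prob_fibres:
  assumes "simple_function M c"
  shows "(\<Sum>v\<in>range c. prob (c -` {v})) = 1"
proof -
  have "(\<Sum>v\<in>range c. prob (c -` {v}))
      = (\<Sum>w\<in>range (\<lambda>x::'a. 0::nat). prob ((\<lambda>x. 0) -` {w}))"
    using marginal_sum[OF assms, where F = "\<lambda>_. 1" and g = "\<lambda>_. 0"]
    by (simp only: mult_1_right)
  then show ?thesis using prob_space by (simp add: image_constant_conv)
qed

lemma label_entropy_factor:
  assumes c: "simple_function M c"
  shows "label_entropy M (\<lambda>x. g (c x))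
       = - (\<Sum>v\<in>range c. prob (c -` {v}) * ln (prob ((\<lambda>x. g (c x)) -` {g v})))"
  using marginal_sum[OF c, of "\<lambda>w. ln (prob ((\<lambda>x. g (c x)) -` {w}))" g]
  by (simp add: label_entropy_def)

lemma prob_fibre_le_factor:
  assumes c: "simple_function M c"
  shows "prob (c -` {v}) \<le> prob ((\<lambda>x. g (c x)) -` {g v})"
  using simple_function_compose1[OF c, of g] by (intro finite_measure_mono fibre_sets) auto

text \<open>Written over the fibres of \<open>c\<close>, both entropies average minus the logarithm of the measure of a
  fibre, and the fibres of a factor of \<open>c\<close> are larger than those of \<open>c\<close>.\<close>
lemma label_entropy_factor_le:
  assumes c: "simple_function M c"
  shows "label_entropy M (\<lambda>x. g (c x)) \<le> label_entropy M c"
proof -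
  have "prob (c -` {v}) * ln (prob (c -` {v}))
      \<le> prob (c -` {v}) * ln (prob ((\<lambda>x. g (c x)) -` {g v}))" for v
  proof (cases "prob (c -` {v}) = 0")
    case False
    then have "prob (c -` {v}) > 0" by (simp add: order_less_le)
    with prob_fibre_le_factor[OF c, of v g] show ?thesis
      by (intro mult_left_mono) auto
  qed auto
  then show ?thesis
    unfolding label_entropy_factor[OF c] by (auto simp: label_entropy_def intro: sum_mono)
qed

lemma label_entropy_eq_of_factors:
  assumes "simple_function M c" "simple_function M d"
    and "\<And>x. d x = g (c x)" "\<And>x. c x = h (d x)"
  shows "label_entropy M c = label_entropy M d"
  using label_entropy_factor_le[OF assms(1), of g] label_entropy_factor_le[OF assms(2), of h]
  by (simp add: assms(3,4)[symmetric])

lemma label_entropy_nonneg: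
  assumes "simple_function M c"
  shows "label_entropy M c \<ge> 0"
proof -
  have "label_entropy M (\<lambda>x. ()) = 0"
    using prob_space by (simp add: label_entropy_def)
  with label_entropy_factor_le[OF assms, of "\<lambda>_. ()"] show ?thesis by simp
qed

text \<open>The difference of the two sides is the conditional mutual information of \<open>a\<close> and \<open>b\<close> given
  \<open>c\<close>.\<close>
lemma label_entropy_submodular:
  assumes a: "simple_function M a" and b: "simple_function M b" and c: "simple_function M c"
  shows "label_entropy M (\<lambda>x. (a x, b x, c x)) + label_entropy M c
       \<le> label_entropy M (\<lambda>x. (a x, c x)) + label_entropy M (\<lambda>x. (b x, c x))"
proof -
  interpret information_space M "exp 1" by unfold_locales auto
  let ?t = "\<lambda>x. (a x, b x, c x)"
  have t: "simple_function M ?t" by (intro simple_function_Pair a b c)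
  note sd = simple_distributedI[OF _ measure_nonneg refl]
  let ?p = "\<lambda>v. prob (?t -` {v})"
  let ?ac = "\<lambda>v. prob ((\<lambda>x. (a x, c x)) -` {(fst v, snd (snd v))})"
  let ?bc = "\<lambda>v. prob ((\<lambda>x. (b x, c x)) -` {(fst (snd v), snd (snd v))})"
  let ?c = "\<lambda>v. prob (c -` {snd (snd v)})"
  have "0 \<le> conditional_mutual_information (exp 1)
      (count_space (a ` space M)) (count_space (b ` space M)) (count_space (c ` space M)) a b c"
    by (rule conditional_mutual_information_nonneg[OF a b c])
  also have "\<dots> = (\<Sum>v\<in>range ?t. ?p v * ln (?p v / (?ac v * (?bc v / ?c v))))"
    by (subst conditional_mutual_information_eq[OF sd sd sd sd])
       (auto simp: a b c simple_function_Pair log_def split_def)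
  also have "\<dots> = (\<Sum>v\<in>range ?t. ?p v * ln (?p v) - ?p v * ln (?ac v) - ?p v * ln (?bc v) + ?p v * ln (?c v))"
  proof (rule sum.cong[OF refl])
    fix v
    show "?p v * ln (?p v / (?ac v * (?bc v / ?c v)))
        = ?p v * ln (?p v) - ?p v * ln (?ac v) - ?p v * ln (?bc v) + ?p v * ln (?c v)"
    proof (cases "?p v = 0")
      case False
      then have p: "?p v > 0" by (simp add: order_less_le)
      have "?ac v \<ge> ?p v" "?bc v \<ge> ?p v" "?c v \<ge> ?p v"
        using prob_fibre_le_factor[OF t, of v "\<lambda>v. (fst v, snd (snd v))"]
          prob_fibre_le_factor[OF t, of v "\<lambda>v. (fst (snd v), snd (snd v))"]
          prob_fibre_le_factor[OF t, of v "\<lambda>v. snd (snd v)"] by simp_all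
      with p have pos: "?ac v > 0" "?bc v > 0" "?c v > 0" by linarith+
      then have "ln (?p v / (?ac v * (?bc v / ?c v))) = ln (?p v) - (ln (?ac v) + (ln (?bc v) - ln (?c v)))"
        using p by (simp add: ln_div ln_mult)
      then show ?thesis by (simp only:) (simp add: algebra_simps)
    qed simp
  qed
  also have "\<dots> = - label_entropy M ?t + label_entropy M (\<lambda>x. (a x, c x))
       + label_entropy M (\<lambda>x. (b x, c x)) - label_entropy M c"
    using label_entropy_factor[OF t, of "\<lambda>v. (fst v, snd (snd v))"]
      label_entropy_factor[OF t, of "\<lambda>v. (fst (snd v), snd (snd v))"]
      label_entropy_factor[OF t, of "\<lambda>v. snd (snd v)"]
    by (simp add: sum.distrib sum_subtractf label_entropy_def)
  finally show ?thesis by simp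
qed

lemma label_entropy_subadditive:
  assumes a: "simple_function M a" and b: "simple_function M b"
  shows "label_entropy M (\<lambda>x. (a x, b x)) \<le> label_entropy M a + label_entropy M b"
proof -
  have "label_entropy M (\<lambda>x. (a x, b x, ())) = label_entropy M (\<lambda>x. (a x, b x))"
    by (rule label_entropy_eq_of_factors[where g = "\<lambda>v. (fst v, fst (snd v))" and h = "\<lambda>v. (fst v, snd v, ())"])
       (auto simp: a b)
  moreover have "label_entropy M (\<lambda>x. (a x, ())) = label_entropy M a"
    by (rule label_entropy_eq_of_factors[where g = fst and h = "\<lambda>v. (v, ())"]) (auto simp: a)
  moreover have "label_entropy M (\<lambda>x. (b x, ())) = label_entropy M b"
    by (rule label_entropy_eq_of_factors[where g = fst and h = "\<lambda>v. (v, ())"]) (auto simp: b)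
  moreover have "label_entropy M (\<lambda>x. ()) \<ge> 0" by (rule label_entropy_nonneg) simp
  ultimately show ?thesis
    using label_entropy_submodular[OF a b simple_function_const[of M "()"]] by simp
qed

text \<open>With \<open>H(x|y) = H(x,y) - H(y)\<close> this reads \<open>H(a,b|c,d) \<le> H(a|c) + H(b|d)\<close>: conditional entropy is
  subadditive, and it grows when conditions are dropped. Each of the three steps is an instance of
  submodularity.\<close>
lemma conditional_label_entropy_subadditive:
  assumes a: "simple_function M a" and b: "simple_function M b"
    and c: "simple_function M c" and d: "simple_function M d"
  shows "label_entropy M (\<lambda>x. ((a x, b x), (c x, d x))) - label_entropy M (\<lambda>x. (c x, d x))
       \<le> (label_entropy M (\<lambda>x. (a x, c x)) - label_entropy M c)
         + (label_entropy M (\<lambda>x. (b x, d x)) - label_entropy M d)"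
proof -
  note cd = simple_function_Pair[OF c d]
  have "label_entropy M (\<lambda>x. (a x, b x, (c x, d x))) + label_entropy M (\<lambda>x. (c x, d x))
      \<le> label_entropy M (\<lambda>x. (a x, (c x, d x))) + label_entropy M (\<lambda>x. (b x, (c x, d x)))"
    by (rule label_entropy_submodular[OF a b cd])
  moreover have "label_entropy M (\<lambda>x. (a x, d x, c x)) + label_entropy M c
      \<le> label_entropy M (\<lambda>x. (a x, c x)) + label_entropy M (\<lambda>x. (d x, c x))"
    by (rule label_entropy_submodular[OF a d c])
  moreover have "label_entropy M (\<lambda>x. (b x, c x, d x)) + label_entropy M d
      \<le> label_entropy M (\<lambda>x. (b x, d x)) + label_entropy M (\<lambda>x. (c x, d x))"
    by (rule label_entropy_submodular[OF b c d])
  moreover have "label_entropy M (\<lambda>x. (a x, d x, c x)) = label_entropy M (\<lambda>x. (a x, (c x, d x)))"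
    by (rule label_entropy_eq_of_factors[where g = "\<lambda>(a,d,c). (a,c,d)" and h = "\<lambda>(a,d,c). (a,c,d)"])
       (auto simp: a c d)
  moreover have "label_entropy M (\<lambda>x. (d x, c x)) = label_entropy M (\<lambda>x. (c x, d x))"
    by (rule label_entropy_eq_of_factors[where g = prod.swap and h = prod.swap]) (auto simp: c d)
  moreover have "label_entropy M (\<lambda>x. ((a x, b x), (c x, d x))) = label_entropy M (\<lambda>x. (a x, b x, (c x, d x)))"
    by (rule label_entropy_eq_of_factors[where g = "\<lambda>((a,b),cd). (a,b,cd)" and h = "\<lambda>(a,b,cd). ((a,b),cd)"])
       (auto simp: a b c d)
  ultimately show ?thesis by linarith
qed

text \<open>Gibbs' inequality: the weights \<open>exp (A v)\<close>, normalised, maximise entropy plus energy. It follows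
  from \<open>ln x \<le> x - 1\<close> at the quotient of the two probability vectors.\<close>
lemma label_entropy_plus_energy_le:
  assumes c: "simple_function M c"
  shows "label_entropy M c + (\<Sum>v\<in>range c. prob (c -` {v}) * A v) \<le> ln (\<Sum>v\<in>range c. exp (A v))"
proof -
  let ?p = "\<lambda>v. prob (c -` {v})"
  let ?Z = "\<Sum>v\<in>range c. exp (A v)"
  have Z: "?Z > 0" using finite_range_label[OF c] by (intro sum_pos) auto
  have "?p v * A v - ?p v * ln (?p v) \<le> ?p v * ln ?Z + exp (A v) / ?Z - ?p v" for v
  proof (cases "?p v = 0")
    case False
    then have p: "?p v > 0" by (simp add: order_less_le)
    have "ln (exp (A v) / (?Z * ?p v)) \<le> exp (A v) / (?Z * ?p v) - 1"
      using Z p by (intro ln_le_minus_one) auto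
    then have "A v - (ln ?Z + ln (?p v)) \<le> exp (A v) / (?Z * ?p v) - 1"
      using Z p by (simp add: ln_div ln_mult_pos)
    then have "?p v * (A v - (ln ?Z + ln (?p v))) \<le> ?p v * (exp (A v) / (?Z * ?p v) - 1)"
      using p by (intro mult_left_mono) auto
    also have "\<dots> = exp (A v) / ?Z - ?p v" using p Z by (simp add: field_simps)
    finally show ?thesis by (simp add: algebra_simps)
  qed (use Z in auto)
  then have "(\<Sum>v\<in>range c. ?p v * A v - ?p v * ln (?p v))
      \<le> (\<Sum>v\<in>range c. ?p v * ln ?Z + exp (A v) / ?Z - ?p v)" by (intro sum_mono)
  also have "\<dots> = ln ?Z"
    using Z by (simp add: sum.distrib sum_subtractf sum_prob_fibres[OF c]
        flip: sum_distrib_right sum_divide_distrib)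
  finally show ?thesis by (simp add: label_entropy_def sum_subtractf)
qed

lemma label_entropy_le_ln_card:
  assumes "simple_function M c"
  shows "label_entropy M c \<le> ln (card (range c))"
  using label_entropy_plus_energy_le[OF assms, of "\<lambda>_. 0"] by simp

end

text \<open>The function \<open>x ln x\<close> lies above its tangent at the averaged point. The labelling may depend on
  \<open>i\<close> so that the lemma covers averages along an orbit, where \<open>d i\<close> is \<open>c \<circ> f\<^sup>i\<close> and the measure
  \<open>Q i\<close> is always the same.\<close>
lemma label_entropy_concave:
  assumes I: "finite I" "\<And>i. i \<in> I \<Longrightarrow> a i \<ge> 0" "sum a I = 1"
    and N: "\<And>v. measure N (c -` {v}) = (\<Sum>i\<in>I. a i * measure (Q i) (d i -` {v}))"
    and r: "\<And>i. i \<in> I \<Longrightarrow> range (d i) \<subseteq> range c" and fin: "finite (range c)"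
  shows "(\<Sum>i\<in>I. a i * label_entropy (Q i) (d i)) \<le> label_entropy N c"
proof -
  have tangent: "x * ln y + x - y \<le> x * ln x" if "x \<ge> 0" "y > 0" for x y :: real
  proof (cases "x = 0")
    case False
    with that have "ln (y / x) \<le> y / x - 1" by (intro ln_le_minus_one) auto
    then have "x * ln (y / x) \<le> x * (y / x - 1)" using that by (intro mult_left_mono)
    then show ?thesis using that False by (simp add: ln_div algebra_simps)
  qed (use that in auto)
  let ?y = "\<lambda>v. measure N (c -` {v})" and ?x = "\<lambda>i v. measure (Q i) (d i -` {v})"
  have one: "?y v * ln (?y v) \<le> (\<Sum>i\<in>I. a i * (?x i v * ln (?x i v)))" for v
  proof (cases "?y v = 0")
    case True
    then have "\<forall>i\<in>I. a i * ?x i v = 0"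
      using I unfolding N by (subst (asm) sum_nonneg_eq_0_iff) auto
    then have "(\<Sum>i\<in>I. a i * (?x i v * ln (?x i v))) = 0" by (intro sum.neutral) auto
    then show ?thesis using True by simp
  next
    case False
    then have y: "?y v > 0" by (simp add: order_less_le)
    have "?y v * ln (?y v) = ?y v * ln (?y v) + ?y v - sum a I * ?y v" using I by simp
    also have "\<dots> = (\<Sum>i\<in>I. a i * ?x i v) * ln (?y v) + (\<Sum>i\<in>I. a i * ?x i v) - sum a I * ?y v"
      by (simp only: N)
    also have "\<dots> = (\<Sum>i\<in>I. a i * (?x i v * ln (?y v) + ?x i v - ?y v))"
      unfolding sum_distrib_right sum.distrib[symmetric] sum_subtractf[symmetric]
      by (intro sum.cong) (auto simp: algebra_simps)
    also have "\<dots> \<le> (\<Sum>i\<in>I. a i * (?x i v * ln (?x i v)))"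
      using I y by (intro sum_mono mult_left_mono tangent) auto
    finally show ?thesis .
  qed
  have "(\<Sum>v\<in>range c. ?y v * ln (?y v)) \<le> (\<Sum>v\<in>range c. \<Sum>i\<in>I. a i * (?x i v * ln (?x i v)))"
    by (intro sum_mono one)
  also have "\<dots> = (\<Sum>i\<in>I. a i * (\<Sum>v\<in>range c. ?x i v * ln (?x i v)))"
    unfolding sum_distrib_left by (rule sum.swap)
  also have "\<dots> = (\<Sum>i\<in>I. a i * (\<Sum>v\<in>range (d i). ?x i v * ln (?x i v)))"
  proof (rule sum.cong[OF refl])
    fix i assume i: "i \<in> I"
    have "?x i v = 0" if "v \<notin> range (d i)" for v
    proof -
      from that have "d i -` {v} = {}" by auto
      then show ?thesis by simp
    qed
    then have "(\<Sum>v\<in>range c. ?x i v * ln (?x i v)) = (\<Sum>v\<in>range (d i). ?x i v * ln (?x i v))"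
      by (intro sum.mono_neutral_right fin r[OF i]) auto
    then show "a i * (\<Sum>v\<in>range c. ?x i v * ln (?x i v)) = a i * (\<Sum>v\<in>range (d i). ?x i v * ln (?x i v))"
      by simp
  qed
  finally show ?thesis by (simp add: label_entropy_def sum_negf)
qed

text \<open>Concavity is sharp up to the entropy of the pair \<open>(s, 1 - s)\<close>, since the measure of a fibre is at
  least \<open>s\<close> times its \<open>P\<close>-measure and at least \<open>1 - s\<close> times its \<open>Q\<close>-measure. That error does
  not depend on \<open>c\<close>, so it disappears when the entropy of an itinerary is divided by its length.\<close>
lemma label_entropy_convex_combination_le:
  assumes P: "prob_on_UNIV P" "prob_on_UNIV Q" and s: "0 < s" "s < 1"
    and c: "simple_function P c" "simple_function Q c"
    and N: "\<And>v. measure N (c -` {v}) = s * measure P (c -` {v}) + (1 - s) * measure Q (c -` {v})"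
  shows "label_entropy N c \<le> s * label_entropy P c + (1 - s) * label_entropy Q c
      + (- s * ln s - (1 - s) * ln (1 - s))"
proof -
  interpret P: prob_on_UNIV P by fact
  interpret Q: prob_on_UNIV Q by fact
  have half: "r * x * ln r + r * (x * ln x) \<le> r * x * ln (r * x + z)"
    if "r > 0" "x \<ge> 0" "z \<ge> 0" for r x z :: real
  proof (cases "x = 0")
    case False
    with that have "r * x > 0" by simp
    have "r * x * (ln r + ln x) = r * x * ln (r * x)" using that False by (simp add: ln_mult_pos)
    also have "\<dots> \<le> r * x * ln (r * x + z)"
      using that \<open>r * x > 0\<close> by (intro mult_left_mono) auto
    finally show ?thesis by (simp add: algebra_simps)
  qed simp
  let ?p = "\<lambda>v. measure P (c -` {v})" and ?q = "\<lambda>v. measure Q (c -` {v})" and ?n = "\<lambda>v. measure N (c -` {v})"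
  have "(\<Sum>v\<in>range c. s * ?p v * ln s + s * (?p v * ln (?p v)) + ((1 - s) * ?q v * ln (1 - s) + (1 - s) * (?q v * ln (?q v))))
      \<le> (\<Sum>v\<in>range c. s * ?p v * ln (?n v) + (1 - s) * ?q v * ln (?n v))"
    using half[of s "?p _" "(1 - s) * ?q _"] half[of "1 - s" "?q _" "s * ?p _"] s
    by (intro sum_mono add_mono) (auto simp: N add.commute)
  also have "\<dots> = (\<Sum>v\<in>range c. ?n v * ln (?n v))"
    by (intro sum.cong) (auto simp: N algebra_simps)
  finally have "s * (\<Sum>v\<in>range c. ?p v) * ln s + s * (\<Sum>v\<in>range c. ?p v * ln (?p v))
     + ((1 - s) * (\<Sum>v\<in>range c. ?q v) * ln (1 - s) + (1 - s) * (\<Sum>v\<in>range c. ?q v * ln (?q v)))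
     \<le> (\<Sum>v\<in>range c. ?n v * ln (?n v))"
    by (simp add: sum.distrib sum_distrib_left sum_distrib_right)
  then show ?thesis
    using P.sum_prob_fibres[OF c(1)] Q.sum_prob_fibres[OF c(2)]
    by (simp add: label_entropy_def)
qed

section \<open>Entropy of an invariant measure through itineraries\<close>

lemma label_entropy_superset:
  assumes "finite S" "range c \<subseteq> S"
  shows "label_entropy M c = - (\<Sum>v\<in>S. measure M (c -` {v}) * ln (measure M (c -` {v})))"
proof -
  have "c -` {v} = {}" if "v \<notin> range c" for v using that by auto
  then have "(\<Sum>v\<in>range c. measure M (c -` {v}) * ln (measure M (c -` {v})))
      = (\<Sum>v\<in>S. measure M (c -` {v}) * ln (measure M (c -` {v})))"
    using assms by (intro sum.mono_neutral_left) auto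
  then show ?thesis by (simp add: label_entropy_def)
qed

text \<open>One labelling may omit values that the other takes on a null set, as \<open>c \<circ> f\<^sup>n\<close> may do in
  comparison with \<open>c\<close> when \<open>f\<close> is not surjective.\<close>
lemma label_entropy_same_distribution:
  assumes "finite (range c)" "finite (range d)"
    and "\<And>v. measure M (c -` {v}) = measure N (d -` {v})"
  shows "label_entropy M c = label_entropy N d"
  using assms by (simp add: label_entropy_superset[where S = "range c \<union> range d"])

definition itinerary :: "('a \<Rightarrow> 'a) \<Rightarrow> nat \<Rightarrow> ('a \<Rightarrow> 'b) \<Rightarrow> 'a \<Rightarrow> 'b list" where
  "itinerary f n c x = map (\<lambda>i. c ((f ^^ i) x)) [0..<n]"

lemma itinerary_add: "itinerary f (m + n) c x = itinerary f m c x @ itinerary f n c ((f ^^ m) x)"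
proof -
  have "map (\<lambda>i. c ((f ^^ i) x)) [m..<m + n] = map (\<lambda>i. c ((f ^^ i) ((f ^^ m) x))) [0..<n]"
    by (induction n) (auto simp: funpow_add add.commute)
  then show ?thesis by (simp add: itinerary_def upt_add_eq_append[of 0 m n, simplified])
qed

lemma itinerary_0 [simp]: "itinerary f 0 c x = []"
  by (simp add: itinerary_def)

lemma itinerary_eq_iff:
  "itinerary f n c x = itinerary f n c y \<longleftrightarrow> (\<forall>i<n. c ((f ^^ i) x) = c ((f ^^ i) y))"
  by (auto simp: itinerary_def)

lemma measurable_funpow:
  assumes "f \<in> measurable M M"
  shows "(f ^^ n) \<in> measurable M M"
  by (induction n) (use assms in \<open>auto intro: measurable_comp\<close>)

lemma simple_function_measurable_comp:
  assumes "simple_function N c" "f \<in> measurable M N"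
  shows "simple_function M (\<lambda>x. c (f x))"
proof -
  have "finite ((\<lambda>x. c (f x)) ` space M)"
    using simple_functionD(1)[OF assms(1)] measurable_space[OF assms(2)]
    by (elim finite_subset[rotated]) auto
  moreover have "(\<lambda>x. c (f x)) \<in> measurable M (count_space UNIV)"
    using measurable_comp[OF assms(2) measurable_simple_function[OF assms(1)]] by (simp add: comp_def)
  ultimately show ?thesis by (simp add: simple_function_eq_measurable)
qed

lemma simple_function_itinerary:
  assumes "simple_function M c" "f \<in> measurable M M"
  shows "simple_function M (itinerary f n c)"
proof (induction n)
  case (Suc n)
  have "simple_function M (\<lambda>x. itinerary f n c x @ [c ((f ^^ n) x)])"
    using simple_function_compose2[OF Suc
        simple_function_measurable_comp[OF assms(1) measurable_funpow[OF assms(2)]],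
        of "\<lambda>l v. l @ [v]"] by simp
  then show ?case by (simp add: itinerary_def)
qed (simp add: itinerary_def)

definition fibres :: "('a \<Rightarrow> 'b) \<Rightarrow> 'a set set" where
  "fibres c = (\<lambda>v. c -` {v}) ` range c"

lemma partition_entropy_fibres: "partition_entropy \<mu> (fibres c) = label_entropy \<mu> c"
proof -
  have "inj_on (\<lambda>v. c -` {v}) (range c)" by (auto simp: inj_on_def)
  then show ?thesis
    by (simp add: partition_entropy_def label_entropy_def fibres_def sum.reindex)
qed

lemma fibres_borel_partition:
  assumes "simple_function borel c"
  shows "fibres c \<in> borel_partitions"
  using simple_functionD[OF assms]
  by (auto simp: borel_partitions_def fibres_def partition_on_def disjoint_def)

lemma borel_partition_is_fibres:
  fixes \<xi> :: "'a::topological_space set set"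
  assumes "\<xi> \<in> borel_partitions"
  obtains c :: "'a \<Rightarrow> 'a set" where "simple_function borel c" "\<xi> = fibres c"
proof -
  have fin: "finite \<xi>" and part: "partition_on UNIV \<xi>" and borel: "\<xi> \<subseteq> sets borel"
    using assms by (auto simp: borel_partitions_def)
  have ex: "\<exists>!A. A \<in> \<xi> \<and> x \<in> A" for x
    using part unfolding partition_on_def disjoint_def by (metis UNIV_I UnionE disjoint_iff)
  define c where "c x = (THE A. A \<in> \<xi> \<and> x \<in> A)" for x
  have c: "c x \<in> \<xi>" "x \<in> c x" for x
    using theI'[OF ex[of x]] by (auto simp: c_def)
  have c_eq: "A \<in> \<xi> \<Longrightarrow> c x = A \<longleftrightarrow> x \<in> A" for A x
    using ex[of x] c[of x] by auto
  have rng: "range c = \<xi>"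
  proof (intro equalityI subsetI)
    fix A assume A: "A \<in> \<xi>"
    then have "A \<noteq> {}" using part by (auto simp: partition_on_def)
    then obtain x where "x \<in> A" by auto
    then have "A = c x" using c_eq[OF A, of x] by simp
    then show "A \<in> range c" by simp
  qed (use c in auto)
  have vim: "c -` {A} = A" if "A \<in> \<xi>" for A using c_eq[OF that] by auto
  have "simple_function borel c"
    unfolding simple_function_def using rng fin borel vim by auto
  moreover have "\<xi> = fibres c" unfolding fibres_def rng using vim by auto
  ultimately show ?thesis by (rule that)
qed

lemma mem_fibres_iff: "A \<in> fibres c \<longleftrightarrow> (\<exists>x. A = {y. c y = c x})"
  by (auto simp: fibres_def vimage_def image_iff)

lemma fibres_vimage: "(\<lambda>A. h -` A) ` fibres c - {{}} = fibres (\<lambda>x. c (h x))"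
proof (intro equalityI subsetI)
  fix A assume "A \<in> (\<lambda>A. h -` A) ` fibres c - {{}}"
  then obtain B y where B: "B \<in> fibres c" "A = h -` B" "y \<in> A" by blast
  then obtain x where "B = {z. c z = c x}" by (auto simp: mem_fibres_iff)
  with B have "A = {z. c (h z) = c (h y)}" by auto
  then show "A \<in> fibres (\<lambda>x. c (h x))" by (auto simp: mem_fibres_iff)
next
  fix A assume "A \<in> fibres (\<lambda>x. c (h x))"
  then obtain x where "A = {y. c (h y) = c (h x)}" by (auto simp: mem_fibres_iff)
  then have "x \<in> A" "A = h -` {z. c z = c (h x)}" by auto
  moreover have "{z. c z = c (h x)} \<in> fibres c" by (auto simp: mem_fibres_iff)
  ultimately show "A \<in> (\<lambda>A. h -` A) ` fibres c - {{}}" by blast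
qed

text \<open>The common refinement is indexed by a set of partitions, so coinciding partitions are counted
  once. The choice function that describes a cell may therefore be taken as the one that selects,
  in any partition, the cell of a given point.\<close>
lemma common_refinement_fibres:
  "common_refinement ((\<lambda>i. fibres (g i)) ` I) = range (\<lambda>x. {y. \<forall>i\<in>I. g i y = g i x})"
proof (intro equalityI subsetI)
  fix A assume "A \<in> common_refinement ((\<lambda>i. fibres (g i)) ` I)"
  then have "\<exists>F. (\<forall>i\<in>I. F (fibres (g i)) \<in> fibres (g i)) \<and> A = (\<Inter>i\<in>I. F (fibres (g i))) \<and> A \<noteq> {}"
    unfolding common_refinement by (elim DiffE UN_E) (simp add: Pi_iff image_image, blast)
  then obtain F where F: "\<And>i. i \<in> I \<Longrightarrow> F (fibres (g i)) \<in> fibres (g i)"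
    and A: "A = (\<Inter>i\<in>I. F (fibres (g i)))" "A \<noteq> {}" by blast
  then obtain x where x: "\<And>i. i \<in> I \<Longrightarrow> x \<in> F (fibres (g i))" by auto
  have "F (fibres (g i)) = {y. g i y = g i x}" if i: "i \<in> I" for i
  proof -
    obtain z where z: "F (fibres (g i)) = {y. g i y = g i z}"
      using F[OF i] unfolding mem_fibres_iff ..
    then have "g i x = g i z" using x[OF i] by simp
    with z show ?thesis by simp
  qed
  then show "A \<in> range (\<lambda>x. {y. \<forall>i\<in>I. g i y = g i x})" unfolding A by auto
next
  fix A assume "A \<in> range (\<lambda>x. {y. \<forall>i\<in>I. g i y = g i x})"
  then obtain x where A: "A = {y. \<forall>i\<in>I. g i y = g i x}" by auto
  define F where "F P = (THE B. B \<in> P \<and> x \<in> B)" for P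
  have F: "F (fibres (g i)) = {y. g i y = g i x}" for i
    unfolding F_def by (rule the_equality) (auto simp: mem_fibres_iff)
  have "F \<in> (\<Pi> P\<in>(\<lambda>i. fibres (g i)) ` I. P)" by (auto simp: F mem_fibres_iff)
  moreover have "A = \<Inter> (F ` (\<lambda>i. fibres (g i)) ` I)" unfolding A image_image F by auto
  moreover have "A \<noteq> {}" unfolding A by auto
  ultimately show "A \<in> common_refinement ((\<lambda>i. fibres (g i)) ` I)"
    unfolding common_refinement by (intro DiffI UN_I[of F]) simp_all
qed

lemma iterated_join_fibres: "iterated_join f n (fibres c) = fibres (itinerary f n c)"
proof -
  have "iterated_join f n (fibres c) = range (\<lambda>x. {y. \<forall>i\<in>{..<n}. c ((f ^^ i) y) = c ((f ^^ i) x)})"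
    unfolding iterated_join_def fibres_vimage by (rule common_refinement_fibres)
  also have "\<dots> = fibres (itinerary f n c)"
    by (rule set_eqI) (simp add: mem_fibres_iff itinerary_eq_iff image_iff Ball_def)
  finally show ?thesis .
qed

lemma entropy_wrt_fibres:
  "entropy_wrt_partition f \<mu> (fibres c) = lim (\<lambda>n. label_entropy \<mu> (itinerary f n c) / real n)"
  by (simp add: entropy_wrt_partition_def iterated_join_fibres partition_entropy_fibres)

text \<open>Fekete's lemma. Writing \<open>n = q k + r\<close> with \<open>r < k\<close> gives \<open>a n \<le> q a k + a r\<close>, and the
  remainders \<open>a r\<close> are bounded for fixed \<open>k\<close>.\<close>
lemma subadditive_sequence_limit:
  fixes a :: "nat \<Rightarrow> real"
  assumes nonneg: "\<And>n. a n \<ge> 0" and sub: "\<And>m n. a (m + n) \<le> a m + a n"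
  defines "L \<equiv> (INF n\<in>{1..}. a n / real n)"
  shows "(\<lambda>n. a n / real n) \<longlonglongrightarrow> L" "\<And>n. n \<ge> 1 \<Longrightarrow> L \<le> a n / real n"
proof -
  have bdd: "bdd_below ((\<lambda>n. a n / real n) ` {1..})"
    by (rule bdd_belowI[of _ 0]) (auto simp: nonneg)
  show lower: "L \<le> a n / real n" if "n \<ge> 1" for n
    unfolding L_def using that bdd by (intro cINF_lower) auto
  show "(\<lambda>n. a n / real n) \<longlonglongrightarrow> L"
  proof (rule LIMSEQ_I)
    fix e :: real assume e: "e > 0"
    have "\<exists>k\<in>{1..}. a k / real k < L + e / 2"
      using e bdd unfolding L_def by (subst cINF_less_iff[symmetric]) auto
    then obtain k where k: "k \<ge> 1" "a k / real k < L + e / 2" by auto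
    have mult: "a (q * k + r) \<le> q * a k + a r" for q r
    proof (induction q)
      case (Suc q)
      have "a (Suc q * k + r) \<le> a k + a (q * k + r)" using sub[of k "q * k + r"] by (simp add: add.assoc)
      with Suc show ?case by (simp add: algebra_simps)
    qed simp
    define B where "B = Max (a ` {..<k})"
    have B: "a r \<le> B" if "r < k" for r using that by (auto simp: B_def)
    have "0 \<le> B" using B[of 0] nonneg[of 0] k by auto
    obtain n0 where n0: "real n0 > 2 * B / e" using reals_Archimedean2 by blast
    have "norm (a n / real n - L) < e" if n: "n \<ge> Suc n0" for n
    proof -
      have n1: "n \<ge> 1" "real n > 0" using n by auto
      have "a n \<le> real (n div k) * a k + a (n mod k)" using mult[of "n div k" "n mod k"] by simp
      also have "\<dots> \<le> real (n div k) * a k + B" using B[of "n mod k"] k by auto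
      also have "real (n div k) * a k \<le> (real n / real k) * a k"
        using nonneg by (intro mult_right_mono) (auto simp: of_nat_div_le_of_nat)
      finally have "a n / real n \<le> ((real n / real k) * a k + B) / real n" 
        using n1 by (intro divide_right_mono) auto
      also have "\<dots> = a k / real k + B / real n" using n1 by (simp add: field_simps)
      also have "B / real n < e / 2"
      proof -
        have "2 * B / e < real n" using n0 n by linarith
        then have "2 * B < e * real n" using e by (simp add: field_simps)
        then show ?thesis using n1 by (simp add: field_simps)
      qed
      finally have "a n / real n < L + e" using k(2) by simp
      with lower[OF n1(1)] show ?thesis by simp
    qed
    then show "\<exists>no. \<forall>n\<ge>no. norm (a n / real n - L) < e" by blast
  qed
qed

lemma invariant_measuresD:
  assumes "\<mu> \<in> invariant_measures f"
  shows "sets \<mu> = sets borel" "prob_on_UNIV \<mu>" "space \<mu> = UNIV"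
    "A \<in> sets borel \<Longrightarrow> measure \<mu> (f -` A) = measure \<mu> A"
proof -
  show s: "sets \<mu> = sets borel" using assms by (simp add: invariant_measures_def)
  then show sp: "space \<mu> = UNIV" using sets_eq_imp_space_eq[OF s] by simp
  show "prob_on_UNIV \<mu>"
    using assms sp by (simp add: invariant_measures_def prob_on_UNIV_def prob_on_UNIV_axioms_def)
  show "A \<in> sets borel \<Longrightarrow> measure \<mu> (f -` A) = measure \<mu> A"
    using assms by (simp add: invariant_measures_def)
qed

lemma simple_function_borel_iff:
  "sets \<mu> = sets borel \<Longrightarrow> simple_function \<mu> c \<longleftrightarrow> simple_function borel c"
  by (intro simple_function_cong_algebra) (auto dest: sets_eq_imp_space_eq)

lemma measure_vimage_funpow:
  assumes mu: "\<mu> \<in> invariant_measures f" and f: "f \<in> borel_measurable borel" and A: "A \<in> sets borel"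
  shows "measure \<mu> ((f ^^ n) -` A) = measure \<mu> A"
proof (induction n)
  case (Suc n)
  have "(f ^^ n) -` A \<in> sets borel" using measurable_sets[OF measurable_funpow[OF f] A] by simp
  then show ?case
    using invariant_measuresD(4)[OF mu, of "(f ^^ n) -` A"] Suc
    by (simp only: vimage_comp funpow_Suc_right)
qed simp

lemma label_entropy_funpow:
  assumes mu: "\<mu> \<in> invariant_measures f" and f: "f \<in> borel_measurable borel"
    and c: "simple_function borel c"
  shows "label_entropy \<mu> (\<lambda>x. c ((f ^^ n) x)) = label_entropy \<mu> c"
proof (rule label_entropy_same_distribution)
  fix v
  have "(\<lambda>x. c ((f ^^ n) x)) -` {v} = (f ^^ n) -` (c -` {v})" by auto
  then show "measure \<mu> ((\<lambda>x. c ((f ^^ n) x)) -` {v}) = measure \<mu> (c -` {v})"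
    using simple_functionD(2)[OF c] by (simp only: measure_vimage_funpow[OF mu f] space_borel Int_UNIV_right)
next
  show "finite (range c)" using simple_functionD(1)[OF c] by simp
  then show "finite (range (\<lambda>x. c ((f ^^ n) x)))" by (rule finite_subset[rotated]) auto
qed

text \<open>The entropy with respect to a partition is a limit, and also the infimum of the
  normalised entropies of itineraries. The limit is used for lower estimates of the entropy and the
  infimum for upper ones.\<close>
lemma entropy_of_labelling:
  assumes mu: "\<mu> \<in> invariant_measures f" and f: "f \<in> borel_measurable borel"
    and c: "simple_function borel c"
  shows "(\<lambda>n. label_entropy \<mu> (itinerary f n c) / real n) \<longlonglongrightarrow> entropy_wrt_partition f \<mu> (fibres c)"
    and "n \<ge> 1 \<Longrightarrow> entropy_wrt_partition f \<mu> (fibres c) \<le> label_entropy \<mu> (itinerary f n c) / real n"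
proof -
  interpret prob_on_UNIV \<mu> using invariant_measuresD(2)[OF mu] .
  note sf = simple_function_borel_iff[OF invariant_measuresD(1)[OF mu]]
  have it: "simple_function borel (itinerary f n c)" for n
    using c f by (rule simple_function_itinerary)
  let ?a = "\<lambda>n. label_entropy \<mu> (itinerary f n c)"
  have nonneg: "?a n \<ge> 0" for n using it by (intro label_entropy_nonneg) (simp add: sf)
  have sub: "?a (m + n) \<le> ?a m + ?a n" for m n
  proof -
    let ?d = "\<lambda>x. itinerary f n c ((f ^^ m) x)"
    have d: "simple_function \<mu> ?d"
      unfolding sf using it measurable_funpow[OF f] by (rule simple_function_measurable_comp)
    have i: "simple_function \<mu> (itinerary f m c)" using it sf by blast
    have "?a (m + n) = label_entropy \<mu> (\<lambda>x. (\<lambda>(u, v). u @ v) (itinerary f m c x, ?d x))"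
      unfolding itinerary_add[abs_def] by simp
    also have "\<dots> \<le> label_entropy \<mu> (\<lambda>x. (itinerary f m c x, ?d x))"
      by (rule label_entropy_factor_le) (intro simple_function_Pair i d)
    also have "\<dots> \<le> ?a m + label_entropy \<mu> ?d" by (rule label_entropy_subadditive[OF i d])
    also have "label_entropy \<mu> ?d = ?a n" by (rule label_entropy_funpow[OF mu f it])
    finally show ?thesis .
  qed
  note lim = subadditive_sequence_limit[of ?a, OF nonneg sub]
  have eq: "entropy_wrt_partition f \<mu> (fibres c) = (INF n\<in>{1..}. ?a n / real n)"
    unfolding entropy_wrt_fibres by (rule limI[OF lim(1)])
  show "(\<lambda>n. ?a n / real n) \<longlonglongrightarrow> entropy_wrt_partition f \<mu> (fibres c)"
    using lim(1) unfolding eq .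
  show "n \<ge> 1 \<Longrightarrow> entropy_wrt_partition f \<mu> (fibres c) \<le> ?a n / real n"
    using lim(2) unfolding eq .
qed

lemma entropy_of_labelling_le:
  assumes "simple_function borel c"
  shows "ereal (entropy_wrt_partition f \<mu> (fibres c)) \<le> metric_entropy f \<mu>"
  unfolding metric_entropy_def using fibres_borel_partition[OF assms] by (rule SUP_upper)

lemma metric_entropy_leI:
  fixes f :: "'a::topological_space \<Rightarrow> 'a"
  assumes "\<And>c :: 'a \<Rightarrow> 'a set. simple_function borel c \<Longrightarrow> ereal (entropy_wrt_partition f \<mu> (fibres c)) \<le> B"
  shows "metric_entropy f \<mu> \<le> B"
  unfolding metric_entropy_def
proof (rule SUP_least)
  fix \<xi> :: "'a set set" assume "\<xi> \<in> borel_partitions"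
  then obtain c :: "'a \<Rightarrow> 'a set" where "simple_function borel c" "\<xi> = fibres c"
    by (rule borel_partition_is_fibres)
  then show "ereal (entropy_wrt_partition f \<mu> \<xi>) \<le> B" using assms by simp
qed

lemma metric_entropy_nonneg:
  fixes f :: "'a::topological_space \<Rightarrow> 'a"
  assumes mu: "\<mu> \<in> invariant_measures f" and f: "f \<in> borel_measurable borel"
  shows "metric_entropy f \<mu> \<ge> 0"
proof -
  interpret prob_on_UNIV \<mu> using invariant_measuresD(2)[OF mu] .
  note sf = simple_function_borel_iff[OF invariant_measuresD(1)[OF mu]]
  have c: "simple_function borel (\<lambda>x::'a. ())" by simp
  have "0 \<le> entropy_wrt_partition f \<mu> (fibres (\<lambda>x::'a. ()))"
    using simple_function_itinerary[OF c f]
    by (intro LIMSEQ_le_const[OF entropy_of_labelling(1)[OF mu f c]])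
       (auto intro!: divide_nonneg_nonneg label_entropy_nonneg simp: sf)
  then have "0 \<le> ereal (entropy_wrt_partition f \<mu> (fibres (\<lambda>x::'a. ())))" by simp
  also have "\<dots> \<le> metric_entropy f \<mu>" by (rule entropy_of_labelling_le[OF c])
  finally show ?thesis .
qed

text \<open>The first bound is what makes sets of equilibrium states faces; the second one transports
  infinite entropy from \<open>Q\<close> to any combination that involves \<open>Q\<close>.\<close>
lemma metric_entropy_convex_combination:
  fixes f :: "'a::topological_space \<Rightarrow> 'a"
  assumes P: "P \<in> invariant_measures f" and Q: "Q \<in> invariant_measures f"
    and N: "N \<in> invariant_measures f" and f: "f \<in> borel_measurable borel"
    and s: "0 < s" "s < 1"
    and comb: "\<And>A. A \<in> sets borel \<Longrightarrow> measure N A = s * measure P A + (1 - s) * measure Q A"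
  shows "metric_entropy f N \<le> ereal s * metric_entropy f P + ereal (1 - s) * metric_entropy f Q"
    and "ereal (1 - s) * metric_entropy f Q \<le> metric_entropy f N"
proof -
  interpret P: prob_on_UNIV P using invariant_measuresD(2)[OF P] .
  interpret Q: prob_on_UNIV Q using invariant_measuresD(2)[OF Q] .
  interpret N: prob_on_UNIV N using invariant_measuresD(2)[OF N] .
  note sP = simple_function_borel_iff[OF invariant_measuresD(1)[OF P]]
  note sQ = simple_function_borel_iff[OF invariant_measuresD(1)[OF Q]]
  let ?h = "\<lambda>\<mu> c. entropy_wrt_partition f \<mu> (fibres c)"
  let ?H = "\<lambda>\<mu> n c. label_entropy \<mu> (itinerary f n c)"
  show "metric_entropy f N \<le> ereal s * metric_entropy f P + ereal (1 - s) * metric_entropy f Q"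
  proof (rule metric_entropy_leI)
    fix c :: "'a \<Rightarrow> 'a set" assume c: "simple_function borel c"
    note it = simple_function_itinerary[OF c f]
    define K where "K = - s * ln s - (1 - s) * ln (1 - s)"
    have "?H N n c \<le> s * ?H P n c + (1 - s) * ?H Q n c + K" for n
      unfolding K_def
      by (rule label_entropy_convex_combination_le[OF P.prob_on_UNIV_axioms Q.prob_on_UNIV_axioms s])
         (use it simple_functionD(2)[OF it] in \<open>auto simp: comb sP sQ\<close>)
    then have "?H N n c / n \<le> s * (?H P n c / n) + (1 - s) * (?H Q n c / n) + K / n" for n :: nat
      by (cases "n = 0") (auto simp: field_simps)
    moreover have "(\<lambda>n. s * (?H P n c / n) + (1 - s) * (?H Q n c / n) + K / real n)
        \<longlonglongrightarrow> s * ?h P c + (1 - s) * ?h Q c + 0"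
      by (intro tendsto_intros entropy_of_labelling(1)[OF P f c] entropy_of_labelling(1)[OF Q f c]
            real_tendsto_divide_at_top[where F = sequentially] filterlim_real_sequentially)
    ultimately have "?h N c \<le> s * ?h P c + (1 - s) * ?h Q c"
      using LIMSEQ_le[OF entropy_of_labelling(1)[OF N f c]] by simp
    then have "ereal (?h N c) \<le> ereal s * ereal (?h P c) + ereal (1 - s) * ereal (?h Q c)" by simp
    also have "\<dots> \<le> ereal s * metric_entropy f P + ereal (1 - s) * metric_entropy f Q"
      using s by (intro add_mono ereal_mult_left_mono entropy_of_labelling_le c) auto
    finally show "ereal (?h N c) \<le> ereal s * metric_entropy f P + ereal (1 - s) * metric_entropy f Q" .
  qed
  have *: "ereal (1 - s) * ereal (?h Q c) \<le> metric_entropy f N" if c: "simple_function borel c" for c :: "'a \<Rightarrow> 'a set"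
  proof -
    note it = simple_function_itinerary[OF c f]
    have "(1 - s) * ?H Q n c \<le> ?H N n c" for n
    proof -
      have "(\<Sum>i\<in>{True,False}. (if i then s else 1 - s) * label_entropy (if i then P else Q) (itinerary f n c))
          \<le> ?H N n c"
        by (rule label_entropy_concave)
           (use s simple_functionD[OF it] in \<open>auto simp: comb split: if_splits\<close>)
      moreover have "0 \<le> s * ?H P n c"
        using it s by (intro mult_nonneg_nonneg P.label_entropy_nonneg) (auto simp: sP)
      ultimately show ?thesis by simp
    qed
    then have "(1 - s) * (?H Q n c / n) \<le> ?H N n c / n" for n :: nat
      by (simp add: divide_right_mono)
    moreover have "(\<lambda>n. (1 - s) * (?H Q n c / n)) \<longlonglongrightarrow> (1 - s) * ?h Q c"
      by (intro tendsto_intros entropy_of_labelling(1)[OF Q f c])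
    ultimately have "(1 - s) * ?h Q c \<le> ?h N c"
      using LIMSEQ_le[OF _ entropy_of_labelling(1)[OF N f c]] by blast
    then have "ereal (1 - s) * ereal (?h Q c) \<le> ereal (?h N c)" by simp
    also have "\<dots> \<le> metric_entropy f N" by (rule entropy_of_labelling_le[OF c])
    finally show ?thesis .
  qed
  have "metric_entropy f Q \<le> metric_entropy f N / ereal (1 - s)"
    by (rule metric_entropy_leI) (use * s in \<open>simp add: ereal_le_divide_pos\<close>)
  then show "ereal (1 - s) * metric_entropy f Q \<le> metric_entropy f N"
    using s by (simp add: ereal_le_divide_pos)
qed

section \<open>Borel probability measures on a compact metric space\<close>

locale borel_prob = prob_space M for M :: "'a::topological_space measure" +
  assumes sets_borel [simp, measurable_cong]: "sets M = sets borel"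
begin

lemma space_UNIV [simp]: "space M = UNIV"
  using sets_eq_imp_space_eq[OF sets_borel] by simp

sublocale prob_on_UNIV M by unfold_locales simp

lemma continuous_measurable:
  fixes \<phi> :: "'a \<Rightarrow> 'b::topological_space"
  assumes "continuous_on UNIV \<phi>"
  shows "\<phi> \<in> borel_measurable M"
  using borel_measurable_continuous_onI[OF assms] by measurable

lemma continuous_integrable:
  fixes \<phi> :: "'a \<Rightarrow> real"
  assumes "compact (UNIV :: 'a set)" "continuous_on UNIV \<phi>"
  shows "integrable M \<phi>"
proof -
  obtain B where "\<And>x. norm (\<phi> x) \<le> B"
    using compact_imp_bounded[OF compact_continuous_image[OF assms(2,1)]]
    by (auto simp: bounded_iff)
  then show ?thesis
    using continuous_measurable[OF assms(2)] by (intro integrable_const_bound[of _ B]) auto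
qed

end

lemma borel_prob_iff: "borel_prob M \<longleftrightarrow> prob_space M \<and> sets M = sets borel"
  by (simp add: borel_prob_def borel_prob_axioms_def)

lemma compact_UNIV_finite_cover:
  fixes e :: real
  assumes "compact (UNIV :: 'a::metric_space set)" "e > 0"
  obtains T :: "'a::metric_space set" where "finite T" "\<And>x. \<exists>c\<in>T. dist x c < e"
proof -
  have "(UNIV :: 'a set) \<subseteq> (\<Union>c\<in>UNIV. ball c e)" using assms(2) by auto
  then obtain T :: "'a set" where "finite T" "UNIV \<subseteq> (\<Union>c\<in>T. ball c e)"
    using compactE_image[OF assms(1), of UNIV "\<lambda>c. ball c e"] by auto
  then show ?thesis by (intro that[of T]) (auto simp: dist_commute mem_ball subset_eq)
qed

subsection \<open>A countable base of balls\<close>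

text \<open>Finite nets of balls of radius \<open>1 / Suc n\<close>, listed in one sequence. For each scale \<open>e\<close>, finitely
  many initial indices suffice for all points at once; this uniformity is what later makes the
  inverse of the coding by digits uniformly continuous.\<close>
lemma countable_ball_net:
  assumes "compact (UNIV :: 'a::metric_space set)"
  obtains c :: "nat \<Rightarrow> 'a::metric_space" and r :: "nat \<Rightarrow> real"
  where "\<And>e. e > 0 \<Longrightarrow> \<exists>K. \<forall>x. \<exists>k<K. r k < e \<and> dist x (c k) < r k"
proof -
  have "\<exists>T :: 'a set. finite T \<and> (\<forall>x. \<exists>c\<in>T. dist x c < 1 / Suc n)" for n
    using compact_UNIV_finite_cover[OF assms, of "1 / Suc n"] by (metis of_nat_0_less_iff zero_less_Suc zero_less_divide_1_iff)
  then obtain T :: "nat \<Rightarrow> 'a set" where T: "\<And>n. finite (T n)" "\<And>n x. \<exists>c\<in>T n. dist x c < 1 / Suc n"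
    by metis
  define D where "D = (SIGMA n:UNIV. T n)"
  have "D \<noteq> {}" using T(2)[of 0] by (auto simp: D_def)
  have cD: "countable D" unfolding D_def using T(1) by (intro countable_SIGMA) (auto intro: countable_finite)
  define d where "d = from_nat_into D"
  have dD: "d k \<in> D" for k using from_nat_into[OF \<open>D \<noteq> {}\<close>] by (simp add: d_def)
  show ?thesis
  proof (rule that[of "\<lambda>k. 1 / Suc (fst (d k))" "\<lambda>k. snd (d k)"])
    fix e :: real assume "e > 0"
    then obtain n where n: "1 / Suc n < e" using nat_approx_posE by blast
    have "\<exists>k. d k = (n, c)" if "c \<in> T n" for c
      using from_nat_into_surj[OF cD, of "(n, c)"] that by (auto simp: D_def d_def)
    then obtain i where i: "\<And>c. c \<in> T n \<Longrightarrow> d (i c) = (n, c)" by metis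
    define K where "K = Suc (Max (i ` T n))"
    have "\<exists>k<K. 1 / real (Suc (fst (d k))) < e \<and> dist x (snd (d k)) < 1 / real (Suc (fst (d k)))" for x
    proof -
      obtain c where c: "c \<in> T n" "dist x c < 1 / Suc n" using T(2) by blast
      have "i c < K" unfolding K_def using c T(1) by (simp add: le_imp_less_Suc)
      with c n i[OF c(1)] show ?thesis by (intro exI[of _ "i c"]) simp
    qed
    then show "\<exists>K. \<forall>x. \<exists>k<K. 1 / real (Suc (fst (d k))) < e \<and> dist x (snd (d k)) < 1 / real (Suc (fst (d k)))"
      by blast
  qed
qed

subsection \<open>Countably many continuous functions determine a measure\<close>

lemma measure_eqI_open:
  assumes "borel_prob M" "borel_prob N"
    and "\<And>U. open U \<Longrightarrow> measure M U = measure N U"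
  shows "M = N"
proof -
  interpret M: borel_prob M by fact
  interpret N: borel_prob N by fact
  show ?thesis
  proof (rule measure_eqI_generator_eq[where \<Omega> = UNIV and E = "{S. open S}" and A = "\<lambda>_. UNIV"])
    show "Int_stable {S::'a set. open S}" by (auto simp: Int_stable_def)
    show "emeasure M X = emeasure N X" if "X \<in> {S. open S}" for X
      using assms(3)[of X] that by (simp add: M.emeasure_eq_measure N.emeasure_eq_measure)
  qed (use M.sets_borel N.sets_borel in \<open>auto simp: borel_def\<close>)
qed

text \<open>Let \<open>S F\<close> be the sum of the tent functions of finitely many balls of a countable net. Then
  \<open>min 1 (j * S F)\<close> increases to the indicator of the union of these balls as \<open>j\<close> grows, and every
  open set is an increasing union of such finite unions.\<close>
lemma continuous_determining_family:
  assumes cmp: "compact (UNIV :: 'a::metric_space set)"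
  obtains G :: "nat \<Rightarrow> 'a::metric_space \<Rightarrow> real"
  where "\<And>k. continuous_on UNIV (G k)"
    "\<And>M N. borel_prob M \<Longrightarrow> borel_prob N \<Longrightarrow> (\<And>k. integral\<^sup>L M (G k) = integral\<^sup>L N (G k)) \<Longrightarrow> M = N"
proof -
  obtain c :: "nat \<Rightarrow> 'a" and r
    where net: "\<And>e. e > 0 \<Longrightarrow> \<exists>K. \<forall>x. \<exists>k<K. r k < e \<and> dist x (c k) < r k"
    using countable_ball_net[OF cmp] by metis
  define u where "u k x = max 0 (r k - dist x (c k))" for k x
  define S where "S F x = (\<Sum>k\<in>F. u k x)" for F x
  define g where "g F j x = min 1 (real j * S F x)" for F j x
  have u0: "u k x \<ge> 0" for k x by (simp add: u_def)
  have S0: "S F x \<ge> 0" for F x unfolding S_def by (intro sum_nonneg u0)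
  have contS: "continuous_on UNIV (S F)" for F
    unfolding S_def u_def by (intro continuous_intros)
  have contg: "continuous_on UNIV (g F j)" for F j
    unfolding g_def by (intro continuous_intros contS)
  let ?P = "{F :: nat set. finite F} \<times> (UNIV :: nat set)"
  have P: "countable ?P" "?P \<noteq> {}" by (auto simp: countable_Collect_finite)
  define G where "G k = (let (F, j) = from_nat_into ?P k in g F j)" for k
  have G_onto: "\<exists>k. G k = g F j" if F: "finite F" for F j
  proof -
    obtain k where "from_nat_into ?P k = (F, j)"
      using from_nat_into_surj[OF P(1), of "(F, j)"] F by auto
    then have "G k = g F j" by (simp add: G_def)
    then show ?thesis ..
  qed
  show ?thesis
  proof (rule that[of G])
    show "continuous_on UNIV (G k)" for k
      by (cases "from_nat_into ?P k") (simp add: G_def contg)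
    fix M N :: "'a measure" assume M: "borel_prob M" and N: "borel_prob N"
      and eq: "\<And>k. integral\<^sup>L M (G k) = integral\<^sup>L N (G k)"
    have eqg: "integral\<^sup>L M (g F j) = integral\<^sup>L N (g F j)" if "finite F" for F j
      using G_onto[OF that, of j] eq by metis
    let ?U = "\<lambda>F. {x. S F x > 0}"
    have openU: "open (?U F)" for F
      using open_Collect_less[OF continuous_on_const contS] by simp
    have lim: "(\<lambda>j. integral\<^sup>L Q (g F j)) \<longlonglongrightarrow> measure Q (?U F)" if Q: "borel_prob Q" for Q F
    proof -
      interpret Q: borel_prob Q by fact
      have "(\<lambda>j. integral\<^sup>L Q (g F j)) \<longlonglongrightarrow> integral\<^sup>L Q (indicator (?U F))"
      proof (rule integral_dominated_convergence[where w = "\<lambda>_. 1"])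
        show "AE x in Q. (\<lambda>j. g F j x) \<longlonglongrightarrow> indicator (?U F) x"
        proof (rule AE_I2)
          fix x
          show "(\<lambda>j. g F j x) \<longlonglongrightarrow> indicator (?U F) x"
          proof (cases "S F x > 0")
            case True
            then obtain j0 where "1 / S F x < real j0" using reals_Archimedean2 by blast
            then have "g F j x = 1" if "j \<ge> j0" for j
            proof -
              have "1 < real j0 * S F x" using True \<open>1 / S F x < real j0\<close> by (simp add: field_simps)
              also have "\<dots> \<le> real j * S F x" using that True by (intro mult_right_mono) auto
              finally show ?thesis by (simp add: g_def)
            qed
            then have "\<forall>\<^sub>F j in sequentially. g F j x = 1" by (auto simp: eventually_sequentially)
            then show ?thesis using True by (simp add: tendsto_eventually)
          qed (use S0[of F x] in \<open>simp add: g_def\<close>)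
        qed
        show "AE x in Q. norm (g F j x) \<le> 1" for j using S0[of F] by (auto simp: g_def)
      qed (use openU Q.continuous_measurable[OF contg] in \<open>auto intro!: borel_measurable_indicator\<close>)
      then show ?thesis using openU by simp
    qed
    have eqU: "measure M (?U F) = measure N (?U F)" if "finite F" for F
      using LIMSEQ_unique[OF lim[OF M, of F]] lim[OF N, of F] eqg[OF that] by simp
    show "M = N"
    proof (rule measure_eqI_open[OF M N])
      fix V :: "'a set" assume V: "open V"
      interpret M: borel_prob M by fact
      interpret N: borel_prob N by fact
      define F where "F n = {k. k < n \<and> ball (c k) (r k) \<subseteq> V}" for n
      have finF: "finite (F n)" for n by (simp add: F_def)
      have inc: "incseq (\<lambda>n. ?U (F n))"
      proof (rule incseq_SucI, clarify)
        fix n x assume "S (F n) x > 0"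
        also have "S (F n) x \<le> S (F (Suc n)) x"
          unfolding S_def by (intro sum_mono2 finF u0) (auto simp: F_def)
        finally show "S (F (Suc n)) x > 0" .
      qed
      have un: "(\<Union>n. ?U (F n)) = V"
      proof (intro equalityI subsetI)
        fix x assume "x \<in> (\<Union>n. ?U (F n))"
        then obtain n where "S (F n) x > 0" by auto
        then obtain k where "k \<in> F n" "u k x > 0"
          unfolding S_def using u0 by (metis less_irrefl sum_nonneg not_le sum_nonpos)
        then show "x \<in> V" by (auto simp: F_def u_def dist_commute subset_eq split: if_splits)
      next
        fix x assume "x \<in> V"
        then obtain e where e: "e > 0" "ball x e \<subseteq> V" using V openE by blast
        obtain K where "\<forall>x. \<exists>k<K. r k < e/2 \<and> dist x (c k) < r k" using net[of "e/2"] e by auto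
        then obtain k where k: "r k < e/2" "dist x (c k) < r k" by blast
        have "ball (c k) (r k) \<subseteq> ball x e"
        proof
          fix y assume "y \<in> ball (c k) (r k)"
          with k dist_triangle[of x y "c k"] show "y \<in> ball x e" by (simp add: dist_commute)
        qed
        with e have "k \<in> F (Suc k)" by (auto simp: F_def)
        moreover have "u k x > 0" using k by (simp add: u_def)
        ultimately have "0 < S (F (Suc k)) x"
          unfolding S_def by (intro sum_pos2[of _ k] finF u0) auto
        then show "x \<in> (\<Union>n. ?U (F n))" by auto
      qed
      have "(\<lambda>n. measure M (?U (F n))) \<longlonglongrightarrow> measure M (\<Union>n. ?U (F n))"
        by (rule M.finite_Lim_measure_incseq[OF _ inc]) (use openU in auto)
      moreover have "(\<lambda>n. measure N (?U (F n))) \<longlonglongrightarrow> measure N (\<Union>n. ?U (F n))"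
        by (rule N.finite_Lim_measure_incseq[OF _ inc]) (use openU in auto)
      ultimately show "measure M V = measure N V"
        unfolding un using eqU[OF finF] LIMSEQ_unique by simp
    qed
  qed
qed

lemma measure_eqI_continuous:
  fixes M N :: "'a::metric_space measure"
  assumes cmp: "compact (UNIV :: 'a set)" and M: "borel_prob M" and N: "borel_prob N"
    and eq: "\<And>\<phi> :: 'a \<Rightarrow> real. continuous_on UNIV \<phi> \<Longrightarrow> integral\<^sup>L M \<phi> = integral\<^sup>L N \<phi>"
  shows "M = N"
proof -
  obtain G :: "nat \<Rightarrow> 'a \<Rightarrow> real" where "\<And>k. continuous_on UNIV (G k)"
    "\<And>M N. borel_prob M \<Longrightarrow> borel_prob N \<Longrightarrow> (\<And>k. integral\<^sup>L M (G k) = integral\<^sup>L N (G k)) \<Longrightarrow> M = N"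
    using continuous_determining_family[OF cmp] by metis
  then show ?thesis using M N eq by blast
qed

subsection \<open>A Borel coding by real numbers with continuous inverse\<close>

text \<open>Digits 0 and 1 in base 4 leave a gap: all digits after position \<open>m\<close> together contribute at most
  a third of what a difference at position \<open>m\<close> contributes.\<close>
lemma quaternary_digits_agree:
  fixes a b :: "nat \<Rightarrow> real"
  assumes a: "\<And>k. a k \<in> {0, 1}" and b: "\<And>k. b k \<in> {0, 1}"
    and close: "\<bar>(\<Sum>k. a k / 4 ^ k) - (\<Sum>k. b k / 4 ^ k)\<bar> < 1 / 4 ^ N" and k: "k < N"
  shows "a k = b k"
proof (rule ccontr)
  assume ne: "a k \<noteq> b k"
  define m where "m = (LEAST k. a k \<noteq> b k)"
  have m: "a m \<noteq> b m" "\<And>i. i < m \<Longrightarrow> a i = b i" "m \<le> k"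
    unfolding m_def using LeastI[of "\<lambda>k. a k \<noteq> b k" k] ne
    by (auto dest: not_less_Least intro: Least_le)
  define t where "t k = (a k - b k) / 4 ^ k" for k
  have sum4: "(\<lambda>k. (1/4::real) ^ k) sums (4 / 3)" using geometric_sums[of "1/4::real"] by simp
  have bnd: "norm (t k) \<le> (1/4) ^ k" "norm (a k / 4 ^ k) \<le> (1/4) ^ k" "norm (b k / 4 ^ k) \<le> (1/4) ^ k" for k
    using a[of k] b[of k] by (auto simp: t_def power_divide)
  have sa: "summable (\<lambda>k. a k / 4 ^ k)" and sb: "summable (\<lambda>k. b k / 4 ^ k)" and st: "summable t"
    using bnd by (auto intro!: summable_comparison_test'[OF sums_summable[OF sum4]])
  have "(\<Sum>k. a k / 4 ^ k) - (\<Sum>k. b k / 4 ^ k) = (\<Sum>k. t k)"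
    unfolding t_def using suminf_diff[OF sa sb] by (simp add: diff_divide_distrib)
  also have "\<dots> = (\<Sum>k. t (k + Suc m)) + (\<Sum>k<Suc m. t k)" by (rule suminf_split_initial_segment[OF st])
  also have "(\<Sum>k<Suc m. t k) = t m" using m(2) by (simp add: t_def)
  finally have eq: "(\<Sum>k. a k / 4 ^ k) - (\<Sum>k. b k / 4 ^ k) = (\<Sum>k. t (k + Suc m)) + t m" .
  have sums': "(\<lambda>k. (1/4::real) ^ Suc m * (1/4) ^ k) sums ((1/4) ^ Suc m * (4 / 3))"
    using sum4 by (rule sums_mult)
  have bnd': "norm (t (k + Suc m)) \<le> (1/4) ^ Suc m * (1/4) ^ k" for k
    using bnd(1)[of "k + Suc m"] by (simp add: power_add mult_ac)
  have "norm (\<Sum>k. t (k + Suc m)) \<le> (\<Sum>k. (1/4::real) ^ Suc m * (1/4) ^ k)"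
    by (rule norm_suminf_le) (use bnd' sums_summable[OF sums'] in auto)
  also have "\<dots> = (1/4) ^ Suc m * (4 / 3)" using sums' by (rule sums_unique[symmetric])
  finally have tail: "norm (\<Sum>k. t (k + Suc m)) \<le> (1/4) ^ m / 3" by simp
  have "\<bar>t m\<bar> = (1/4) ^ m" using m(1) a[of m] b[of m] by (auto simp: t_def power_divide)
  with tail eq have "\<bar>(\<Sum>k. a k / 4 ^ k) - (\<Sum>k. b k / 4 ^ k)\<bar> \<ge> (1/4) ^ m - (1/4) ^ m / 3"
    unfolding real_norm_def by linarith
  moreover have "(1/4::real) ^ m - (1/4) ^ m / 3 \<ge> (1/4) ^ m * (1/4)" by simp
  moreover have "(1/4::real) ^ m * (1/4) \<ge> (1/4) ^ N"
    using power_decreasing[of "Suc m" N "1/4::real"] m(3) k by simp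
  ultimately show False using close by (simp add: power_divide)
qed

text \<open>The digits of \<open>s x\<close> record which balls of a countable net contain \<open>x\<close>. The map \<open>s\<close> is Borel and in
  general discontinuous, but nearby codes have many common digits and so come from nearby points.
  Hence the inverse of \<open>s\<close> is uniformly continuous on the range of \<open>s\<close>, and compactness extends it
  to the closure. The coding transfers weak compactness from the real line to the space.\<close>
lemma real_coding:
  assumes cmp: "compact (UNIV :: 'a::metric_space set)"
  obtains s :: "'a::metric_space \<Rightarrow> real" and \<pi> :: "real \<Rightarrow> 'a" and C
  where "s \<in> borel_measurable borel" "range s \<subseteq> C" "closed C" "C \<subseteq> {0..2}"
    "continuous_on C \<pi>" "\<And>x. \<pi> (s x) = x"
proof -
  obtain c :: "nat \<Rightarrow> 'a" and r
    where net: "\<And>e. e > 0 \<Longrightarrow> \<exists>K. \<forall>x. \<exists>k<K. r k < e \<and> dist x (c k) < r k"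
    using countable_ball_net[OF cmp] by metis
  define b :: "'a \<Rightarrow> nat \<Rightarrow> real" where "b x k = indicator (ball (c k) (r k)) x" for x k
  define s where "s x = (\<Sum>k. b x k / 4 ^ k)" for x
  have b01: "b x k \<in> {0, 1}" for x k by (auto simp: b_def indicator_def)
  have s_meas: "s \<in> borel_measurable borel"
    unfolding s_def b_def
    by (intro borel_measurable_suminf borel_measurable_divide borel_measurable_indicator) auto
  have sum4: "(\<lambda>k. (1/4::real) ^ k) sums (4 / 3)" using geometric_sums[of "1/4::real"] by simp
  have smb: "summable (\<lambda>k. b x k / 4 ^ k)" for x
    using b01[of x] by (intro summable_comparison_test'[OF sums_summable[OF sum4]]) (auto simp: power_divide b_def indicator_def)
  have s_rng: "s x \<in> {0..2}" for x
  proof -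
    have "s x \<le> (\<Sum>k. (1/4::real) ^ k)"
      unfolding s_def by (intro suminf_le smb sums_summable[OF sum4]) (auto simp: b_def power_divide indicator_def)
    moreover have "s x \<ge> 0" unfolding s_def by (intro suminf_nonneg smb) (auto simp: b_def)
    ultimately show ?thesis using sums_unique[OF sum4] by simp
  qed
  have sep: "\<exists>d>0. \<forall>x y. \<bar>s x - s y\<bar> < d \<longrightarrow> dist x y < e" if e: "e > 0" for e
  proof -
    obtain K where K: "\<forall>x. \<exists>k<K. r k < e/2 \<and> dist x (c k) < r k" using net[of "e/2"] e by auto
    have "dist x y < e" if xy: "\<bar>s x - s y\<bar> < 1 / 4 ^ K" for x y
    proof -
      obtain k where k: "k < K" "r k < e/2" "dist x (c k) < r k" using K by blast
      have "b x k = b y k"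
        using quaternary_digits_agree[OF b01 b01 _ k(1)] xy by (simp add: s_def)
      moreover have "b x k = 1" using k by (simp add: b_def dist_commute)
      ultimately have "dist y (c k) < r k" by (simp add: b_def indicator_def dist_commute split: if_splits)
      with k dist_triangle[of x y "c k"] show ?thesis by (simp add: dist_commute)
    qed
    then show ?thesis by (intro exI[of _ "1 / 4 ^ K"]) auto
  qed
  define C where "C = closure (range s)"
  \<comment> \<open>\<open>lift t x\<close> means that \<open>x\<close> is a limit of points whose codes tend to \<open>t\<close>\<close>
  define lift where "lift t x \<longleftrightarrow> (\<exists>y. (\<lambda>n::nat. s (y n)) \<longlonglongrightarrow> t \<and> y \<longlonglongrightarrow> x)" for t x
  have lift_ex: "\<exists>x. lift t x" if t: "t \<in> C" for t
  proof -
    obtain z where z: "\<And>n. z n \<in> range s" "z \<longlonglongrightarrow> t" 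
      using t closure_sequential[of t "range s"] unfolding C_def by blast
    then have "\<forall>n. \<exists>x. z n = s x" by blast
    from choice[OF this] obtain y where y: "\<And>n. z n = s (y n)" by blast
    obtain x q where q: "strict_mono q" "(y \<circ> q) \<longlonglongrightarrow> x"
      using cmp[unfolded compact_def, rule_format, of y] by auto
    have "(z \<circ> q) \<longlonglongrightarrow> t" using z(2) q(1) by (rule LIMSEQ_subseq_LIMSEQ)
    then show ?thesis unfolding lift_def using q(2) y by (intro exI[of _ x] exI[of _ "y \<circ> q"]) (simp add: comp_def)
  qed
  have lift_close: "\<exists>d>0. \<forall>t t' x x'. lift t x \<longrightarrow> lift t' x' \<longrightarrow> \<bar>t - t'\<bar> < d \<longrightarrow> dist x x' \<le> e" if "e > 0" for e
  proof -
    obtain d where d: "d > 0" "\<And>x y. \<bar>s x - s y\<bar> < d \<Longrightarrow> dist x y < e" using sep[OF \<open>e > 0\<close>] by blast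
    have "dist x x' \<le> e" if L: "lift t x" "lift t' x'" "\<bar>t - t'\<bar> < d" for t t' x x'
    proof -
      obtain y y' where y: "(\<lambda>n::nat. s (y n)) \<longlonglongrightarrow> t" "y \<longlonglongrightarrow> x" "(\<lambda>n::nat. s (y' n)) \<longlonglongrightarrow> t'" "y' \<longlonglongrightarrow> x'"
        using L(1,2) unfolding lift_def by blast
      have "(\<lambda>n. \<bar>s (y n) - s (y' n)\<bar>) \<longlonglongrightarrow> \<bar>t - t'\<bar>" by (intro tendsto_intros y)
      then have "\<forall>\<^sub>F n in sequentially. \<bar>s (y n) - s (y' n)\<bar> < d" using L(3) by (rule order_tendstoD)
      then have "\<forall>\<^sub>F n in sequentially. dist (y n) (y' n) \<le> e"
        by eventually_elim (use d(2) in \<open>auto intro: less_imp_le\<close>)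
      moreover have "(\<lambda>n. dist (y n) (y' n)) \<longlonglongrightarrow> dist x x'" by (intro tendsto_dist y)
      ultimately show ?thesis by (intro tendsto_upperbound[of _ _ sequentially]) auto
    qed
    with d(1) show ?thesis by blast
  qed
  define \<pi> where "\<pi> t = (SOME x. lift t x)" for t
  have \<pi>: "lift t (\<pi> t)" if "t \<in> C" for t unfolding \<pi>_def by (rule someI_ex[OF lift_ex[OF that]])
  have sC: "s x \<in> C" for x unfolding C_def by (meson closure_subset rangeI subsetD)
  show ?thesis
  proof (rule that[of s C \<pi>])
    show "closed C" by (simp add: C_def)
    show "C \<subseteq> {0..2}" unfolding C_def using s_rng by (intro closure_minimal) auto
    show "continuous_on C \<pi>"
      unfolding continuous_on_iff
    proof (intro ballI allI impI)
      fix t e :: real assume t: "t \<in> C" and "e > 0"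
      then obtain d where d: "d > 0" "\<forall>t t' x x'. lift t x \<longrightarrow> lift t' x' \<longrightarrow> \<bar>t - t'\<bar> < d \<longrightarrow> dist x x' \<le> e/2"
        using lift_close[of "e/2"] by auto
      have "dist (\<pi> t') (\<pi> t) < e" if "t' \<in> C" "dist t' t < d" for t'
        using d(2) \<pi>[OF that(1)] \<pi>[OF t] that(2) \<open>e > 0\<close> by (fastforce simp: dist_real_def)
      with d(1) show "\<exists>d>0. \<forall>t'\<in>C. dist t' t < d \<longrightarrow> dist (\<pi> t') (\<pi> t) < e" by blast
    qed
    show "\<pi> (s x) = x" for x
    proof -
      have "lift (s x) x" unfolding lift_def by (intro exI[of _ "\<lambda>_. x"]) auto
      then have "dist (\<pi> (s x)) x \<le> e" if "e > 0" for e
        using lift_close[OF that] \<pi>[OF sC[of x]] by fastforce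
      then show ?thesis by (metis dist_eq_0_iff dense_ge order_antisym zero_le_dist)
    qed
  qed (use s_meas sC in auto)
qed

subsection \<open>Sequential compactness\<close>

definition weakly_converges :: "(nat \<Rightarrow> 'a::topological_space measure) \<Rightarrow> 'a measure \<Rightarrow> bool" where
  "weakly_converges Q M \<longleftrightarrow>
     (\<forall>\<phi> :: 'a \<Rightarrow> real. continuous_on UNIV \<phi> \<longrightarrow> (\<lambda>n. integral\<^sup>L (Q n) \<phi>) \<longlonglongrightarrow> integral\<^sup>L M \<phi>)"

lemma weakly_convergesD:
  "weakly_converges Q M \<Longrightarrow> continuous_on UNIV \<phi> \<Longrightarrow> (\<lambda>n. integral\<^sup>L (Q n) \<phi>) \<longlonglongrightarrow> integral\<^sup>L M (\<phi> :: _ \<Rightarrow> real)"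
  by (simp add: weakly_converges_def)

lemma weakly_converges_subseq:
  "weakly_converges Q M \<Longrightarrow> strict_mono r \<Longrightarrow> weakly_converges (Q \<circ> r) M"
  unfolding weakly_converges_def using LIMSEQ_subseq_LIMSEQ by (fastforce simp: comp_def)

text \<open>The coding \<open>s\<close> pushes the measures forward to measures on a bounded interval, where Helly's
  selection theorem applies. The limit lives on the closed set \<open>C\<close>, because the distance to \<open>C\<close>
  integrates to 0 along the sequence, and the continuous left inverse \<open>\<pi>\<close> of \<open>s\<close> carries it back.\<close>
theorem weak_sequential_compactness:
  fixes Q :: "nat \<Rightarrow> 'a::metric_space measure"
  assumes cmp: "compact (UNIV :: 'a set)" and Q: "\<And>n. borel_prob (Q n)"
  obtains r M where "strict_mono (r :: nat \<Rightarrow> nat)" "borel_prob M" "weakly_converges (Q \<circ> r) M"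
proof -
  obtain s :: "'a \<Rightarrow> real" and \<pi> C where s: "s \<in> borel_measurable borel" "range s \<subseteq> C" "closed C" "C \<subseteq> {0..2}"
    "continuous_on C \<pi>" "\<And>x. \<pi> (s x) = x"
    by (rule real_coding[OF cmp], rule that; assumption)
  interpret Q: borel_prob "Q n" for n by (rule Q)
  have s_meas: "s \<in> borel_measurable (Q n)" for n using s(1) by measurable
  define \<Lambda> where "\<Lambda> n = distr (Q n) borel s" for n
  have \<Lambda>: "real_distribution (\<Lambda> n)" for n unfolding \<Lambda>_def using s_meas by (rule Q.real_distribution_distr)
  have int\<Lambda>: "integral\<^sup>L (\<Lambda> n) h = integral\<^sup>L (Q n) (\<lambda>x. h (s x))"
    if "continuous_on UNIV h" for h :: "real \<Rightarrow> real" and n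
    unfolding \<Lambda>_def using s_meas by (rule integral_distr) (rule borel_measurable_continuous_onI[OF that])
  have "tight \<Lambda>"
    unfolding tight_def
  proof (intro conjI allI impI \<Lambda>)
    fix e :: real assume "e > 0"
    have "measure (\<Lambda> n) {-1<..3} = 1" for n
    proof -
      have "s x \<in> {0..2}" for x using s(2,4) by blast
      then have "0 \<le> s x" "s x \<le> 2" for x by simp_all
      then have "-1 < s x" "s x \<le> 3" for x by (smt (verit))+
      then have "s -` {-1<..3} = UNIV" by auto
      then show ?thesis unfolding \<Lambda>_def using Q.prob_space by (simp add: measure_distr[OF s_meas])
    qed
    then show "\<exists>a b. a < b \<and> (\<forall>n. 1 - e < measure (\<Lambda> n) {a<..b})" using \<open>e > 0\<close> by (intro exI[of _ "-1"] exI[of _ 3]) auto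
  qed
  then obtain r \<nu> where r: "strict_mono r" and \<nu>: "real_distribution \<nu>" and conv: "weak_conv_m (\<Lambda> \<circ> id \<circ> r) \<nu>"
    using tight_imp_convergent_subsubsequence[of \<Lambda> id] by (auto simp: strict_mono_def)
  interpret \<nu>: real_distribution \<nu> by fact
  have lim: "(\<lambda>n. integral\<^sup>L (Q (r n)) (\<lambda>x. h (s x))) \<longlonglongrightarrow> integral\<^sup>L \<nu> h"
    if h: "continuous_on UNIV h" "\<And>t. norm (h t) \<le> B" for h :: "real \<Rightarrow> real" and B
  proof -
    have "(\<lambda>n. integral\<^sup>L ((\<Lambda> \<circ> id \<circ> r) n) h) \<longlonglongrightarrow> integral\<^sup>L \<nu> h"
      by (rule weak_conv_imp_integral_bdd_continuous_conv[OF _ \<nu> conv _ h(2)])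
         (use \<Lambda> h(1) in \<open>auto simp: continuous_on_eq_continuous_at\<close>)
    then show ?thesis using int\<Lambda>[OF h(1)] by simp
  qed
  have "C \<noteq> {}" using s(2) by auto
  have AE_C: "AE t in \<nu>. t \<in> C"
  proof -
    let ?h = "\<lambda>t. min 1 (infdist t C)"
    have cont: "continuous_on UNIV ?h" by (intro continuous_intros)
    have h_int: "integrable \<nu> ?h"
      using borel_measurable_continuous_onI[OF cont] by (intro \<nu>.integrable_const_bound[of _ 1]) (auto simp: infdist_nonneg)
    have "(\<lambda>n. integral\<^sup>L (Q (r n)) (\<lambda>x. ?h (s x))) \<longlonglongrightarrow> integral\<^sup>L \<nu> ?h"
      by (rule lim[OF cont, of 1]) (auto simp: infdist_nonneg)
    moreover have "?h (s x) = 0" for x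
    proof -
      have "s x \<in> C" using s(2) by blast
      then show ?thesis by simp
    qed
    ultimately have "(\<lambda>n::nat. 0) \<longlonglongrightarrow> integral\<^sup>L \<nu> ?h" by simp
    then have "integral\<^sup>L \<nu> ?h = 0" using LIMSEQ_unique tendsto_const by metis
    then have "AE t in \<nu>. ?h t = 0"
      by (subst (asm) integral_nonneg_eq_0_iff_AE[OF h_int]) (auto simp: infdist_nonneg)
    then show ?thesis
    proof (rule AE_mp, intro AE_I2 impI)
      fix t assume "?h t = 0"
      then have "infdist t C = 0" by (auto simp: min_def split: if_splits)
      then show "t \<in> C" using in_closed_iff_infdist_zero[OF s(3) \<open>C \<noteq> {}\<close>] by simp
    qed
  qed
  define \<pi>' where "\<pi>' t = (if t \<in> C then \<pi> t else \<pi> 0)" for t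
  have \<pi>'_meas: "\<pi>' \<in> borel_measurable \<nu>"
    unfolding \<pi>'_def using borel_measurable_continuous_on_if[OF _ s(5) continuous_on_const] s(3) by auto
  define M where "M = distr \<nu> borel \<pi>'"
  have M: "borel_prob M"
    unfolding borel_prob_iff M_def using \<nu>.prob_space_distr[OF \<pi>'_meas] by simp
  have "weakly_converges (Q \<circ> r) M"
    unfolding weakly_converges_def
  proof (intro allI impI)
    fix \<phi> :: "'a \<Rightarrow> real" assume \<phi>: "continuous_on UNIV \<phi>"
    obtain B where B: "\<And>x. norm (\<phi> x) \<le> B"
      using compact_imp_bounded[OF compact_continuous_image[OF \<phi> cmp]] by (auto simp: bounded_iff)
    have "0 \<le> B" using B[of undefined] by (meson norm_ge_zero order_trans)
    have cont: "continuous_on C (\<lambda>t. \<phi> (\<pi> t))"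
      by (rule continuous_on_compose2[OF \<phi> s(5)]) auto
    have "closedin (top_of_set UNIV) C" using s(3) by simp
    from Continuous_Extension.Tietze[OF cont this \<open>0 \<le> B\<close> B]
    obtain g where g: "continuous_on UNIV g" "\<And>t. t \<in> C \<Longrightarrow> g t = \<phi> (\<pi> t)" "\<And>t. norm (g t) \<le> B"
      by (metis UNIV_I)
    have "integral\<^sup>L M \<phi> = integral\<^sup>L \<nu> (\<lambda>t. \<phi> (\<pi>' t))"
      unfolding M_def using \<pi>'_meas by (rule integral_distr) (rule borel_measurable_continuous_onI[OF \<phi>])
    also have "\<dots> = integral\<^sup>L \<nu> g"
    proof (rule integral_cong_AE)
      show "(\<lambda>t. \<phi> (\<pi>' t)) \<in> borel_measurable \<nu>"
        using measurable_compose[OF \<pi>'_meas borel_measurable_continuous_onI[OF \<phi>]] .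
      show "g \<in> borel_measurable \<nu>" using borel_measurable_continuous_onI[OF g(1)] by simp
      show "AE t in \<nu>. \<phi> (\<pi>' t) = g t" using AE_C by eventually_elim (simp add: \<pi>'_def g(2))
    qed
    finally have "integral\<^sup>L M \<phi> = integral\<^sup>L \<nu> g" .
    moreover have "g (s x) = \<phi> x" for x using s(2,6) g(2)[of "s x"] by auto
    ultimately show "(\<lambda>n. integral\<^sup>L ((Q \<circ> r) n) \<phi>) \<longlonglongrightarrow> integral\<^sup>L M \<phi>"
      using lim[OF g(1,3)] by simp
  qed
  with r M show ?thesis by (rule that)
qed

subsection \<open>Weak convergence and open, closed and continuity sets\<close>


text \<open>The functions \<open>min 1 (j * infdist x (- U))\<close> increase to the indicator of \<open>U\<close>.\<close>
lemma open_inner_function: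
  fixes U :: "'a::metric_space set"
  assumes "borel_prob M" and U: "open U" and e: "e > 0"
  obtains g :: "'a \<Rightarrow> real" where "continuous_on UNIV g" "\<And>x. 0 \<le> g x" "\<And>x. g x \<le> indicator U x"
    "measure M U - e < integral\<^sup>L M g"
proof (cases "U = UNIV")
  case True
  interpret borel_prob M by fact
  show ?thesis
    by (rule that[of "\<lambda>_. 1"]) (use e prob_space in \<open>auto simp: True\<close>)
next
  case False
  interpret borel_prob M by fact
  define g where "g j x = min 1 (real j * infdist x (- U))" for j x
  have cont: "continuous_on UNIV (g j)" for j unfolding g_def by (intro continuous_intros)
  have g0: "g j x \<ge> 0" for j x by (simp add: g_def infdist_nonneg)
  have gU: "g j x \<le> indicator U x" for j x by (auto simp: g_def indicator_def)
  have "(\<lambda>j. integral\<^sup>L M (g j)) \<longlonglongrightarrow> integral\<^sup>L M (indicator U)"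
  proof (rule integral_dominated_convergence[where w = "\<lambda>_. 1"])
    show "AE x in M. (\<lambda>j. g j x) \<longlonglongrightarrow> indicator U x"
    proof (rule AE_I2)
      fix x
      show "(\<lambda>j. g j x) \<longlonglongrightarrow> indicator U x"
      proof (cases "x \<in> U")
        case True
        then have pos: "infdist x (- U) > 0"
          using in_closed_iff_infdist_zero[of "- U" x] U False infdist_nonneg[of x "- U"]
          by (auto simp: order_less_le)
        then obtain j0 where j0: "1 / infdist x (- U) < real j0" using reals_Archimedean2 by blast
        have "g j x = 1" if "j \<ge> j0" for j
        proof -
          have "1 < real j0 * infdist x (- U)" using pos j0 by (simp add: field_simps)
          also have "\<dots> \<le> real j * infdist x (- U)" using that pos by (intro mult_right_mono) auto
          finally show ?thesis by (simp add: g_def)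
        qed
        then have "\<forall>\<^sub>F j in sequentially. g j x = 1" by (auto simp: eventually_sequentially)
        then show ?thesis using True by (simp add: tendsto_eventually)
      qed (simp add: g_def)
    qed
    show "AE x in M. norm (g j x) \<le> 1" for j using g0 by (auto simp: g_def)
  qed (use U continuous_measurable[OF cont] in \<open>auto intro!: borel_measurable_indicator\<close>)
  moreover have "integral\<^sup>L M (indicator U) = measure M U" using U by simp
  ultimately have "\<forall>\<^sub>F j in sequentially. measure M U - e < integral\<^sup>L M (g j)"
    using e by (intro order_tendstoD(1)) auto
  then obtain j where "measure M U - e < integral\<^sup>L M (g j)" by (auto simp: eventually_sequentially)
  with cont g0 gU show ?thesis by (rule that)
qed

lemma weak_limit_open:
  fixes U :: "'a::metric_space set"
  assumes cmp: "compact (UNIV :: 'a set)" and Q: "\<And>n. borel_prob (Q n)" and M: "borel_prob M"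
    and conv: "weakly_converges Q M" and U: "open U" and e: "e > 0"
  shows "\<forall>\<^sub>F n in sequentially. measure M U - e < measure (Q n) U"
proof -
  obtain g :: "'a \<Rightarrow> real" where g: "continuous_on UNIV g" "\<And>x. 0 \<le> g x" "\<And>x. g x \<le> indicator U x"
    "measure M U - e < integral\<^sup>L M g"
    using open_inner_function[OF M U e] by blast
  have "\<forall>\<^sub>F n in sequentially. measure M U - e < integral\<^sup>L (Q n) g"
    using weakly_convergesD[OF conv g(1)] g(4) by (rule order_tendstoD)
  then show ?thesis
  proof eventually_elim
    case (elim n)
    interpret Q: borel_prob "Q n" by (rule Q)
    have "integral\<^sup>L (Q n) g \<le> integral\<^sup>L (Q n) (indicator U)"
      using U g(3) by (intro integral_mono Q.continuous_integrable[OF cmp g(1)])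
        (auto simp: Q.emeasure_eq_measure)
    also have "\<dots> = measure (Q n) U" using U by simp
    finally show ?case using elim by simp
  qed
qed

text \<open>The null set \<open>N\<close> plays the role of the boundary of \<open>A\<close>: apart from \<open>N\<close>, both \<open>A\<close> and its
  complement are open, and the measure of an open set is lower semicontinuous under weak convergence.\<close>
lemma weak_limit_continuity_set:
  fixes A N :: "'a::metric_space set"
  assumes cmp: "compact (UNIV :: 'a set)" and Q: "\<And>n. borel_prob (Q n)" and M: "borel_prob M"
    and conv: "weakly_converges Q M" and A: "A \<in> sets borel" and N: "closed N" "measure M N = 0"
    and "open (A - N)" "open (- A - N)"
  shows "(\<lambda>n. measure (Q n) A) \<longlonglongrightarrow> measure M A"
proof (rule LIMSEQ_I)
  fix e :: real assume e: "e > 0"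
  interpret Q: borel_prob "Q n" for n by (rule Q)
  interpret M: borel_prob M by (rule M)
  have lower: "\<forall>\<^sub>F n in sequentially. measure M B - e < measure (Q n) B"
    if B: "B \<in> sets borel" "open (B - N)" for B
    using weak_limit_open[OF cmp Q M conv B(2) e]
  proof eventually_elim
    case (elim n)
    have "measure M B \<le> measure M (B - N) + measure M N"
      using B N(1) measure_Un_le[of "B - N" M N]
      by (intro order_trans[OF M.finite_measure_mono[of B "(B - N) \<union> N"]]) auto
    moreover have "measure (Q n) (B - N) \<le> measure (Q n) B"
      using B N by (intro Q.finite_measure_mono) auto
    ultimately show ?case using elim N(2) by simp
  qed
  have compl: "measure L (- A) = 1 - measure L A" if "borel_prob L" for L
  proof -
    interpret L: borel_prob L by fact
    show ?thesis using L.prob_compl[of A] A by (simp add: Compl_eq_Diff_UNIV)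
  qed
  have "\<forall>\<^sub>F n in sequentially. norm (measure (Q n) A - measure M A) < e"
    using lower[OF A assms(8)] lower[OF borel_comp[OF A] assms(9)]
  proof eventually_elim
    case (elim n)
    then show ?case using compl[OF Q, of n] compl[OF M] A by (simp add: abs_less_iff)
  qed
  then show "\<exists>no. \<forall>n\<ge>no. norm (measure (Q n) A - measure M A) < e"
    by (simp add: eventually_sequentially)
qed

subsection \<open>Inner regularity\<close>

text \<open>The sets that lie between a closed and an open set of almost the same measure form a sigma
  algebra that contains the open sets.\<close>
lemma closed_inner_regular:
  fixes M :: "'a::metric_space measure"
  assumes "borel_prob M" and A: "A \<in> sets borel" and e: "e > 0"
  obtains F where "closed F" "F \<subseteq> A" "measure M (A - F) < e"
proof -
  interpret borel_prob M by fact
  let ?P = "\<lambda>A. \<forall>e>0. \<exists>F U. closed F \<and> open U \<and> F \<subseteq> A \<and> A \<subseteq> U \<and> measure M (U - F) < e"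
  have "A \<in> sigma_sets UNIV {S::'a set. open S}" using A by (simp add: borel_def)
  then have "?P A"
  proof induction
    case (Basic U)
    then have U: "open U" by simp
    show ?case
    proof (cases "U = UNIV")
      case True then show ?thesis by (intro allI impI exI[of _ UNIV]) simp
    next
      case False
      define F where "F n = {x. infdist x (- U) \<ge> 1 / Suc n}" for n
      have F: "closed (F n)" for n
        unfolding F_def by (intro closed_Collect_le continuous_intros)
      have FU: "F n \<subseteq> U" for n
      proof
        fix x assume "x \<in> F n"
        then have "infdist x (- U) > 0"
          unfolding F_def by (auto intro: less_le_trans[rotated])
        then show "x \<in> U" by (metis ComplI infdist_zero less_irrefl)
      qed
      have dec: "decseq (\<lambda>n. U - F n)"
      proof (rule decseq_SucI)
        fix n
        have "1 / real (Suc (Suc n)) \<le> 1 / real (Suc n)" by (intro divide_left_mono) auto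
        then show "U - F (Suc n) \<subseteq> U - F n" unfolding F_def by force
      qed
      have "(\<Inter>n. U - F n) = {}"
      proof (rule ccontr)
        assume "(\<Inter>n. U - F n) \<noteq> {}"
        then obtain x where x: "x \<in> U" "\<And>n. x \<notin> F n" by auto
        have "infdist x (- U) > 0"
          using in_closed_iff_infdist_zero[of "- U" x] U False infdist_nonneg[of x "- U"] x(1)
          by (auto simp: order_less_le)
        then obtain n where "1 / Suc n < infdist x (- U)" using nat_approx_posE by blast
        then show False using x(2)[of n] by (simp add: F_def)
      qed
      moreover have "(\<lambda>n. measure M (U - F n)) \<longlonglongrightarrow> measure M (\<Inter>n. U - F n)"
        by (rule finite_Lim_measure_decseq[OF _ dec]) (use U F in auto)
      ultimately have lim: "(\<lambda>n. measure M (U - F n)) \<longlonglongrightarrow> 0" by (simp only: measure_empty)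
      show ?thesis
      proof (intro allI impI)
        fix e :: real assume "e > 0"
        then have "\<forall>\<^sub>F n in sequentially. measure M (U - F n) < e" using lim by (rule order_tendstoD(2)[rotated])
        then obtain n where "measure M (U - F n) < e" by (auto simp: eventually_sequentially)
        then show "\<exists>F V. closed F \<and> open V \<and> F \<subseteq> U \<and> U \<subseteq> V \<and> measure M (V - F) < e"
          using F FU U by blast
      qed
    qed
  next
    case Empty
    show ?case by (intro allI impI exI[of _ "{}"]) simp
  next
    case (Compl A)
    show ?case
    proof (intro allI impI)
      fix e :: real assume "e > 0"
      with Compl.IH obtain F U where FU: "closed F" "open U" "F \<subseteq> A" "A \<subseteq> U" "measure M (U - F) < e"
        by metis
      have "- F - - U = U - F" by auto
      then show "\<exists>F U. closed F \<and> open U \<and> F \<subseteq> UNIV - A \<and> UNIV - A \<subseteq> U \<and> measure M (U - F) < e"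
        using FU by (intro exI[of _ "- U"] exI[of _ "- F"]) auto
    qed
  next
    case (Union A)
    show ?case
    proof (intro allI impI)
      fix e :: real assume e: "e > 0"
      have "\<exists>F U. closed F \<and> open U \<and> F \<subseteq> A n \<and> A n \<subseteq> U \<and> measure M (U - F) < e / 4 * (1/2) ^ n" for n
        by (rule Union.IH[of n, rule_format]) (use e in simp)
      then obtain F U where FU: "\<And>n. closed (F n)" "\<And>n. open (U n)" "\<And>n. F n \<subseteq> A n" "\<And>n. A n \<subseteq> U n"
        "\<And>n. measure M (U n - F n) < e / 4 * (1/2) ^ n" by metis
      define V where "V = (\<Union>n. U n)"
      define K where "K n = (\<Union>i<n. F i)" for n
      have V: "open V" and K: "closed (K n)" for n
        unfolding V_def K_def using FU(1,2) by auto
      have geo: "(\<lambda>n. e / 4 * (1/2) ^ n) sums (e / 4 * 2)"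
        using geometric_sums[of "1/2::real"] by (intro sums_mult) simp
      have "measure M (V - (\<Union>i. F i)) \<le> measure M (\<Union>n. U n - F n)"
        unfolding V_def using FU(1,2) by (intro finite_measure_mono) auto
      also have "\<dots> \<le> (\<Sum>n. measure M (U n - F n))"
      proof (rule finite_measure_subadditive_countably)
        show "summable (\<lambda>n. measure M (U n - F n))"
          by (rule summable_comparison_test'[OF sums_summable[OF geo]]) (use FU(5) in \<open>auto intro: less_imp_le\<close>)
      qed (use FU(1,2) in auto)
      also have "\<dots> \<le> (\<Sum>n. e / 4 * (1/2) ^ n)"
        using FU(5) by (intro suminf_le summable_comparison_test'[OF sums_summable[OF geo]] sums_summable[OF geo])
          (auto intro: less_imp_le)
      also have "\<dots> = e / 2" using sums_unique[OF geo] by simp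
      finally have half: "measure M (V - (\<Union>i. F i)) < e" using e by simp
      have "decseq (\<lambda>n. V - K n)" by (rule decseq_SucI) (auto simp: K_def)
      then have "(\<lambda>n. measure M (V - K n)) \<longlonglongrightarrow> measure M (\<Inter>n. V - K n)"
        using V K by (intro finite_Lim_measure_decseq) auto
      moreover have "(\<Inter>n. V - K n) = V - (\<Union>i. F i)" unfolding K_def by auto
      ultimately have "\<forall>\<^sub>F n in sequentially. measure M (V - K n) < e"
        using half by (intro order_tendstoD(2)) auto
      then obtain n where "measure M (V - K n) < e" by (auto simp: eventually_sequentially)
      moreover have "K n \<subseteq> (\<Union>i. A i)" "(\<Union>i. A i) \<subseteq> V" unfolding K_def V_def using FU(3,4) by blast+
      ultimately show "\<exists>F U. closed F \<and> open U \<and> F \<subseteq> (\<Union>i. A i) \<and> (\<Union>i. A i) \<subseteq> U \<and> measure M (U - F) < e"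
        using V K by (intro exI[of _ "K n"] exI[of _ V]) simp
    qed
  qed
  then obtain F U where FU: "closed F" "open U" "F \<subseteq> A" "A \<subseteq> U" "measure M (U - F) < e"
    using e by metis
  have "measure M (A - F) \<le> measure M (U - F)" using FU A by (intro finite_measure_mono) auto
  with FU have "measure M (A - F) < e" by simp
  with FU(1,3) show ?thesis by (rule that)
qed

section \<open>The space of invariant measures\<close>

lemma invariant_borel_prob: "\<mu> \<in> invariant_measures f \<Longrightarrow> borel_prob \<mu>"
  by (simp add: invariant_measures_def borel_prob_iff)

lemma invariant_iff_distr:
  assumes M: "borel_prob M" and f: "f \<in> borel_measurable borel"
  shows "M \<in> invariant_measures f \<longleftrightarrow> distr M borel f = M"
proof -
  interpret borel_prob M by fact
  have f': "f \<in> measurable M borel" using f by measurable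
  have md: "measure (distr M borel f) A = measure M (f -` A)" if "A \<in> sets borel" for A
    using measure_distr[OF f' that] by simp
  interpret D: prob_space "distr M borel f" by (rule prob_space_distr[OF f'])
  show ?thesis
  proof
    assume inv: "M \<in> invariant_measures f"
    show "distr M borel f = M"
    proof (rule measure_eqI)
      fix A assume A: "A \<in> sets (distr M borel f)"
      then show "emeasure (distr M borel f) A = emeasure M A"
        using md[of A] invariant_measuresD(4)[OF inv, of A]
        by (simp add: D.emeasure_eq_measure emeasure_eq_measure)
    qed simp
  next
    assume "distr M borel f = M"
    then show "M \<in> invariant_measures f"
      using md prob_space_axioms by (simp add: invariant_measures_def)
  qed
qed

text \<open>Asymptotic invariance of the sequence is enough, which covers both sequences of invariant measures
  and averages along long orbit segments.\<close>
lemma weak_limit_invariant: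
  fixes f :: "'a::metric_space \<Rightarrow> 'a"
  assumes cmp: "compact (UNIV :: 'a set)" and f: "continuous_on UNIV f"
    and M: "borel_prob M" and conv: "weakly_converges Q M"
    and asymp: "\<And>\<phi> :: 'a \<Rightarrow> real. continuous_on UNIV \<phi> \<Longrightarrow>
      (\<lambda>n. integral\<^sup>L (Q n) (\<lambda>x. \<phi> (f x)) - integral\<^sup>L (Q n) \<phi>) \<longlonglongrightarrow> 0"
  shows "M \<in> invariant_measures f"
proof -
  interpret borel_prob M by fact
  have fm: "f \<in> borel_measurable borel" by (rule borel_measurable_continuous_onI[OF f])
  then have fM: "f \<in> measurable M borel" by measurable
  have "distr M borel f = M"
  proof (rule measure_eqI_continuous[OF cmp _ M])
    show "borel_prob (distr M borel f)" using prob_space_distr[OF fM] by (simp add: borel_prob_iff)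
    fix \<phi> :: "'a \<Rightarrow> real" assume \<phi>: "continuous_on UNIV \<phi>"
    have \<phi>f: "continuous_on UNIV (\<lambda>x. \<phi> (f x))" by (rule continuous_on_compose2[OF \<phi> f]) simp
    have "(\<lambda>n. integral\<^sup>L (Q n) (\<lambda>x. \<phi> (f x)) - integral\<^sup>L (Q n) \<phi>)
        \<longlonglongrightarrow> integral\<^sup>L M (\<lambda>x. \<phi> (f x)) - integral\<^sup>L M \<phi>"
      by (intro tendsto_diff weakly_convergesD[OF conv] \<phi> \<phi>f)
    then have "integral\<^sup>L M (\<lambda>x. \<phi> (f x)) - integral\<^sup>L M \<phi> = 0"
      using asymp[OF \<phi>] LIMSEQ_unique by blast
    then show "integral\<^sup>L (distr M borel f) \<phi> = integral\<^sup>L M \<phi>"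
      using integral_distr[OF fM borel_measurable_continuous_onI[OF \<phi>]] by simp
  qed
  then show ?thesis using invariant_iff_distr[OF M fm] by simp
qed

lemma integral_comp_invariant:
  fixes \<phi> :: "'a::topological_space \<Rightarrow> real"
  assumes mu: "\<mu> \<in> invariant_measures f" and f: "f \<in> borel_measurable borel"
    and \<phi>: "\<phi> \<in> borel_measurable borel"
  shows "integral\<^sup>L \<mu> (\<lambda>x. \<phi> ((f ^^ n) x)) = integral\<^sup>L \<mu> \<phi>"
proof (induction n)
  case (Suc n)
  interpret borel_prob \<mu> by (rule invariant_borel_prob[OF mu])
  have f': "f \<in> measurable \<mu> borel" using f by measurable
  have "(\<lambda>x. \<phi> ((f ^^ n) x)) \<in> borel_measurable borel"
    using measurable_compose[OF measurable_funpow[OF f] \<phi>] .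
  then have "integral\<^sup>L (distr \<mu> borel f) (\<lambda>x. \<phi> ((f ^^ n) x)) = integral\<^sup>L \<mu> (\<lambda>x. \<phi> ((f ^^ n) (f x)))"
    by (rule integral_distr[OF f'])
  moreover have "distr \<mu> borel f = \<mu>"
    using invariant_iff_distr[OF invariant_borel_prob[OF mu] f] mu by simp
  ultimately show ?case using Suc by (simp add: funpow_Suc_right del: funpow.simps)
qed simp

theorem invariant_measures_sequentially_compact:
  fixes f :: "'a::metric_space \<Rightarrow> 'a"
  assumes cmp: "compact (UNIV :: 'a set)" and f: "continuous_on UNIV f"
    and Q: "\<And>n. Q n \<in> invariant_measures f"
  obtains r M where "strict_mono (r :: nat \<Rightarrow> nat)" "M \<in> invariant_measures f" "weakly_converges (Q \<circ> r) M"
proof -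
  obtain r M where r: "strict_mono (r :: nat \<Rightarrow> nat)" "borel_prob M" "weakly_converges (Q \<circ> r) M"
    by (rule weak_sequential_compactness[OF cmp invariant_borel_prob[OF Q]])
  have "M \<in> invariant_measures f"
  proof (rule weak_limit_invariant[OF cmp f r(2,3)])
    fix \<phi> :: "'a \<Rightarrow> real" assume "continuous_on UNIV \<phi>"
    then have "integral\<^sup>L ((Q \<circ> r) n) (\<lambda>x. \<phi> (f x)) = integral\<^sup>L ((Q \<circ> r) n) \<phi>" for n
      using integral_comp_invariant[OF Q, of \<phi> _ 1] f by (simp add: borel_measurable_continuous_onI)
    then show "(\<lambda>n. integral\<^sup>L ((Q \<circ> r) n) (\<lambda>x. \<phi> (f x)) - integral\<^sup>L ((Q \<circ> r) n) \<phi>) \<longlonglongrightarrow> 0"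
      by simp
  qed
  with r show ?thesis using that by blast
qed

subsection \<open>Convex combinations\<close>

text \<open>The combination is the mixture of \<open>P\<close> and \<open>Q\<close> over a Bernoulli variable.\<close>
lemma convex_combination_exists:
  fixes P Q :: "'a::topological_space measure"
  assumes P: "borel_prob P" and Q: "borel_prob Q" and s: "0 \<le> s" "s \<le> 1"
  obtains N where "borel_prob N"
    "\<And>A. A \<in> sets borel \<Longrightarrow> measure N A = s * measure P A + (1 - s) * measure Q A"
    "\<And>\<phi> :: 'a \<Rightarrow> real. \<phi> \<in> borel_measurable borel \<Longrightarrow> bounded (range \<phi>) \<Longrightarrow>
       integral\<^sup>L N \<phi> = s * integral\<^sup>L P \<phi> + (1 - s) * integral\<^sup>L Q \<phi>"
proof -
  interpret P: borel_prob P by fact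
  interpret Q: borel_prob Q by fact
  let ?B = "measure_pmf (bernoulli_pmf s)" and ?K = "\<lambda>b. if b then P else Q"
  have K: "?K \<in> measurable ?B (subprob_algebra borel)"
  proof -
    have "P \<in> space (subprob_algebra borel)" "Q \<in> space (subprob_algebra borel)"
      using P.prob_space_axioms Q.prob_space_axioms
      by (simp_all add: space_subprob_algebra prob_space_imp_subprob_space)
    then show ?thesis unfolding measurable_pmf_measure1 by simp
  qed
  define N where "N = ?B \<bind> ?K"
  have N: "borel_prob N"
    unfolding borel_prob_iff N_def
  proof
    show "prob_space (?B \<bind> ?K)"
      by (rule measure_pmf.prob_space_bind[OF _ K]) (simp add: P.prob_space_axioms Q.prob_space_axioms)
    show "sets (?B \<bind> ?K) = sets borel"
      by (rule sets_bind) simp_all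
  qed
  have int: "integral\<^sup>L N \<phi> = s * integral\<^sup>L P \<phi> + (1 - s) * integral\<^sup>L Q \<phi>"
    if \<phi>: "\<phi> \<in> borel_measurable borel" "bounded (range \<phi>)" for \<phi> :: "'a \<Rightarrow> real"
  proof -
    obtain C where C: "\<And>x. \<bar>\<phi> x\<bar> \<le> C" using \<phi>(2) by (auto simp: bounded_iff)
    have "integral\<^sup>L N \<phi> = (\<integral>b. integral\<^sup>L (?K b) \<phi> \<partial>?B)"
      unfolding N_def
      by (rule integral_bind[OF \<phi>(1) C K, where B' = 1])
         (auto simp: measure_pmf.finite_measure_axioms P.emeasure_space_1 Q.emeasure_space_1 P.emeasure_eq_measure Q.emeasure_eq_measure)
    also have "\<dots> = s * integral\<^sup>L P \<phi> + (1 - s) * integral\<^sup>L Q \<phi>"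
      using s by (subst integral_measure_pmf_real[where A = UNIV]) (auto simp: UNIV_bool mult.commute)
    finally show ?thesis .
  qed
  have "measure N A = s * measure P A + (1 - s) * measure Q A" if A: "A \<in> sets borel" for A
  proof -
    interpret N: borel_prob N by (rule N)
    have "bounded (range (indicator A :: 'a \<Rightarrow> real))" by (rule boundedI[of _ 1]) (auto simp: indicator_def)
    with int[of "indicator A"] A show ?thesis by simp
  qed
  with N int show ?thesis using that by blast
qed

lemma integral_convex_combination:
  fixes P Q N :: "'a::topological_space measure" and \<phi> :: "'a \<Rightarrow> real"
  assumes P: "borel_prob P" and Q: "borel_prob Q" and N: "borel_prob N" and s: "0 \<le> s" "s \<le> 1"
    and comb: "\<And>A. A \<in> sets borel \<Longrightarrow> measure N A = s * measure P A + (1 - s) * measure Q A"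
    and \<phi>: "\<phi> \<in> borel_measurable borel" "bounded (range \<phi>)"
  shows "integral\<^sup>L N \<phi> = s * integral\<^sup>L P \<phi> + (1 - s) * integral\<^sup>L Q \<phi>"
proof -
  obtain N' where N': "borel_prob N'"
    "\<And>A. A \<in> sets borel \<Longrightarrow> measure N' A = s * measure P A + (1 - s) * measure Q A"
    "integral\<^sup>L N' \<phi> = s * integral\<^sup>L P \<phi> + (1 - s) * integral\<^sup>L Q \<phi>"
    using convex_combination_exists[OF P Q s] \<phi> by metis
  interpret N: borel_prob N by fact
  interpret N': borel_prob N' by fact
  have "N = N'"
    by (rule measure_eqI) (use N'(2) comb in \<open>auto simp: N.emeasure_eq_measure N'.emeasure_eq_measure\<close>)
  with N'(3) show ?thesis by simp
qed

section \<open>Separated sets and pressure\<close>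

definition birkhoff_sum :: "('a \<Rightarrow> 'a) \<Rightarrow> ('a \<Rightarrow> real) \<Rightarrow> nat \<Rightarrow> 'a \<Rightarrow> real" where
  "birkhoff_sum f \<phi> n x = (\<Sum>i<n. \<phi> ((f ^^ i) x))"

lemma continuous_on_funpow:
  fixes f :: "'a::topological_space \<Rightarrow> 'a"
  assumes "continuous_on UNIV f"
  shows "continuous_on UNIV (f ^^ n)"
  by (induction n) (auto simp: comp_def intro: continuous_on_compose2[OF assms])

lemma continuous_birkhoff_sum:
  fixes f :: "'a::topological_space \<Rightarrow> 'a"
  assumes "continuous_on UNIV f" "continuous_on UNIV \<phi>"
  shows "continuous_on UNIV (birkhoff_sum f \<phi> n)"
  unfolding birkhoff_sum_def
  by (intro continuous_intros continuous_on_compose2[OF assms(2) continuous_on_funpow[OF assms(1)]]) auto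

lemma birkhoff_sum_le:
  assumes "\<And>x. \<phi> x \<le> B"
  shows "birkhoff_sum f \<phi> n x \<le> n * B"
  unfolding birkhoff_sum_def using sum_bounded_above[of "{..<n}" "\<lambda>i. \<phi> ((f ^^ i) x)" B] assms by simp

text \<open>Label each point by a nearby centre of a finite net of mesh \<open>e / 2\<close>. Points of a separated set
  have different itineraries of length \<open>n\<close>, and there are finitely many of these.\<close>
lemma dyn_separated_card_bound:
  fixes f :: "'a::metric_space \<Rightarrow> 'a"
  assumes cmp: "compact (UNIV :: 'a set)" and e: "e > 0"
  shows "\<exists>N. \<forall>E. finite E \<longrightarrow> dyn_separated f n e E \<longrightarrow> card E \<le> N"
proof -
  obtain T :: "'a set" where T: "finite T" "\<And>x. \<exists>c\<in>T. dist x c < e / 2"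
    using compact_UNIV_finite_cover[OF cmp, of "e/2"] e by auto
  then obtain t where t: "\<And>x. t x \<in> T" "\<And>x. dist x (t x) < e / 2" by metis
  let ?L = "{l. set l \<subseteq> T \<and> length l = n}"
  have "card E \<le> card ?L" if E: "finite E" "dyn_separated f n e E" for E
  proof (rule card_inj_on_le[of "itinerary f n t"])
    show "inj_on (itinerary f n t) E"
    proof (rule inj_onI, rule ccontr)
      fix x y assume xy: "x \<in> E" "y \<in> E" "itinerary f n t x = itinerary f n t y" "x \<noteq> y"
      then obtain i where i: "i < n" "dist ((f ^^ i) x) ((f ^^ i) y) > e"
        using E(2) unfolding dyn_separated_def by blast
      have "t ((f ^^ i) x) = t ((f ^^ i) y)" using xy(3) i(1) by (simp add: itinerary_eq_iff)
      with t(2)[of "(f ^^ i) x"] t(2)[of "(f ^^ i) y"]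
        dist_triangle2[of "(f ^^ i) x" "(f ^^ i) y" "t ((f ^^ i) x)"]
      have "dist ((f ^^ i) x) ((f ^^ i) y) < e" by simp
      with i show False by simp
    qed
    show "itinerary f n t ` E \<subseteq> ?L" using t(1) by (auto simp: itinerary_def)
    show "finite ?L" by (rule finite_lists_length_eq[OF T(1)])
  qed
  then show ?thesis by blast
qed

context
  fixes f :: "'a::metric_space \<Rightarrow> 'a" and \<phi> :: "'a \<Rightarrow> real"
  assumes cmp: "compact (UNIV :: 'a set)" and f: "continuous_on UNIV f" and \<phi>: "continuous_on UNIV \<phi>"
begin

abbreviation (input) "Z n e \<equiv> separated_partition_function f \<phi> n e"
abbreviation (input) "pressure_at e \<equiv> limsup (\<lambda>n. ereal (ln (Z n e) / real n))"

lemma separated_sums_bdd_above: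
  assumes e: "e > 0"
  shows "bdd_above ((\<lambda>E. \<Sum>x\<in>E. exp (\<Sum>i<n. \<phi> ((f ^^ i) x))) ` {E. finite E \<and> dyn_separated f n e E})"
proof -
  obtain N where N: "\<And>E. finite E \<Longrightarrow> dyn_separated f n e E \<Longrightarrow> card E \<le> N"
    using dyn_separated_card_bound[OF cmp e] by metis
  obtain B where B: "\<And>x. \<bar>\<phi> x\<bar> \<le> B"
    using compact_imp_bounded[OF compact_continuous_image[OF \<phi> cmp]] by (auto simp: bounded_iff)
  have "\<phi> x \<le> B" for x using B[of x] by simp
  then have S: "(\<Sum>i<n. \<phi> ((f ^^ i) x)) \<le> n * B" for x
    using birkhoff_sum_le[of \<phi> B f n x] by (simp add: birkhoff_sum_def)
  show ?thesis
  proof (rule bdd_aboveI2)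
    fix E assume "E \<in> {E. finite E \<and> dyn_separated f n e E}"
    then have E: "card E \<le> N" using N by blast
    have "(\<Sum>x\<in>E. exp (\<Sum>i<n. \<phi> ((f ^^ i) x))) \<le> card E * exp (n * B)"
      using sum_bounded_above[of E "\<lambda>x. exp (\<Sum>i<n. \<phi> ((f ^^ i) x))" "exp (n * B)"] S by simp
    also have "\<dots> \<le> N * exp (n * B)" using E by simp
    finally show "(\<Sum>x\<in>E. exp (\<Sum>i<n. \<phi> ((f ^^ i) x))) \<le> N * exp (n * B)" .
  qed
qed

lemma separated_sum_le:
  assumes "e > 0" "finite E" "dyn_separated f n e E"
  shows "(\<Sum>x\<in>E. exp (birkhoff_sum f \<phi> n x)) \<le> Z n e"
  unfolding separated_partition_function_def birkhoff_sum_def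
  by (rule cSUP_upper[OF _ separated_sums_bdd_above]) (use assms in auto)

lemma separated_partition_function_pos:
  assumes "e > 0"
  shows "Z n e > 0"
proof -
  have "0 < (\<Sum>x\<in>{undefined}. exp (birkhoff_sum f \<phi> n x))" by simp
  also have "\<dots> \<le> Z n e" by (rule separated_sum_le[OF assms]) (auto simp: dyn_separated_def)
  finally show ?thesis .
qed

lemma pressure_at_antimono:
  assumes "0 < d" "d \<le> e"
  shows "pressure_at e \<le> pressure_at d"
proof (rule Limsup_mono, rule always_eventually, rule allI)
  fix n
  have "Z n e \<le> Z n d"
    unfolding separated_partition_function_def
  proof (rule cSUP_subset_mono)
    show "{E. finite E \<and> dyn_separated f n e E} \<noteq> {}" by (auto simp: dyn_separated_def intro!: exI[of _ "{}"])
    show "{E. finite E \<and> dyn_separated f n e E} \<subseteq> {E. finite E \<and> dyn_separated f n d E}"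
      using assms by (fastforce simp: dyn_separated_def)
  qed (use separated_sums_bdd_above assms in auto)
  then show "ereal (ln (Z n e) / real n) \<le> ereal (ln (Z n d) / real n)"
    using separated_partition_function_pos[of e n] assms by (simp add: divide_right_mono)
qed

text \<open>A smaller \<open>e\<close> admits more separated sets, so the limit at 0 is a monotone limit.\<close>
lemma topological_pressure_eq_SUP: "topological_pressure f \<phi> = (SUP e\<in>{0<..}. pressure_at e)"
  unfolding topological_pressure_def
proof (rule tendsto_Lim)
  show "((\<lambda>e. pressure_at e) \<longlongrightarrow> (SUP e\<in>{0<..}. pressure_at e)) (at_right 0)"
  proof (rule order_tendstoI)
    fix a assume "a < (SUP e\<in>{0<..}. pressure_at e)"
    then obtain e where e: "e > 0" "a < pressure_at e" by (auto simp: less_SUP_iff)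
    then have "\<forall>d. 0 < d \<and> d < e \<longrightarrow> a < pressure_at d"
      using pressure_at_antimono[of _ e] by (auto intro: less_le_trans)
    then show "\<forall>\<^sub>F d in at_right 0. a < pressure_at d"
      using e(1) by (auto simp: eventually_at_right_field)
  next
    fix a assume a: "(SUP e\<in>{0<..}. pressure_at e) < a"
    have "pressure_at e < a" if "e > 0" for e
      using SUP_upper[of e "{0<..}" "\<lambda>e. pressure_at e"] that a by (auto intro: le_less_trans)
    then show "\<forall>\<^sub>F e in at_right 0. pressure_at e < a"
      by (auto simp: eventually_at_right_field intro!: exI[of _ 1])
  qed
qed simp

text \<open>A separated set of maximal cardinality cannot be enlarged, hence it spans.\<close>
lemma maximal_separated_set:
  assumes e: "e > 0"
  obtains E where "finite E" "dyn_separated f n e E"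
    "\<And>x. \<exists>y\<in>E. \<forall>i<n. dist ((f ^^ i) x) ((f ^^ i) y) \<le> e"
proof -
  let ?P = "\<lambda>k. \<exists>E. finite E \<and> dyn_separated f n e E \<and> card E = k"
  obtain N where N: "\<And>E. finite E \<Longrightarrow> dyn_separated f n e E \<Longrightarrow> card E \<le> N"
    using dyn_separated_card_bound[OF cmp e] by metis
  have "?P 0" by (intro exI[of _ "{}"]) (simp add: dyn_separated_def)
  moreover have "\<And>k. ?P k \<Longrightarrow> k \<le> N" using N by auto
  ultimately obtain k where k: "?P k" "\<And>j. ?P j \<Longrightarrow> j \<le> k"
    using GreatestI_nat[of ?P 0 N] Greatest_le_nat[of ?P _ N] by blast
  then obtain E where E: "finite E" "dyn_separated f n e E" "card E = k" by blast
  have "\<exists>y\<in>E. \<forall>i<n. dist ((f ^^ i) x) ((f ^^ i) y) \<le> e" for x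
  proof (rule ccontr)
    assume "\<not> ?thesis"
    then have far: "\<And>y. y \<in> E \<Longrightarrow> \<exists>i<n. dist ((f ^^ i) x) ((f ^^ i) y) > e" by (meson not_le)
    then have "x \<notin> E" using e by fastforce
    have "dyn_separated f n e (insert x E)"
      using E(2) far unfolding dyn_separated_def by (auto simp: dist_commute)
    then have "?P (Suc k)" using E \<open>x \<notin> E\<close> by (intro exI[of _ "insert x E"]) simp
    then show False using k(2) by fastforce
  qed
  with E show ?thesis using that by blast
qed

end

section \<open>Measure pressure is bounded by topological pressure\<close>

lemma (in prob_on_UNIV) expectation_label:
  fixes g :: "'b \<Rightarrow> real"
  assumes c: "simple_function M c"
  shows "integrable M (\<lambda>x. g (c x))"
    and "expectation (\<lambda>x. g (c x)) = (\<Sum>v\<in>range c. prob (c -` {v}) * g v)"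
proof -
  have eq: "g (c x) = (\<Sum>v\<in>range c. indicator (c -` {v}) x * g v)" for x
  proof -
    have "(\<Sum>v\<in>range c. indicator (c -` {v}) x * g v) = (\<Sum>v\<in>range c. if v = c x then g v else 0)"
      by (intro sum.cong) (auto simp: indicator_def)
    then show ?thesis using finite_range_label[OF c] by simp
  qed
  have int: "integrable M (\<lambda>x. indicator (c -` {v}) x * g v)" for v
    using fibre_sets[OF c] by (intro integrable_mult_left) (simp add: emeasure_eq_measure)
  show "integrable M (\<lambda>x. g (c x))" unfolding eq using int by (rule Bochner_Integration.integrable_sum)
  show "expectation (\<lambda>x. g (c x)) = (\<Sum>v\<in>range c. prob (c -` {v}) * g v)"
    unfolding eq using int fibre_sets[OF c] by (simp add: Bochner_Integration.integral_sum)
qed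

text \<open>An explicit form of the continuity of \<open>x ln x\<close> at 0.\<close>
lemma neg_mult_ln_le_sqrt:
  fixes x :: real
  assumes "x \<ge> 0"
  shows "- x * ln x \<le> 2 * sqrt x"
proof (cases "x = 0")
  case False
  then have x: "x > 0" "sqrt x > 0" using assms by auto
  have "ln (1 / sqrt x) \<le> 1 / sqrt x - 1" using x by (intro ln_le_minus_one) auto
  then have "- ln x \<le> 2 * (1 / sqrt x)" using x by (simp add: ln_div ln_sqrt)
  then have "x * - ln x \<le> x * (2 * (1 / sqrt x))" using x by (intro mult_left_mono) auto
  also have "\<dots> = 2 * sqrt x" using x by (simp add: field_simps flip: power2_eq_square)
  finally show ?thesis by simp
qed simp

text \<open>The labelling \<open>if x \<in> B (c x) then Some (c x) else None\<close> remembers \<open>c\<close> on closed cores of its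
  fibres and forgets it on a set of small measure. So \<open>c\<close> has little entropy conditional on it,
  while its values other than \<open>None\<close> are taken on sets with positive mutual distance. The bound 1
  suffices because \<open>c\<close> will be an itinerary of length \<open>N\<close>, and its entropy is divided by \<open>N\<close>.\<close>
lemma closed_core_labelling:
  fixes c :: "'a::metric_space \<Rightarrow> 'b"
  assumes "borel_prob M" and c: "simple_function borel c"
  obtains B where "\<And>v. closed (B v)" "\<And>v. B v \<subseteq> c -` {v}"
    "simple_function borel (\<lambda>x. if x \<in> B (c x) then Some (c x) else None)"
    "label_entropy M (\<lambda>x. (c x, if x \<in> B (c x) then Some (c x) else None))
      - label_entropy M (\<lambda>x. if x \<in> B (c x) then Some (c x) else None) \<le> 1"
proof -
  interpret borel_prob M by fact
  define R where "R = range c"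
  have R: "finite R" unfolding R_def using simple_functionD(1)[OF c] by simp
  have fib: "c -` {v} \<in> sets borel" for v using simple_functionD(2)[OF c, of "{v}"] by simp
  have k: "card R > 0" using R by (auto simp: R_def card_gt_0_iff)
  \<comment> \<open>chosen such that \<open>2 * sqrt d\<close> is the share \<open>1 / card R\<close> of each fibre\<close>
  define d where "d = (1 / (2 * card R))\<^sup>2"
  have d: "d > 0" using k by (simp add: d_def)
  have small: "- x * ln x \<le> 1 / card R" if "0 \<le> x" "x \<le> d" for x
  proof -
    have "sqrt x \<le> sqrt d" using that by simp
    also have "\<dots> = 1 / (2 * card R)" by (simp add: d_def)
    finally show ?thesis using neg_mult_ln_le_sqrt[OF that(1)] by simp
  qed
  have "\<exists>F. closed F \<and> F \<subseteq> c -` {v} \<and> measure M (c -` {v} - F) < d" for v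
    using closed_inner_regular[OF assms(1) fib[of v] d] by metis
  then obtain B where B: "\<And>v. closed (B v)" "\<And>v. B v \<subseteq> c -` {v}" "\<And>v. measure M (c -` {v} - B v) < d"
    by metis
  define b where "b x = (if x \<in> B (c x) then Some (c x) else None)" for x
  have D: "c x = v" if "x \<in> B v" for x v using B(2)[of v] that by auto
  have bS: "b x = Some v \<longleftrightarrow> x \<in> B v" for x v
    by (cases "x \<in> B v") (auto simp: b_def dest: D)
  have fSome: "b -` {Some v} = B v" for v by (auto simp: bS)
  have fNone: "b -` {None} = - (\<Union>v\<in>R. B v)"
  proof (rule set_eqI)
    fix x
    have "x \<in> B (c x) \<longleftrightarrow> (\<exists>v\<in>R. x \<in> B v)" unfolding R_def by (metis D rangeI)
    then show "x \<in> b -` {None} \<longleftrightarrow> x \<in> - (\<Union>v\<in>R. B v)" by (simp add: b_def)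
  qed
  have rb: "range b \<subseteq> insert None (Some ` R)" by (auto simp: b_def R_def)
  have Bs: "B v \<in> sets borel" for v using B(1) by (rule borel_closed)
  have sb: "simple_function borel b"
    unfolding simple_function_def
  proof (intro conjI ballI)
    show "finite (b ` space borel)" using rb R by (auto intro: finite_subset)
    show "b -` {y} \<inter> space borel \<in> sets borel" for y
    proof (cases y)
      case None
      have "(\<Union>v\<in>R. B v) \<in> sets borel" using Bs R by (intro sets.finite_UN) auto
      then show ?thesis unfolding None fNone by (simp only: space_borel Int_UNIV_right borel_comp)
    qed (simp add: fSome Bs)
  qed
  let ?h = "\<lambda>x::real. x * ln x"
  let ?cb = "\<lambda>x. (c x, b x)"
  let ?S1 = "(\<lambda>v. (v, Some v)) ` R" and ?S2 = "(\<lambda>v. (v, None)) ` R"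
  have f1: "?cb -` {(v, Some v)} = B v" for v by (auto simp: bS dest: D)
  have f2: "?cb -` {(v, None)} = c -` {v} - B v" for v by (auto simp: b_def split: if_splits)
  have "label_entropy M ?cb = - (\<Sum>y\<in>?S1 \<union> ?S2. ?h (measure M (?cb -` {y})))"
    by (rule label_entropy_superset) (use R in \<open>auto simp: b_def R_def\<close>)
  also have "(\<Sum>y\<in>?S1 \<union> ?S2. ?h (measure M (?cb -` {y})))
      = (\<Sum>y\<in>?S1. ?h (measure M (?cb -` {y}))) + (\<Sum>y\<in>?S2. ?h (measure M (?cb -` {y})))"
    using R by (intro sum.union_disjoint) auto
  also have "\<dots> = (\<Sum>v\<in>R. ?h (measure M (B v))) + (\<Sum>v\<in>R. ?h (measure M (c -` {v} - B v)))"
    by (simp add: sum.reindex inj_on_def f1 f2)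
  finally have Hcb: "label_entropy M ?cb
      = - ((\<Sum>v\<in>R. ?h (measure M (B v))) + (\<Sum>v\<in>R. ?h (measure M (c -` {v} - B v))))" .
  have "label_entropy M b = - (\<Sum>y\<in>insert None (Some ` R). ?h (measure M (b -` {y})))"
    by (rule label_entropy_superset) (use rb R in auto)
  also have "(\<Sum>y\<in>insert None (Some ` R). ?h (measure M (b -` {y})))
      = ?h (measure M (b -` {None})) + (\<Sum>v\<in>R. ?h (measure M (B v)))"
    using R by (simp add: sum.reindex fSome)
  finally have Hb: "label_entropy M b
      = - (?h (measure M (b -` {None})) + (\<Sum>v\<in>R. ?h (measure M (B v))))" .
  have "?h p \<le> 0" if "0 \<le> p" "p \<le> 1" for p :: real
    using that by (cases "p = 0") (auto intro!: mult_nonneg_nonpos)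
  then have "?h (measure M (b -` {None})) \<le> 0" by simp
  moreover have "- (\<Sum>v\<in>R. ?h (measure M (c -` {v} - B v))) \<le> 1"
  proof -
    have "- (\<Sum>v\<in>R. ?h (measure M (c -` {v} - B v))) = (\<Sum>v\<in>R. - measure M (c -` {v} - B v) * ln (measure M (c -` {v} - B v)))"
      by (simp add: sum_negf)
    also have "\<dots> \<le> (\<Sum>v\<in>R. 1 / card R)"
      using B(3) by (intro sum_mono small) (auto intro: less_imp_le)
    also have "\<dots> = 1" using k by simp
    finally show ?thesis .
  qed
  ultimately have "label_entropy M ?cb - label_entropy M b \<le> 1" unfolding Hcb Hb by simp
  with B(1,2) sb show ?thesis unfolding b_def by (rule that)
qed


lemma itinerary_block:
  "itinerary f (m * N) c x = concat (itinerary (f ^^ N) m (itinerary f N c) x)"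
proof (induction m)
  case (Suc m)
  have "Suc m * N = m * N + N" by simp
  then have "itinerary f (Suc m * N) c x = itinerary f (m * N) c x @ itinerary f N c ((f ^^ (m * N)) x)"
    by (simp only: itinerary_add)
  moreover have "((f ^^ N) ^^ m) x = (f ^^ (m * N)) x" by (simp add: funpow_mult mult.commute)
  ultimately show ?case using Suc by (simp add: itinerary_def[of "f ^^ N"])
qed simp

lemma itinerary_Suc: "itinerary f (Suc m) c x = itinerary f m c x @ [c ((f ^^ m) x)]"
  by (simp add: itinerary_def)

text \<open>By invariance every block of length \<open>N\<close> has the same entropy conditional on its core.\<close>
lemma relative_block_entropy:
  fixes N m :: nat
  assumes mu: "\<mu> \<in> invariant_measures f" and f: "f \<in> borel_measurable borel"
    and z: "simple_function borel z" and b: "simple_function borel b"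
  defines "g \<equiv> f ^^ N"
  shows "label_entropy \<mu> (\<lambda>x. (itinerary g m z x, itinerary g m b x)) - label_entropy \<mu> (itinerary g m b)
    \<le> m * (label_entropy \<mu> (\<lambda>x. (z x, b x)) - label_entropy \<mu> b)"
proof (induction m)
  case 0
  interpret borel_prob \<mu> by (rule invariant_borel_prob[OF mu])
  show ?case using prob_space by (simp add: label_entropy_def itinerary_def)
next
  case (Suc m)
  interpret borel_prob \<mu> by (rule invariant_borel_prob[OF mu])
  note sf = simple_function_borel_iff[OF sets_borel]
  have g: "g \<in> borel_measurable borel" unfolding g_def by (rule measurable_funpow[OF f])
  have gm: "g ^^ m = f ^^ (N * m)" by (simp add: g_def funpow_mult mult.commute)
  let ?a = "itinerary g m z" and ?c = "itinerary g m b"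
  let ?z = "\<lambda>x. z ((g ^^ m) x)" and ?b = "\<lambda>x. b ((g ^^ m) x)"
  have sa: "simple_function \<mu> ?a" and sc: "simple_function \<mu> ?c"
    and sz: "simple_function \<mu> ?z" and sb: "simple_function \<mu> ?b"
    unfolding sf using z b g measurable_funpow[OF g]
    by (auto intro: simple_function_itinerary simple_function_measurable_comp)
  have si: "simple_function \<mu> (itinerary g k b)" for k
    unfolding sf by (rule simple_function_itinerary[OF b g])
  have "label_entropy \<mu> (\<lambda>x. (itinerary g (Suc m) z x, itinerary g (Suc m) b x))
      = label_entropy \<mu> (\<lambda>x. ((?a x, ?z x), (?c x, ?b x)))"
    by (rule label_entropy_eq_of_factors
        [where g = "\<lambda>(l, l'). ((butlast l, last l), (butlast l', last l'))"
           and h = "\<lambda>((a, z), (c, b)). (a @ [z], c @ [b])"])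
       (auto simp: itinerary_Suc intro!: simple_function_Pair sa sc sz sb simple_function_compose2[OF sa sz] simple_function_compose2[OF sc sb])
  moreover have "label_entropy \<mu> (itinerary g (Suc m) b) = label_entropy \<mu> (\<lambda>x. (?c x, ?b x))"
    by (rule label_entropy_eq_of_factors[where g = "\<lambda>l. (butlast l, last l)" and h = "\<lambda>(c, b). c @ [b]"])
       (auto simp: itinerary_Suc sc sb si)
  moreover have "label_entropy \<mu> (\<lambda>x. ((?a x, ?z x), (?c x, ?b x))) - label_entropy \<mu> (\<lambda>x. (?c x, ?b x))
      \<le> (label_entropy \<mu> (\<lambda>x. (?a x, ?c x)) - label_entropy \<mu> ?c)
        + (label_entropy \<mu> (\<lambda>x. (?z x, ?b x)) - label_entropy \<mu> ?b)"
    by (rule conditional_label_entropy_subadditive[OF sa sz sc sb])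
  moreover have "label_entropy \<mu> ?b = label_entropy \<mu> b"
    unfolding gm by (rule label_entropy_funpow[OF mu f b])
  moreover have "label_entropy \<mu> (\<lambda>x. (?z x, ?b x)) = label_entropy \<mu> (\<lambda>x. (z x, b x))"
    unfolding gm by (rule label_entropy_funpow[OF mu f simple_function_Pair[OF z b]])
  ultimately show ?case using Suc by (simp add: algebra_simps)
qed

text \<open>Each itinerary of blocks is represented by a point \<open>p u\<close> at which the Birkhoff sum is almost
  maximal, and \<open>p u\<close> is shadowed by a point of a maximal separated set. A point of the separated set
  shadows at most \<open>2\<^sup>m\<close> itineraries: in every block the label is \<open>None\<close> or the only other label
  that occurs within distance \<open>e\<close> of its orbit. Gibbs' inequality turns this count into an entropy bound.\<close>
lemma separated_block_estimate:
  fixes f :: "'a::metric_space \<Rightarrow> 'a" and b :: "'a \<Rightarrow> 'b option"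
  assumes cmp: "compact (UNIV :: 'a set)" and f: "continuous_on UNIV f" and \<phi>: "continuous_on UNIV \<phi>"
    and mu: "\<mu> \<in> invariant_measures f" and b: "simple_function borel b" and e: "e > 0"
    and sep: "\<And>x y. b x \<noteq> None \<Longrightarrow> b y \<noteq> None \<Longrightarrow> b x \<noteq> b y \<Longrightarrow> dist x y > 2 * e"
    and \<kappa>: "\<And>x y. dist x y \<le> e \<Longrightarrow> \<phi> x \<le> \<phi> y + \<kappa>"
    and N: "N \<ge> 1"
  shows "label_entropy \<mu> (itinerary (f ^^ N) m b) + (m * N) * integral\<^sup>L \<mu> \<phi>
    \<le> m * ln 2 + (m * N) * \<kappa> + 1 + ln (separated_partition_function f \<phi> (m * N) e)"
proof -
  interpret borel_prob \<mu> by (rule invariant_borel_prob[OF mu])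
  note sf = simple_function_borel_iff[OF sets_borel]
  have fm: "f \<in> borel_measurable borel" by (rule borel_measurable_continuous_onI[OF f])
  define n where "n = m * N"
  define w where "w = itinerary (f ^^ N) m b"
  define S where "S = birkhoff_sum f \<phi> n"
  have w: "simple_function \<mu> w"
    unfolding w_def sf by (rule simple_function_itinerary[OF b measurable_funpow[OF fm]])
  have finR: "finite (range w)" by (rule finite_range_label[OF w])
  obtain E where E: "finite E" "dyn_separated f n e E"
    "\<And>x. \<exists>y\<in>E. \<forall>i<n. dist ((f ^^ i) x) ((f ^^ i) y) \<le> e"
    by (rule maximal_separated_set[OF cmp f \<phi> e, where n = n], rule that; assumption)
  obtain C where C: "\<And>x. \<bar>\<phi> x\<bar> \<le> C"
    using compact_imp_bounded[OF compact_continuous_image[OF \<phi> cmp]] by (auto simp: bounded_iff)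
  have SC: "S x \<le> n * C" for x
    unfolding S_def by (rule birkhoff_sum_le) (use C abs_le_iff in blast)
  \<comment> \<open>the supremum over a fibre need not be attained; the error 1 disappears after division by \<open>n\<close>\<close>
  have "\<exists>x. w x = u \<and> (\<forall>y. w y = u \<longrightarrow> S y \<le> S x + 1)" if u: "u \<in> range w" for u
  proof -
    let ?T = "S ` (w -` {u})"
    have ne: "?T \<noteq> {}" using u by auto
    have bdd: "bdd_above ?T" using SC by (intro bdd_aboveI2[where M = "n * C"])
    obtain t where t: "t \<in> ?T" "Sup ?T - 1 < t"
      using less_cSupE[of "Sup ?T - 1" ?T] ne by auto
    then obtain x where x: "w x = u" "t = S x" by auto
    have "S y \<le> S x + 1" if "w y = u" for y
      using cSup_upper[of "S y" ?T] bdd that t(2) x by force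
    with x show ?thesis by blast
  qed
  then obtain p where p: "\<And>u. u \<in> range w \<Longrightarrow> w (p u) = u"
    "\<And>u y. u \<in> range w \<Longrightarrow> w y = u \<Longrightarrow> S y \<le> S (p u) + 1" by metis
  obtain q where q: "\<And>x. q x \<in> E" "\<And>x i. i < n \<Longrightarrow> dist ((f ^^ i) x) ((f ^^ i) (q x)) \<le> e"
    using E(3) by metis
  define y where "y u = q (p u)" for u
  define A where "A u = S (p u) + 1" for u
  have intS: "integral\<^sup>L \<mu> S = n * integral\<^sup>L \<mu> \<phi>"
  proof -
    have "integrable \<mu> (\<lambda>x. \<phi> ((f ^^ i) x))" for i
      by (rule continuous_integrable[OF cmp continuous_on_compose2[OF \<phi> continuous_on_funpow[OF f]]]) simp
    then have "integral\<^sup>L \<mu> S = (\<Sum>i<n. integral\<^sup>L \<mu> (\<lambda>x. \<phi> ((f ^^ i) x)))"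
      unfolding S_def birkhoff_sum_def by (rule Bochner_Integration.integral_sum)
    then show ?thesis
      using integral_comp_invariant[OF mu fm borel_measurable_continuous_onI[OF \<phi>]] by simp
  qed
  have "integral\<^sup>L \<mu> S \<le> expectation (\<lambda>x. A (w x))"
  proof (rule integral_mono)
    show "integrable \<mu> S"
      unfolding S_def by (rule continuous_integrable[OF cmp continuous_birkhoff_sum[OF f \<phi>]])
    show "integrable \<mu> (\<lambda>x. A (w x))" by (rule expectation_label(1)[OF w])
    show "S x \<le> A (w x)" for x unfolding A_def by (rule p(2)) auto
  qed
  also have "\<dots> = (\<Sum>u\<in>range w. prob (w -` {u}) * A u)" by (rule expectation_label(2)[OF w])
  finally have energy: "n * integral\<^sup>L \<mu> \<phi> \<le> (\<Sum>u\<in>range w. prob (w -` {u}) * A u)" using intS by simp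
  have shadow: "S (p u) \<le> S (y u) + n * \<kappa>" for u
  proof -
    have "S (p u) \<le> (\<Sum>i<n. \<phi> ((f ^^ i) (y u)) + \<kappa>)"
      unfolding S_def birkhoff_sum_def y_def by (intro sum_mono \<kappa> q(2)) simp
    then show ?thesis by (simp add: S_def birkhoff_sum_def sum.distrib)
  qed
  have mult: "card {u \<in> range w. y u = x} \<le> 2 ^ m" for x
  proof -
    let ?L = "{l :: bool list. set l \<subseteq> UNIV \<and> length l = m}"
    have len: "length u = m" if "u \<in> range w" for u using that by (auto simp: w_def itinerary_def)
    \<comment> \<open>an itinerary shadowed by \<open>x\<close> is determined by the positions of its \<open>None\<close>s\<close>
    have "inj_on (map (\<lambda>v. v = None)) {u \<in> range w. y u = x}"
    proof (rule inj_onI)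
      fix u v assume uv: "u \<in> {u \<in> range w. y u = x}" "v \<in> {u \<in> range w. y u = x}"
        and eq: "map (\<lambda>v. v = None) u = map (\<lambda>v. v = None) v"
      show "u = v"
      proof (rule nth_equalityI)
        show "length u = length v" using uv len by auto
        fix i assume "i < length u"
        then have i: "i < m" using uv len by auto
        have idx: "i * N < n" using i N by (simp add: n_def)
        have wi: "w x' ! i = b ((f ^^ (i * N)) x')" for x'
          using i by (simp add: w_def itinerary_def funpow_mult mult.commute)
        have ui: "u ! i = b ((f ^^ (i * N)) (p u))" "v ! i = b ((f ^^ (i * N)) (p v))"
          using wi[of "p u"] wi[of "p v"] uv p(1)[of u] p(1)[of v] by simp_all
        have "(map (\<lambda>v. v = None) u) ! i = (map (\<lambda>v. v = None) v) ! i" using eq by simp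
        then have none: "u ! i = None \<longleftrightarrow> v ! i = None" using i uv len by simp
        have "dist ((f ^^ (i * N)) (p u)) ((f ^^ (i * N)) (p v)) \<le> 2 * e"
          using q(2)[OF idx, of "p u"] q(2)[OF idx, of "p v"] uv
            dist_triangle2[of "(f ^^ (i * N)) (p u)" "(f ^^ (i * N)) (p v)" "(f ^^ (i * N)) x"]
          by (simp add: y_def)
        with sep[of "(f ^^ (i * N)) (p u)" "(f ^^ (i * N)) (p v)"] none ui
        show "u ! i = v ! i" by (metis not_le)
      qed
    qed
    moreover have "map (\<lambda>v. v = None) ` {u \<in> range w. y u = x} \<subseteq> ?L" using len by auto
    moreover have "finite ?L" by (rule finite_lists_length_eq) simp
    ultimately have "card {u \<in> range w. y u = x} \<le> card ?L" by (intro card_inj_on_le)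
    also have "card ?L = 2 ^ m" by (subst card_lists_length_eq) simp_all
    finally show ?thesis .
  qed
  have "(\<Sum>u\<in>range w. exp (A u)) \<le> (\<Sum>u\<in>range w. exp (n * \<kappa> + 1) * exp (S (y u)))"
    using shadow by (intro sum_mono) (simp add: A_def add.commute flip: exp_add)
  also have "\<dots> = exp (n * \<kappa> + 1) * (\<Sum>u\<in>range w. exp (S (y u)))" by (simp add: sum_distrib_left)
  also have "(\<Sum>u\<in>range w. exp (S (y u))) = (\<Sum>x\<in>E. \<Sum>u\<in>{u \<in> range w. y u = x}. exp (S (y u)))"
    by (rule sum.group[symmetric, OF finR E(1)]) (auto simp: y_def q(1))
  also have "\<dots> = (\<Sum>x\<in>E. card {u \<in> range w. y u = x} * exp (S x))" by simp
  also have "\<dots> \<le> (\<Sum>x\<in>E. 2 ^ m * exp (S x))"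
  proof (intro sum_mono mult_right_mono)
    show "real (card {u \<in> range w. y u = x}) \<le> 2 ^ m" for x
      using of_nat_mono[OF mult[of x], where 'a = real] by simp
  qed simp
  also have "\<dots> = 2 ^ m * (\<Sum>x\<in>E. exp (S x))" by (simp add: sum_distrib_left)
  also have "(\<Sum>x\<in>E. exp (S x)) \<le> separated_partition_function f \<phi> n e"
    unfolding S_def by (rule separated_sum_le[OF cmp f \<phi> e E(1,2)])
  finally have count: "(\<Sum>u\<in>range w. exp (A u)) \<le> exp (n * \<kappa> + 1) * (2 ^ m * separated_partition_function f \<phi> n e)"
    by simp
  have Z: "separated_partition_function f \<phi> n e > 0"
    by (rule separated_partition_function_pos[OF cmp f \<phi> e])
  have "label_entropy \<mu> w + n * integral\<^sup>L \<mu> \<phi> \<le> label_entropy \<mu> w + (\<Sum>u\<in>range w. prob (w -` {u}) * A u)"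
    using energy by simp
  also have "\<dots> \<le> ln (\<Sum>u\<in>range w. exp (A u))" by (rule label_entropy_plus_energy_le[OF w])
  also have "\<dots> \<le> ln (exp (n * \<kappa> + 1) * (2 ^ m * separated_partition_function f \<phi> n e))"
    using count finR Z by (subst ln_le_cancel_iff) (auto intro!: sum_pos)
  also have "\<dots> = n * \<kappa> + 1 + (m * ln 2 + ln (separated_partition_function f \<phi> n e))"
    using Z by (simp add: ln_mult_pos ln_realpow)
  finally show ?thesis by (simp add: n_def w_def)
qed

lemma finite_closed_family_gap:
  fixes B :: "'b \<Rightarrow> 'a::metric_space set"
  assumes cmp: "compact (UNIV :: 'a set)" and R: "finite R" and B: "\<And>v. closed (B v)"
    and disj: "\<And>v w. v \<noteq> w \<Longrightarrow> B v \<inter> B w = {}"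
  obtains r where "r > 0" "\<And>v w x y. v \<in> R \<Longrightarrow> w \<in> R \<Longrightarrow> v \<noteq> w \<Longrightarrow> x \<in> B v \<Longrightarrow> y \<in> B w \<Longrightarrow> r \<le> dist x y"
proof -
  have "\<exists>d>0. \<forall>x\<in>B v. \<forall>y\<in>B w. d \<le> dist x y" if vw: "v \<noteq> w" for v w
  proof (cases "B v = {} \<or> B w = {}")
    case True
    then show ?thesis by (intro exI[of _ 1]) auto
  next
    case False
    have "compact (B v)" using compact_Int_closed[OF cmp B] by simp
    moreover have "continuous_on (B v) (\<lambda>x. infdist x (B w))" by (intro continuous_intros)
    ultimately obtain x0 where x0: "x0 \<in> B v" "\<And>x. x \<in> B v \<Longrightarrow> infdist x0 (B w) \<le> infdist x (B w)"
      using continuous_attains_inf[of "B v" "\<lambda>x. infdist x (B w)"] False by auto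
    have "x0 \<notin> B w" using disj[OF vw] x0(1) by auto
    then have "infdist x0 (B w) > 0"
      using in_closed_iff_infdist_zero[OF B, of w x0] False infdist_nonneg[of x0 "B w"]
      by (auto simp: order_less_le)
    moreover have "infdist x0 (B w) \<le> dist x y" if "x \<in> B v" "y \<in> B w" for x y
      using x0(2)[OF that(1)] infdist_le[OF that(2), of x] by simp
    ultimately show ?thesis by blast
  qed
  then obtain d where d: "\<And>v w. v \<noteq> w \<Longrightarrow> d v w > 0"
    "\<And>v w x y. v \<noteq> w \<Longrightarrow> x \<in> B v \<Longrightarrow> y \<in> B w \<Longrightarrow> d v w \<le> dist x y" by metis
  define D where "D = insert 1 ((\<lambda>(v, w). d v w) ` {(v, w) \<in> R \<times> R. v \<noteq> w})"
  have "finite {(v, w) \<in> R \<times> R. v \<noteq> w}" using R by (auto intro: finite_subset[of _ "R \<times> R"])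
  then have D: "finite D" "D \<noteq> {}" by (auto simp: D_def)
  show ?thesis
  proof (rule that[of "Min D"])
    show "Min D > 0" using D d(1) by (auto simp: D_def)
    show "Min D \<le> dist x y" if "v \<in> R" "w \<in> R" "v \<noteq> w" "x \<in> B v" "y \<in> B w" for v w x y
    proof -
      have "Min D \<le> d v w" using D(1) that by (intro Min_le) (auto simp: D_def)
      with d(2)[OF that(3-5)] show ?thesis by simp
    qed
  qed
qed

text \<open>Cutting itineraries into blocks of length \<open>N\<close> and replacing each block by its closed core costs a
  bounded amount of entropy per block: at most 1 for the core, and \<open>ln 2\<close> for the multiplicity of the
  shadowing. The cost per unit of time is therefore of order \<open>1 / N\<close>.\<close>
lemma entropy_of_labelling_plus_integral_le:
  fixes f :: "'a::metric_space \<Rightarrow> 'a" and c :: "'a \<Rightarrow> 'b" and N :: nat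
  assumes cmp: "compact (UNIV :: 'a set)" and f: "continuous_on UNIV f" and \<phi>: "continuous_on UNIV \<phi>"
    and mu: "\<mu> \<in> invariant_measures f" and c: "simple_function borel c"
    and N: "N \<ge> 1" and \<kappa>: "\<kappa> > 0"
  shows "ereal (entropy_wrt_partition f \<mu> (fibres c) + integral\<^sup>L \<mu> \<phi> - 3 / N - \<kappa>) \<le> topological_pressure f \<phi>"
proof -
  interpret borel_prob \<mu> by (rule invariant_borel_prob[OF mu])
  note sf = simple_function_borel_iff[OF sets_borel]
  have fm: "f \<in> borel_measurable borel" by (rule borel_measurable_continuous_onI[OF f])
  define z where "z = itinerary f N c"
  have z: "simple_function borel z" unfolding z_def by (rule simple_function_itinerary[OF c fm])
  obtain B where B: "\<And>v. closed (B v)" "\<And>v. B v \<subseteq> z -` {v}"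
    "simple_function borel (\<lambda>x. if x \<in> B (z x) then Some (z x) else None)"
    "label_entropy \<mu> (\<lambda>x. (z x, if x \<in> B (z x) then Some (z x) else None))
      - label_entropy \<mu> (\<lambda>x. if x \<in> B (z x) then Some (z x) else None) \<le> 1"
    by (rule closed_core_labelling[OF borel_prob_axioms z], rule that; assumption)
  define b where "b x = (if x \<in> B (z x) then Some (z x) else None)" for x
  have b: "simple_function borel b" using B(3) by (simp add: b_def[abs_def])
  have rel: "label_entropy \<mu> (\<lambda>x. (z x, b x)) - label_entropy \<mu> b \<le> 1"
    using B(4) by (simp add: b_def[abs_def])
  have "finite (range z)" using simple_functionD(1)[OF z] by simp
  moreover have "B v \<inter> B w = {}" if "v \<noteq> w" for v w using B(2)[of v] B(2)[of w] that by auto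
  ultimately obtain r where r: "r > 0" "\<And>v w x y. v \<in> range z \<Longrightarrow> w \<in> range z \<Longrightarrow> v \<noteq> w \<Longrightarrow> x \<in> B v \<Longrightarrow> y \<in> B w \<Longrightarrow> r \<le> dist x y"
    using finite_closed_family_gap[OF cmp, of "range z" B] B(1) by metis
  obtain d where d: "d > 0" "\<And>x y. dist x y < d \<Longrightarrow> dist (\<phi> x) (\<phi> y) < \<kappa>"
    using compact_uniformly_continuous[OF \<phi> cmp] \<kappa> unfolding uniformly_continuous_on_def by (metis UNIV_I)
  define e where "e = min (r / 3) (d / 2)"
  have e: "e > 0" "2 * e < r" "e < d" using r(1) d(1) by (auto simp: e_def min_def)
  have sep: "dist x y > 2 * e" if "b x \<noteq> None" "b y \<noteq> None" "b x \<noteq> b y" for x y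
    using that r(2)[of "z x" "z y" x y] e(2) by (auto simp: b_def split: if_splits)
  have var: "\<phi> x \<le> \<phi> y + \<kappa>" if "dist x y \<le> e" for x y
    using d(2)[of x y] that e(3) by (simp add: dist_real_def)
  let ?h = "entropy_wrt_partition f \<mu> (fibres c)" and ?I = "integral\<^sup>L \<mu> \<phi>"
  let ?Z = "\<lambda>n. separated_partition_function f \<phi> n e"
  have main: "?h + ?I - 3 / N - \<kappa> \<le> ln (?Z (m * N)) / (m * N)" if m: "m \<ge> 1" for m
  proof -
    let ?g = "f ^^ N"
    let ?w = "itinerary ?g m b" and ?v = "itinerary ?g m z"
    have g: "?g \<in> borel_measurable borel" by (rule measurable_funpow[OF fm])
    have sv: "simple_function \<mu> ?v" and sw: "simple_function \<mu> ?w"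
      unfolding sf by (rule simple_function_itinerary[OF z g], rule simple_function_itinerary[OF b g])
    have n: "m * N \<ge> 1" "real (m * N) > 0" using m N by auto
    have "label_entropy \<mu> (itinerary f (m * N) c) = label_entropy \<mu> (\<lambda>x. concat (?v x))"
      unfolding z_def itinerary_block[abs_def] ..
    also have "\<dots> \<le> label_entropy \<mu> ?v" by (rule label_entropy_factor_le[OF sv])
    also have "\<dots> \<le> label_entropy \<mu> (\<lambda>x. (?v x, ?w x))"
      using label_entropy_factor_le[OF simple_function_Pair[OF sv sw], of fst] by simp
    also have "\<dots> \<le> label_entropy \<mu> ?w + m * (label_entropy \<mu> (\<lambda>x. (z x, b x)) - label_entropy \<mu> b)"
      using relative_block_entropy[OF mu fm z b, where N = N and m = m] by linarith
    also have "\<dots> \<le> label_entropy \<mu> ?w + m * 1"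
      using mult_left_mono[OF rel, of "real m"] by simp
    finally have "label_entropy \<mu> (itinerary f (m * N) c) + (m * N) * ?I
        \<le> m + (m * ln 2 + (m * N) * \<kappa> + 1 + ln (?Z (m * N)))"
      using separated_block_estimate[OF cmp f \<phi> mu b e(1) sep var N, of m] by simp
    moreover have "m + m * ln 2 + 1 \<le> 3 * real m"
    proof -
      have "real m * ln 2 \<le> real m * 1" using ln_2_less_1 by (intro mult_left_mono) auto
      moreover have "1 \<le> real m" using m by simp
      ultimately show ?thesis by linarith
    qed
    ultimately have "label_entropy \<mu> (itinerary f (m * N) c) + (m * N) * ?I \<le> 3 * m + (m * N) * \<kappa> + ln (?Z (m * N))"
      by simp
    then have "(label_entropy \<mu> (itinerary f (m * N) c) + (m * N) * ?I) / (m * N)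
        \<le> (3 * m + (m * N) * \<kappa> + ln (?Z (m * N))) / (m * N)"
      using n by (intro divide_right_mono) auto
    then have "label_entropy \<mu> (itinerary f (m * N) c) / (m * N) + ?I \<le> 3 / N + \<kappa> + ln (?Z (m * N)) / (m * N)"
      using m N by (simp add: add_divide_distrib)
    moreover have "?h \<le> label_entropy \<mu> (itinerary f (m * N) c) / (m * N)"
      using entropy_of_labelling(2)[OF mu fm c n(1)] by simp
    ultimately show ?thesis by simp
  qed
  have "strict_mono (\<lambda>m. Suc m * N)" using N by (intro strict_monoI) simp
  then have sub: "limsup ((\<lambda>n. ereal (ln (?Z n) / real n)) \<circ> (\<lambda>m. Suc m * N)) \<le> limsup (\<lambda>n. ereal (ln (?Z n) / real n))"
    by (rule limsup_subseq_mono)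
  have "ereal (?h + ?I - 3 / N - \<kappa>) \<le> limsup ((\<lambda>n. ereal (ln (?Z n) / real n)) \<circ> (\<lambda>m. Suc m * N))"
  proof (rule le_Limsup)
    show "\<forall>\<^sub>F m in sequentially. ereal (?h + ?I - 3 / N - \<kappa>) \<le> ((\<lambda>n. ereal (ln (?Z n) / real n)) \<circ> (\<lambda>m. Suc m * N)) m"
    proof (rule always_eventually, rule allI)
      fix m
      show "ereal (?h + ?I - 3 / N - \<kappa>) \<le> ((\<lambda>n. ereal (ln (?Z n) / real n)) \<circ> (\<lambda>m. Suc m * N)) m"
        using main[of "Suc m"] by (simp only: comp_def ereal_less_eq(3))
    qed
  qed simp
  also note sub
  also have "limsup (\<lambda>n. ereal (ln (?Z n) / real n)) \<le> topological_pressure f \<phi>"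
    unfolding topological_pressure_eq_SUP[OF cmp f \<phi>] using e(1) by (intro SUP_upper) simp
  finally show ?thesis .
qed

text \<open>The upper half of the variational principle; the error \<open>3 / N + \<kappa>\<close> of the estimate for one
  labelling is arbitrarily small.\<close>
theorem measure_pressure_le_topological_pressure:
  fixes f :: "'a::metric_space \<Rightarrow> 'a"
  assumes cmp: "compact (UNIV :: 'a set)" and f: "continuous_on UNIV f" and \<phi>: "continuous_on UNIV \<phi>"
    and mu: "\<mu> \<in> invariant_measures f"
  shows "measure_pressure f \<mu> \<phi> \<le> topological_pressure f \<phi>"
proof -
  let ?P = "topological_pressure f \<phi>" and ?I = "integral\<^sup>L \<mu> \<phi>"
  have "metric_entropy f \<mu> \<le> ?P - ereal ?I"
  proof (rule metric_entropy_leI)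
    fix c :: "'a \<Rightarrow> 'a set" assume c: "simple_function borel c"
    let ?h = "entropy_wrt_partition f \<mu> (fibres c)"
    have "ereal (?h + ?I) \<le> ?P"
    proof (rule ereal_le_epsilon2)
      fix \<delta> :: real assume "\<delta> > 0"
      then obtain N where N: "1 / Suc N < \<delta> / 6" using nat_approx_posE[of "\<delta> / 6"] by auto
      then have "3 / real (Suc N) + \<delta> / 2 \<le> \<delta>" by (simp add: field_simps)
      moreover have "ereal (?h + ?I - 3 / real (Suc N) - \<delta> / 2) \<le> ?P"
        by (rule entropy_of_labelling_plus_integral_le[OF cmp f \<phi> mu c]) (use \<open>\<delta> > 0\<close> in auto)
      ultimately show "ereal (?h + ?I) \<le> ?P + ereal \<delta>"
        by (cases ?P) auto
    qed
    then show "ereal ?h \<le> ?P - ereal ?I" by (cases ?P) auto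
  qed
  then show ?thesis unfolding measure_pressure_def by (cases ?P; cases "metric_entropy f \<mu>") auto
qed

section \<open>Atomic measures\<close>

lemma atomic_measure:
  fixes t :: "'j \<Rightarrow> 'a::topological_space"
  assumes J: "finite J" and a: "\<And>j. j \<in> J \<Longrightarrow> a j \<ge> 0" "sum a J = 1"
  obtains M where "borel_prob M"
    "\<And>A. A \<in> sets borel \<Longrightarrow> measure M A = (\<Sum>j\<in>J. a j * indicator A (t j))"
    "\<And>\<phi> :: 'a \<Rightarrow> real. \<phi> \<in> borel_measurable borel \<Longrightarrow> integral\<^sup>L M \<phi> = (\<Sum>j\<in>J. a j * \<phi> (t j))"
proof -
  let ?P = "point_measure J (\<lambda>j. ennreal (a j))"
  have emP: "emeasure ?P (space ?P) = 1"
    using J a by (simp add: space_point_measure emeasure_point_measure_finite sum_ennreal)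
  then interpret P: prob_space ?P by (rule prob_spaceI)
  have t: "t \<in> measurable ?P borel" by (auto simp: measurable_def space_point_measure sets_point_measure)
  define M where "M = distr ?P borel t"
  have M: "borel_prob M" unfolding borel_prob_iff M_def using P.prob_space_distr[OF t] by simp
  have int: "integral\<^sup>L M \<phi> = (\<Sum>j\<in>J. a j * \<phi> (t j))" if "\<phi> \<in> borel_measurable borel" for \<phi> :: "'a \<Rightarrow> real"
    unfolding M_def integral_distr[OF t that]
    using J a by (subst lebesgue_integral_point_measure_finite) auto
  have "measure M A = (\<Sum>j\<in>J. a j * indicator A (t j))" if A: "A \<in> sets borel" for A
  proof -
    interpret M: borel_prob M by (rule M)
    show ?thesis using int[of "indicator A"] A by simp
  qed
  with M int show ?thesis using that by blast
qed

section \<open>The entropy of an itinerary bounded by its windows\<close>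

text \<open>For every offset \<open>j < q\<close>, the times from \<open>j\<close> to \<open>n\<close> are covered by consecutive windows of
  length \<open>q\<close>. The last one may reach beyond \<open>n\<close>, which only increases its entropy, and the first \<open>j\<close>
  times cost at most \<open>q * ln (card (range c))\<close>. Summed over the offsets, each time less than \<open>n\<close>
  starts exactly one window.\<close>
lemma (in prob_on_UNIV) window_entropy:
  assumes f: "f \<in> measurable M M" and c: "simple_function M c" and q: "q \<ge> 1"
  shows "q * label_entropy M (itinerary f n c)
    \<le> real q ^ 2 * ln (card (range c)) + (\<Sum>i<n. label_entropy M (\<lambda>x. itinerary f q c ((f ^^ i) x)))"
proof -
  let ?L = "ln (card (range c))"
  define h where "h i k = label_entropy M (\<lambda>x. itinerary f k c ((f ^^ i) x))" for i k
  have s: "simple_function M (\<lambda>x. itinerary f k c ((f ^^ i) x))" for i k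
    by (rule simple_function_measurable_comp[OF simple_function_itinerary[OF c f] measurable_funpow[OF f]])
  have h0: "h i k \<ge> 0" for i k unfolding h_def by (rule label_entropy_nonneg[OF s])
  have split: "itinerary f (k + l) c ((f ^^ i) x)
      = itinerary f k c ((f ^^ i) x) @ itinerary f l c ((f ^^ (i + k)) x)" for i k l x
  proof -
    have "(f ^^ (i + k)) x = (f ^^ k) ((f ^^ i) x)" by (subst add.commute) (simp add: funpow_add)
    then show ?thesis by (simp add: itinerary_add)
  qed
  have sub: "h i (k + l) \<le> h i k + h (i + k) l" for i k l
  proof -
    have "h i (k + l) = label_entropy M (\<lambda>x. (\<lambda>(u, v). u @ v)
        (itinerary f k c ((f ^^ i) x), itinerary f l c ((f ^^ (i + k)) x)))"
      unfolding h_def split by simp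
    also have "\<dots> \<le> label_entropy M (\<lambda>x. (itinerary f k c ((f ^^ i) x), itinerary f l c ((f ^^ (i + k)) x)))"
      by (rule label_entropy_factor_le[OF simple_function_Pair[OF s s]])
    also have "\<dots> \<le> h i k + h (i + k) l"
      unfolding h_def by (rule label_entropy_subadditive[OF s s])
    finally show ?thesis .
  qed
  have mono: "h i k \<le> h i (k + l)" for i k l
  proof -
    have "(\<lambda>x. itinerary f k c ((f ^^ i) x)) = (\<lambda>x. take k (itinerary f (k + l) c ((f ^^ i) x)))"
      unfolding split by (simp add: itinerary_def)
    then show ?thesis unfolding h_def by (simp only: label_entropy_factor_le[OF s])
  qed
  have h1: "h i 1 \<le> ?L" for i
  proof -
    have "h i 1 = label_entropy M (\<lambda>x. (\<lambda>v. [v]) (c ((f ^^ i) x)))" by (simp add: h_def itinerary_def)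
    also have "\<dots> \<le> label_entropy M (\<lambda>x. c ((f ^^ i) x))"
      by (rule label_entropy_factor_le) (rule simple_function_measurable_comp[OF c measurable_funpow[OF f]])
    also have "\<dots> \<le> ln (card (range (\<lambda>x. c ((f ^^ i) x))))"
      by (rule label_entropy_le_ln_card) (rule simple_function_measurable_comp[OF c measurable_funpow[OF f]])
    also have "\<dots> \<le> ?L"
    proof -
      have "card (range (\<lambda>x. c ((f ^^ i) x))) \<le> card (range c)"
        using finite_range_label[OF c] by (intro card_mono) auto
      moreover have "card (range (\<lambda>x. c ((f ^^ i) x))) > 0"
        using finite_range_label[OF c] by (subst card_gt_0_iff) (auto intro: finite_subset[of _ "range c"])
      ultimately show ?thesis by simp
    qed
    finally show ?thesis .
  qed
  have hL: "h i k \<le> k * ?L" for i k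
  proof (induction k)
    case 0
    then show ?case using prob_space by (simp add: h_def label_entropy_def)
  next
    case (Suc k)
    then show ?case using sub[of i k 1] h1[of "i + k"] by (simp add: algebra_simps)
  qed
  have L0: "?L \<ge> 0" using h0[of 0 1] h1[of 0] by simp
  \<comment> \<open>total entropy of the windows that start at \<open>j\<close>, \<open>j + q\<close>, and so on, before time \<open>n\<close>\<close>
  define T where "T j = (\<Sum>i\<in>{i. j \<le> i \<and> i < n \<and> i mod q = j mod q}. h i q)" for j
  have T: "h j (n - j) \<le> T j" for j
  proof (induction "n - j" arbitrary: j rule: less_induct)
    case less
    have T0: "T j \<ge> 0" unfolding T_def by (intro sum_nonneg h0)
    show ?case
    proof (cases "j < n")
      case False
      then show ?thesis using hL[of j 0] T0 by simp
    next
      case True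
      have "{i. j \<le> i \<and> i < n \<and> i mod q = j mod q} = insert j {i. j + q \<le> i \<and> i < n \<and> i mod q = (j + q) mod q}"
      proof (intro equalityI subsetI)
        fix i assume i: "i \<in> {i. j \<le> i \<and> i < n \<and> i mod q = j mod q}"
        show "i \<in> insert j {i. j + q \<le> i \<and> i < n \<and> i mod q = (j + q) mod q}"
        proof (cases "i = j")
          case False
          then have "j < i" using i by simp
          moreover have "q dvd i - j" using i mod_eq_dvd_iff_nat[of j i q] by simp
          ultimately have "q \<le> i - j" by (intro dvd_imp_le) auto
          with \<open>j < i\<close> i show ?thesis by auto
        qed simp
      qed (use True in auto)
      then have Tj: "T j = h j q + T (j + q)"
        unfolding T_def using q by (subst sum.insert[symmetric]) auto
      have T0': "T (j + q) \<ge> 0" unfolding T_def by (intro sum_nonneg h0)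
      show ?thesis
      proof (cases "j + q \<le> n")
        case True
        then have "n - j = q + (n - (j + q))" by simp
        then have "h j (n - j) \<le> h j q + h (j + q) (n - (j + q))" using sub[of j q "n - (j + q)"] by simp
        also have "h (j + q) (n - (j + q)) \<le> T (j + q)" using True q \<open>j < n\<close> by (intro less) simp
        finally show ?thesis using Tj by simp
      next
        case False
        then have "q = (n - j) + (q - (n - j))" by simp
        then have "h j (n - j) \<le> h j q" using mono[of j "n - j" "q - (n - j)"] by simp
        then show ?thesis using Tj T0' by simp
      qed
    qed
  qed
  have one: "h 0 n \<le> q * ?L + (\<Sum>i\<in>{i \<in> {..<n}. i mod q = j}. h i q)" if j: "j < q" for j
  proof (cases "j \<le> n")
    case True
    have "h 0 n \<le> h 0 j + h j (n - j)" using sub[of 0 j "n - j"] True by simp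
    also have "h 0 j \<le> q * ?L" 
      using hL[of 0 j] mult_right_mono[OF _ L0, of "real j" "real q"] j by simp
    also have "h j (n - j) \<le> T j" by (rule T)
    also have "T j = (\<Sum>i\<in>{i \<in> {..<n}. i mod q = j}. h i q)"
      unfolding T_def using j by (intro sum.cong) auto
    finally show ?thesis by simp
  next
    case False
    have "h 0 n \<le> n * ?L" by (rule hL)
    also have "\<dots> \<le> q * ?L" using False j L0 by (intro mult_right_mono) auto
    finally show ?thesis using sum_nonneg[of "{i \<in> {..<n}. i mod q = j}" "\<lambda>i. h i q"] h0 by fastforce
  qed
  have "q * h 0 n = (\<Sum>j<q. h 0 n)" by simp
  also have "\<dots> \<le> (\<Sum>j<q. q * ?L + (\<Sum>i\<in>{i \<in> {..<n}. i mod q = j}. h i q))"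
    by (intro sum_mono one) simp
  also have "\<dots> = real q ^ 2 * ?L + (\<Sum>j<q. \<Sum>i\<in>{i \<in> {..<n}. i mod q = j}. h i q)"
    by (simp add: sum.distrib power2_eq_square)
  also have "(\<Sum>j<q. \<Sum>i\<in>{i \<in> {..<n}. i mod q = j}. h i q) = (\<Sum>i<n. h i q)"
    using q by (intro sum.group) auto
  finally show ?thesis by (simp add: h_def)
qed

section \<open>Labellings with null boundary\<close>

text \<open>The spheres around \<open>c\<close> are disjoint, so only countably many of them have positive measure.\<close>
lemma null_sphere_radius:
  fixes c :: "'a::metric_space"
  assumes "borel_prob M" and ab: "a < (b::real)"
  shows "\<exists>r. a < r \<and> r < b \<and> measure M {x. dist x c = r} = 0"
proof -
  interpret borel_prob M by fact
  have d: "(\<lambda>x. dist x c) \<in> borel_measurable M"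
    by (rule continuous_measurable) (intro continuous_intros)
  interpret D: prob_space "distr M borel (\<lambda>x. dist x c)" by (rule prob_space_distr[OF d])
  have "countable {r. measure (distr M borel (\<lambda>x. dist x c)) {r} \<noteq> 0}" by (rule D.countable_support)
  moreover have "uncountable {a<..<b}" using ab by (simp add: uncountable_open_interval)
  ultimately have "\<not> {a<..<b} \<subseteq> {r. measure (distr M borel (\<lambda>x. dist x c)) {r} \<noteq> 0}"
    using countable_subset by blast
  then obtain r where r: "a < r" "r < b" "measure (distr M borel (\<lambda>x. dist x c)) {r} = 0" by auto
  have "(\<lambda>x. dist x c) -` {r} = {x. dist x c = r}" by auto
  then have "measure (distr M borel (\<lambda>x. dist x c)) {r} = measure M {x. dist x c = r}"
    using measure_distr[OF d, of "{r}"] by simp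
  with r show ?thesis by auto
qed

text \<open>Label a point by the set of those balls of a finite cover that contain it, with radii chosen such
  that the spheres are null. Away from the preimages of these spheres the itinerary is locally
  constant, hence every union of its fibres is open there.\<close>
lemma null_boundary_labelling:
  fixes f :: "'a::metric_space \<Rightarrow> 'a"
  assumes cmp: "compact (UNIV :: 'a set)" and f: "continuous_on UNIV f"
    and mu: "\<mu> \<in> invariant_measures f" and e: "e > 0"
  obtains c :: "'a \<Rightarrow> 'a set" where "simple_function borel c" "\<And>x y. c x = c y \<Longrightarrow> dist x y < e"
    "\<And>q. \<exists>N. closed N \<and> measure \<mu> N = 0 \<and> (\<forall>W. open (itinerary f q c -` W - N))"
proof -
  interpret borel_prob \<mu> by (rule invariant_borel_prob[OF mu])
  have fm: "f \<in> borel_measurable borel" by (rule borel_measurable_continuous_onI[OF f])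
  obtain T :: "'a set" where T: "finite T" "\<And>x. \<exists>a\<in>T. dist x a < e / 4"
    using compact_UNIV_finite_cover[OF cmp, of "e/4"] e by auto
  have "\<exists>r. e / 4 < r \<and> r < e / 2 \<and> measure \<mu> {x. dist x a = r} = 0" for a
    using null_sphere_radius[OF borel_prob_axioms, of "e/4" "e/2" a] e by simp
  then obtain r where r: "\<And>a. e / 4 < r a" "\<And>a. r a < e / 2" "\<And>a. measure \<mu> {x. dist x a = r a} = 0" by metis
  define c where "c x = {a \<in> T. dist x a < r a}" for x
  have less_open: "open {x. dist x a < r a}" for a
    by (intro open_Collect_less continuous_intros)
  have "simple_function borel c"
    unfolding simple_function_def
  proof (intro conjI ballI)
    have cT: "c ` space borel \<subseteq> Pow T" by (auto simp: c_def)
    then show "finite (c ` space borel)" using T(1) by (rule finite_subset[OF _ finite_Pow_iff[THEN iffD2]])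
    fix A assume "A \<in> c ` space borel"
    with cT have "A \<subseteq> T" by blast
    then have "c -` {A} = {x \<in> space borel. \<forall>a\<in>T. dist x a < r a \<longleftrightarrow> a \<in> A}"
      unfolding c_def by (intro set_eqI) (simp, blast)
    also have "\<dots> \<in> sets borel"
    proof (rule sets.sets_Collect_finite_All'[OF _ T(1)])
      fix a assume "a \<in> T"
      have "{x. \<not> dist x a < r a} = - {x. dist x a < r a}" by blast
      then have "{x. \<not> dist x a < r a} \<in> sets borel" using less_open[of a] by (simp only: borel_comp borel_open)
      then show "{x \<in> space borel. dist x a < r a \<longleftrightarrow> a \<in> A} \<in> sets borel"
        using less_open[of a] by (cases "a \<in> A") simp_all
    qed (use T(2) in blast)
    finally show "c -` {A} \<inter> space borel \<in> sets borel" by simp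
  qed
  moreover have "dist x y < e" if "c x = c y" for x y
  proof -
    obtain a where a: "a \<in> T" "dist x a < e / 4" using T(2) by blast
    then have "a \<in> c x" using r(1)[of a] by (simp add: c_def)
    then have "a \<in> c y" using that by simp
    then have "dist y a < r a" by (simp add: c_def)
    with a r(2)[of a] dist_triangle2[of x y a] e show ?thesis by simp
  qed
  moreover have "\<exists>N. closed N \<and> measure \<mu> N = 0 \<and> (\<forall>W. open (itinerary f q c -` W - N))" for q
  proof -
    have cont: "continuous_on UNIV (\<lambda>x. dist ((f ^^ i) x) a)" for i a
      by (intro continuous_intros continuous_on_funpow[OF f])
    define N where "N = (\<Union>i<q. \<Union>a\<in>T. {x. dist ((f ^^ i) x) a = r a})"
    have closed1: "closed {x. dist ((f ^^ i) x) a = r a}" for i a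
      by (intro closed_Collect_eq cont continuous_intros)
    have "closed N" unfolding N_def using T(1) closed1 by auto
    moreover have "measure \<mu> N = 0"
    proof -
      have "{x. dist ((f ^^ i) x) a = r a} \<in> null_sets \<mu>" for i a
      proof -
        have "{x. dist ((f ^^ i) x) a = r a} = (f ^^ i) -` {x. dist x a = r a}" by auto
        then have "measure \<mu> {x. dist ((f ^^ i) x) a = r a} = 0"
          using measure_vimage_funpow[OF mu fm, of "{x. dist x a = r a}" i] closed1[of 0 a] r(3)[of a] by simp
        then show ?thesis using closed1[of i a] by (simp add: null_sets_def emeasure_eq_measure)
      qed
      then have "N \<in> null_sets \<mu>" unfolding N_def using T(1) by (intro null_sets.finite_UN) auto
      then show ?thesis by (simp add: null_sets_def emeasure_eq_measure)
    qed
    moreover have "open (itinerary f q c -` W - N)" for W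
    proof (subst open_subopen, intro ballI)
      fix x assume x: "x \<in> itinerary f q c -` W - N"
      define V where "V = (\<Inter>i\<in>{..<q}. \<Inter>a\<in>T. (if dist ((f ^^ i) x) a < r a
          then {y. dist ((f ^^ i) y) a < r a} else {y. r a < dist ((f ^^ i) y) a}))"
      have "open V"
        unfolding V_def using T(1)
        by (intro open_INT) (auto intro!: open_Collect_less cont continuous_intros)
      moreover have "x \<in> V"
        using x unfolding V_def N_def by (auto simp: not_less order_less_le)
      moreover have "V \<subseteq> itinerary f q c -` W - N"
      proof
        fix y assume y: "y \<in> V"
        have side: "dist ((f ^^ i) y) a \<noteq> r a \<and> (dist ((f ^^ i) y) a < r a \<longleftrightarrow> dist ((f ^^ i) x) a < r a)"
          if "i < q" "a \<in> T" for i a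
        proof -
          have "y \<in> (if dist ((f ^^ i) x) a < r a
              then {y. dist ((f ^^ i) y) a < r a} else {y. r a < dist ((f ^^ i) y) a})"
            using y that unfolding V_def by blast
          then show ?thesis by (cases "dist ((f ^^ i) x) a < r a") auto
        qed
        then have "c ((f ^^ i) y) = c ((f ^^ i) x)" if "i < q" for i
          using that by (auto simp: c_def)
        then have "itinerary f q c y = itinerary f q c x" by (simp add: itinerary_eq_iff)
        moreover have "y \<notin> N" using side unfolding N_def by blast
        ultimately show "y \<in> itinerary f q c -` W - N" using x by auto
      qed
      ultimately show "\<exists>V. open V \<and> x \<in> V \<and> V \<subseteq> itinerary f q c -` W - N" by blast
    qed
    ultimately show ?thesis by blast
  qed
  ultimately show ?thesis by (rule that)
qed

lemma tendsto_mult_ln: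
  fixes x :: "nat \<Rightarrow> real"
  assumes x: "x \<longlonglongrightarrow> l" and x0: "\<And>n. 0 \<le> x n" "\<And>n. x n \<le> 1"
  shows "(\<lambda>n. x n * ln (x n)) \<longlonglongrightarrow> l * ln l"
proof (cases "l = 0")
  case True
  have "(\<lambda>n. 2 * sqrt (x n)) \<longlonglongrightarrow> 2 * sqrt 0"
    using x unfolding True by (intro tendsto_intros)
  then have lim: "(\<lambda>n. 2 * sqrt (x n)) \<longlonglongrightarrow> 0" by simp
  have "norm (x n * ln (x n)) \<le> 2 * sqrt (x n)" for n
  proof -
    have "x n * ln (x n) \<le> 0"
      using x0[of n] by (cases "x n = 0") (auto intro!: mult_nonneg_nonpos)
    then show ?thesis using neg_mult_ln_le_sqrt[OF x0(1)[of n]] by simp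
  qed
  then have "(\<lambda>n. x n * ln (x n)) \<longlonglongrightarrow> 0"
    by (intro Lim_null_comparison[OF _ lim]) auto
  then show ?thesis by (simp add: True)
qed (intro tendsto_intros x)

lemma label_entropy_weak_limit:
  fixes w :: "'a::metric_space \<Rightarrow> 'b"
  assumes cmp: "compact (UNIV :: 'a set)" and Q: "\<And>n. borel_prob (Q n)" and M: "borel_prob M"
    and conv: "weakly_converges Q M" and w: "simple_function borel w"
    and N: "closed N" "measure M N = 0" "\<And>W. open (w -` W - N)"
  shows "(\<lambda>n. label_entropy (Q n) w) \<longlonglongrightarrow> label_entropy M w"
  unfolding label_entropy_def
proof (intro tendsto_minus tendsto_sum tendsto_mult_ln)
  fix v assume "v \<in> range w"
  have "w -` {v} \<in> sets borel" using simple_functionD(2)[OF w, of "{v}"] by simp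
  moreover have "open (- (w -` {v}) - N)" using N(3)[of "- {v}"] by (simp add: vimage_Compl)
  ultimately show "(\<lambda>n. measure (Q n) (w -` {v})) \<longlonglongrightarrow> measure M (w -` {v})"
    using weak_limit_continuity_set[OF cmp Q M conv _ N(1,2) N(3)[of "{v}"]] by blast
  fix n
  interpret Q: borel_prob "Q n" by (rule Q)
  show "0 \<le> measure (Q n) (w -` {v})" "measure (Q n) (w -` {v}) \<le> 1" by simp_all
qed


section \<open>Empirical measures on separated sets\<close>

text \<open>Put weights proportional to \<open>exp (birkhoff_sum f \<phi> n x)\<close> on an almost optimal separated set. As the
  itineraries of length \<open>n\<close> separate its points, entropy plus energy of this measure \<open>\<sigma>\<close> is exactly the logarithm of
  the normalising constant. The measure \<open>M\<close> is the average of the first \<open>n\<close> images of \<open>\<sigma>\<close>. It is almost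
  invariant, and its itineraries of fixed length \<open>q\<close> still carry the entropy: the itinerary of length
  \<open>n\<close> is bounded by its windows of length \<open>q\<close>, and their average by concavity.\<close>
lemma empirical_measure:
  fixes f :: "'a::metric_space \<Rightarrow> 'a"
  assumes cmp: "compact (UNIV :: 'a set)" and f: "continuous_on UNIV f" and \<phi>: "continuous_on UNIV \<phi>"
    and e: "e > 0" and n: "n \<ge> 1"
  obtains M where "borel_prob M"
    "\<And>\<psi> B. continuous_on UNIV \<psi> \<Longrightarrow> (\<And>x. \<bar>\<psi> x\<bar> \<le> B) \<Longrightarrow>
       \<bar>integral\<^sup>L M (\<lambda>x. \<psi> (f x)) - integral\<^sup>L M \<psi>\<bar> \<le> 2 * B / n"
    "\<And>(c :: 'a \<Rightarrow> 'a set) q. simple_function borel c \<Longrightarrow> (\<And>x y. c x = c y \<Longrightarrow> dist x y < e) \<Longrightarrow> q \<ge> 1 \<Longrightarrow>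
       q * ln (separated_partition_function f \<phi> n e)
       \<le> real q ^ 2 * ln (card (range c)) + n * label_entropy M (itinerary f q c) + real q * real n * integral\<^sup>L M \<phi> + q * ln 2"
proof -
  have fm: "f \<in> borel_measurable borel" by (rule borel_measurable_continuous_onI[OF f])
  let ?Z = "separated_partition_function f \<phi> n e"
  define S where "S = birkhoff_sum f \<phi> n"
  have Z: "?Z > 0" by (rule separated_partition_function_pos[OF cmp f \<phi> e])
  let ?F = "\<lambda>E. \<Sum>x\<in>E. exp (\<Sum>i<n. \<phi> ((f ^^ i) x))"
  have "?Z / 2 < (SUP E\<in>{E. finite E \<and> dyn_separated f n e E}. ?F E)"
    using Z unfolding separated_partition_function_def by simp
  then obtain s where "s \<in> ?F ` {E. finite E \<and> dyn_separated f n e E}" "?Z / 2 < s"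
    by (rule less_cSupE) (auto intro!: exI[of _ "{}"] simp: dyn_separated_def)
  then obtain E where E: "finite E" "dyn_separated f n e E" "?Z / 2 < (\<Sum>x\<in>E. exp (S x))"
    by (auto simp: S_def birkhoff_sum_def)
  define W where "W = (\<Sum>x\<in>E. exp (S x))"
  have W: "W > 0" "?Z / 2 < W" using E(3) Z by (auto simp: W_def)
  define p where "p x = exp (S x) / W" for x
  have p0: "p x > 0" for x using W by (simp add: p_def)
  have p1: "(\<Sum>x\<in>E. p x) = 1" using W by (simp add: p_def W_def flip: sum_divide_distrib)
  obtain \<sigma> :: "'a measure" where \<sigma>: "borel_prob \<sigma>"
    "\<And>A. A \<in> sets borel \<Longrightarrow> measure \<sigma> A = (\<Sum>x\<in>E. p x * indicator A x)"
    by (rule atomic_measure[where t = "\<lambda>x. x", OF E(1) less_imp_le[OF p0] p1], rule that; assumption)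
  let ?J = "E \<times> {..<n}"
  define a where "a = (\<lambda>(x, i::nat). p x / n)"
  have double: "(\<Sum>j\<in>?J. a j * g ((f ^^ snd j) (fst j))) = (\<Sum>x\<in>E. \<Sum>i<n. p x / n * g ((f ^^ i) x))" for g :: "'a \<Rightarrow> real"
    by (simp add: a_def sum.cartesian_product split_def)
  have a1: "(\<Sum>j\<in>?J. a j) = 1" using double[of "\<lambda>_. 1"] p1 n by simp
  have a0: "a j \<ge> 0" for j using p0[of "fst j"] by (simp add: a_def split_def)
  have "finite ?J" using E(1) by simp
  obtain M where M: "borel_prob M"
    "\<And>A. A \<in> sets borel \<Longrightarrow> measure M A = (\<Sum>j\<in>?J. a j * indicator A ((f ^^ snd j) (fst j)))"
    "\<And>\<psi> :: 'a \<Rightarrow> real. \<psi> \<in> borel_measurable borel \<Longrightarrow> integral\<^sup>L M \<psi> = (\<Sum>j\<in>?J. a j * \<psi> ((f ^^ snd j) (fst j)))"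
    by (rule atomic_measure[where J = ?J and a = a and t = "\<lambda>j. (f ^^ snd j) (fst j)", OF \<open>finite ?J\<close> a0 a1],
        rule that; assumption)
  note intM = M(3)[unfolded double]
  have almost: "\<bar>integral\<^sup>L M (\<lambda>x. \<psi> (f x)) - integral\<^sup>L M \<psi>\<bar> \<le> 2 * B / n"
    if \<psi>: "continuous_on UNIV \<psi>" "\<And>x. \<bar>\<psi> x\<bar> \<le> B" for \<psi> :: "'a \<Rightarrow> real" and B
  proof -
    have m: "\<psi> \<in> borel_measurable borel" by (rule borel_measurable_continuous_onI[OF \<psi>(1)])
    then have mf: "(\<lambda>x. \<psi> (f x)) \<in> borel_measurable borel" using measurable_compose[OF fm] by blast
    have "integral\<^sup>L M (\<lambda>x. \<psi> (f x)) - integral\<^sup>L M \<psi>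
        = (\<Sum>x\<in>E. p x / n * (\<Sum>i<n. \<psi> ((f ^^ Suc i) x) - \<psi> ((f ^^ i) x)))"
      unfolding intM[OF m] intM[OF mf]
      by (simp add: sum_subtractf[symmetric] sum_distrib_left right_diff_distrib)
    also have "\<dots> = (\<Sum>x\<in>E. p x / n * (\<psi> ((f ^^ n) x) - \<psi> x))"
    proof (rule sum.cong[OF refl])
      fix x
      have "(\<Sum>i<n. \<psi> ((f ^^ Suc i) x) - \<psi> ((f ^^ i) x)) = \<psi> ((f ^^ n) x) - \<psi> x"
        using sum_lessThan_telescope[of "\<lambda>i. \<psi> ((f ^^ i) x)" n] by simp
      then show "p x / n * (\<Sum>i<n. \<psi> ((f ^^ Suc i) x) - \<psi> ((f ^^ i) x)) = p x / n * (\<psi> ((f ^^ n) x) - \<psi> x)"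
        by (simp only:)
    qed
    finally have "\<bar>integral\<^sup>L M (\<lambda>x. \<psi> (f x)) - integral\<^sup>L M \<psi>\<bar>
        \<le> (\<Sum>x\<in>E. \<bar>p x / n * (\<psi> ((f ^^ n) x) - \<psi> x)\<bar>)" by (simp only: sum_abs)
    also have "\<dots> \<le> (\<Sum>x\<in>E. p x / n * (2 * B))"
    proof (rule sum_mono)
      fix x
      have "\<bar>\<psi> ((f ^^ n) x) - \<psi> x\<bar> \<le> 2 * B" using \<psi>(2)[of "(f ^^ n) x"] \<psi>(2)[of x] by linarith
      then have "p x / n * \<bar>\<psi> ((f ^^ n) x) - \<psi> x\<bar> \<le> p x / n * (2 * B)"
        using p0[of x] by (intro mult_left_mono) auto
      then show "\<bar>p x / n * (\<psi> ((f ^^ n) x) - \<psi> x)\<bar> \<le> p x / n * (2 * B)"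
        using p0[of x] by (simp add: abs_mult)
    qed
    also have "\<dots> = 2 * B / n" using p1 by (simp flip: sum_distrib_right sum_divide_distrib)
    finally show ?thesis .
  qed
  have entropy: "q * ln ?Z
       \<le> real q ^ 2 * ln (card (range c)) + n * label_entropy M (itinerary f q c) + real q * real n * integral\<^sup>L M \<phi> + q * ln 2"
    if c: "simple_function borel c" "\<And>x y. c x = c y \<Longrightarrow> dist x y < e" and q: "q \<ge> 1" for c :: "'a \<Rightarrow> 'a set" and q
  proof -
    interpret \<sigma>: borel_prob \<sigma> by (rule \<sigma>(1))
    interpret M: borel_prob M by (rule M(1))
    note sf = simple_function_borel_iff[OF \<sigma>.sets_borel]
    let ?w = "itinerary f n c" and ?v = "itinerary f q c"
    have w: "simple_function borel ?w" and v: "simple_function borel ?v"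
      by (rule simple_function_itinerary[OF c(1) fm])+
    have finw: "finite (range ?w)" using simple_functionD(1)[OF w] by simp
    have inj: "inj_on ?w E"
    proof (rule inj_onI, rule ccontr)
      fix x y assume xy: "x \<in> E" "y \<in> E" "?w x = ?w y" "x \<noteq> y"
      then obtain i where "i < n" "dist ((f ^^ i) x) ((f ^^ i) y) > e"
        using E(2) unfolding dyn_separated_def by blast
      moreover have "c ((f ^^ i) x) = c ((f ^^ i) y)" using xy(3) \<open>i < n\<close> by (simp add: itinerary_eq_iff)
      ultimately show False using c(2)[of "(f ^^ i) x" "(f ^^ i) y"] by simp
    qed
    have atom: "measure \<sigma> (?w -` {?w x}) = p x" if x: "x \<in> E" for x
    proof -
      have "?w -` {?w x} \<in> sets borel" using simple_functionD(2)[OF w, of "{?w x}"] by simp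
      then have "measure \<sigma> (?w -` {?w x}) = (\<Sum>y\<in>E. p y * indicator (?w -` {?w x}) y)" by (rule \<sigma>(2))
      also have "\<dots> = (\<Sum>y\<in>E. if y = x then p y else 0)"
        using inj x by (intro sum.cong) (auto simp: indicator_def dest: inj_onD)
      also have "\<dots> = p x" using E(1) x by simp
      finally show ?thesis .
    qed
    have off: "measure \<sigma> (?w -` {u}) = 0" if u: "u \<notin> ?w ` E" for u
    proof -
      have "?w -` {u} \<in> sets borel" using simple_functionD(2)[OF w, of "{u}"] by simp
      then have "measure \<sigma> (?w -` {u}) = (\<Sum>y\<in>E. p y * indicator (?w -` {u}) y)" by (rule \<sigma>(2))
      also have "\<dots> = 0" using u by (intro sum.neutral) (auto simp: indicator_def)
      finally show ?thesis .
    qed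
    have "label_entropy \<sigma> ?w = - (\<Sum>u\<in>?w ` E. measure \<sigma> (?w -` {u}) * ln (measure \<sigma> (?w -` {u})))"
      unfolding label_entropy_def using finw off
      by (intro arg_cong[where f = uminus] sum.mono_neutral_right) auto
    also have "\<dots> = - (\<Sum>x\<in>E. p x * ln (p x))" using inj by (simp add: sum.reindex atom)
    also have "\<dots> = (\<Sum>x\<in>E. p x * ln W - p x * S x)"
    proof -
      have "ln (p x) = S x - ln W" for x using W by (simp add: p_def ln_div)
      then show ?thesis by (simp add: right_diff_distrib flip: sum_negf)
    qed
    also have "\<dots> = ln W - (\<Sum>x\<in>E. p x * S x)"
      using p1 by (simp add: sum_subtractf flip: sum_distrib_right)
    finally have HW: "ln W = label_entropy \<sigma> ?w + (\<Sum>x\<in>E. p x * S x)" by simp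
    have "real q * real n * integral\<^sup>L M \<phi> = q * (\<Sum>x\<in>E. \<Sum>i<n. p x * \<phi> ((f ^^ i) x))"
      using intM[OF borel_measurable_continuous_onI[OF \<phi>]] n by (simp add: sum_distrib_left)
    also have "(\<Sum>x\<in>E. \<Sum>i<n. p x * \<phi> ((f ^^ i) x)) = (\<Sum>x\<in>E. p x * S x)"
      by (simp add: S_def birkhoff_sum_def sum_distrib_left)
    finally have energy: "real q * real n * integral\<^sup>L M \<phi> = q * (\<Sum>x\<in>E. p x * S x)" .
    have "(\<Sum>i<n. (1 / n) * label_entropy \<sigma> (\<lambda>x. ?v ((f ^^ i) x))) \<le> label_entropy M ?v"
    proof (rule label_entropy_concave)
      fix u
      have A: "?v -` {u} \<in> sets borel" using simple_functionD(2)[OF v, of "{u}"] by simp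
      have "measure M (?v -` {u}) = (\<Sum>x\<in>E. \<Sum>i<n. p x / n * indicator (?v -` {u}) ((f ^^ i) x))"
        using M(2)[OF A] double by simp
      also have "\<dots> = (\<Sum>i<n. \<Sum>x\<in>E. p x / n * indicator (?v -` {u}) ((f ^^ i) x))" by (rule sum.swap)
      also have "\<dots> = (\<Sum>i<n. 1 / n * measure \<sigma> ((\<lambda>x. ?v ((f ^^ i) x)) -` {u}))"
      proof (rule sum.cong[OF refl])
        fix i
        have "(f ^^ i) -` (?v -` {u}) \<in> sets borel"
          using measurable_sets[OF measurable_funpow[OF fm] A] by simp
        then have "measure \<sigma> ((f ^^ i) -` (?v -` {u})) = (\<Sum>x\<in>E. p x * indicator ((f ^^ i) -` (?v -` {u})) x)"
          by (rule \<sigma>(2))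
        moreover have "(\<lambda>x. ?v ((f ^^ i) x)) -` {u} = (f ^^ i) -` (?v -` {u})" by auto
        ultimately show "(\<Sum>x\<in>E. p x / n * indicator (?v -` {u}) ((f ^^ i) x)) = 1 / n * measure \<sigma> ((\<lambda>x. ?v ((f ^^ i) x)) -` {u})"
          by (simp add: sum_distrib_left indicator_def)
      qed
      finally show "measure M (?v -` {u}) = (\<Sum>i<n. 1 / n * measure \<sigma> ((\<lambda>x. ?v ((f ^^ i) x)) -` {u}))" .
    next
      show "finite (range ?v)" using simple_functionD(1)[OF v] by simp
    qed (use n in auto)
    then have "(\<Sum>i<n. label_entropy \<sigma> (\<lambda>x. ?v ((f ^^ i) x))) / n \<le> label_entropy M ?v"
      by (simp flip: sum_divide_distrib)
    then have avg: "(\<Sum>i<n. label_entropy \<sigma> (\<lambda>x. ?v ((f ^^ i) x))) \<le> n * label_entropy M ?v"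
      using n by (simp add: field_simps)
    have f\<sigma>: "f \<in> measurable \<sigma> \<sigma>" using fm by simp
    have "q * label_entropy \<sigma> ?w \<le> real q ^ 2 * ln (card (range c)) + (\<Sum>i<n. label_entropy \<sigma> (\<lambda>x. ?v ((f ^^ i) x)))"
      by (rule \<sigma>.window_entropy[OF f\<sigma> _ q]) (use c(1) sf in blast)
    then have "q * ln W \<le> real q ^ 2 * ln (card (range c)) + n * label_entropy M ?v + real q * real n * integral\<^sup>L M \<phi>"
      using avg energy unfolding HW distrib_left by linarith
    moreover have "ln ?Z \<le> ln W + ln 2"
    proof -
      have "ln ?Z \<le> ln (W * 2)" using W Z by simp
      then show ?thesis using W by (simp add: ln_mult_pos)
    qed
    then have "q * ln ?Z \<le> q * (ln W + ln 2)" by (intro mult_left_mono) auto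
    ultimately show ?thesis by (simp add: distrib_left)
  qed
  show ?thesis by (rule that[OF M(1) almost entropy])
qed

section \<open>Topological pressure is approached by invariant measures\<close>

text \<open>The lower half of the variational principle, at a fixed scale \<open>e\<close>. The invariant measure is a weak
  limit of empirical measures along times that realise the limes superior. Since the labelling has
  null boundary, the entropies of its itineraries of length \<open>q\<close> converge along the sequence; then
  \<open>q\<close> tends to infinity.\<close>
theorem pressure_at_le_measure_pressure:
  fixes f :: "'a::metric_space \<Rightarrow> 'a"
  assumes cmp: "compact (UNIV :: 'a set)" and f: "continuous_on UNIV f" and \<phi>: "continuous_on UNIV \<phi>"
    and e: "e > 0"
  obtains \<mu> where "\<mu> \<in> invariant_measures f"
    "limsup (\<lambda>n. ereal (ln (separated_partition_function f \<phi> n e) / real n)) \<le> measure_pressure f \<mu> \<phi>"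
proof -
  have fm: "f \<in> borel_measurable borel" by (rule borel_measurable_continuous_onI[OF f])
  let ?Z = "\<lambda>n. separated_partition_function f \<phi> n e"
  let ?u = "\<lambda>n. ereal (ln (?Z n) / real n)"
  let ?P = "limsup ?u"
  obtain r0 where r0: "strict_mono (r0 :: nat \<Rightarrow> nat)" "(?u \<circ> r0) \<longlonglongrightarrow> ?P"
    using limsup_subseq_lim[of ?u] by blast
  \<comment> \<open>the shift keeps the times positive\<close>
  define r where "r k = r0 (Suc k)" for k
  have r1: "r k \<ge> Suc k" for k unfolding r_def by (rule strict_mono_imp_increasing[OF r0(1)])
  have rlim: "(\<lambda>k. ?u (r k)) \<longlonglongrightarrow> ?P"
    using LIMSEQ_Suc[OF r0(2)] by (simp add: r_def comp_def)
  define good where "good k M \<longleftrightarrow> borel_prob M \<and>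
    (\<forall>\<psi> B. continuous_on UNIV \<psi> \<longrightarrow> (\<forall>x. \<bar>\<psi> x\<bar> \<le> B) \<longrightarrow>
       \<bar>integral\<^sup>L M (\<lambda>x. \<psi> (f x)) - integral\<^sup>L M \<psi>\<bar> \<le> 2 * B / r k) \<and>
    (\<forall>(c :: 'a \<Rightarrow> 'a set) q. simple_function borel c \<longrightarrow> (\<forall>x y. c x = c y \<longrightarrow> dist x y < e) \<longrightarrow> q \<ge> 1 \<longrightarrow>
       q * ln (?Z (r k)) \<le> real q ^ 2 * ln (card (range c)) + r k * label_entropy M (itinerary f q c)
         + real q * real (r k) * integral\<^sup>L M \<phi> + q * ln 2)" for k M
  have "\<exists>M. good k M" for k
  proof -
    have n: "r k \<ge> 1" using r1[of k] by simp
    show ?thesis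
    proof (rule empirical_measure[OF cmp f \<phi> e n])
    fix M assume M: "borel_prob M"
      "\<And>\<psi> B. continuous_on UNIV \<psi> \<Longrightarrow> (\<And>x. \<bar>\<psi> x\<bar> \<le> B) \<Longrightarrow>
         \<bar>integral\<^sup>L M (\<lambda>x. \<psi> (f x)) - integral\<^sup>L M \<psi>\<bar> \<le> 2 * B / r k"
      "\<And>(c :: 'a \<Rightarrow> 'a set) q. simple_function borel c \<Longrightarrow> (\<And>x y. c x = c y \<Longrightarrow> dist x y < e) \<Longrightarrow> q \<ge> 1 \<Longrightarrow>
         q * ln (?Z (r k)) \<le> real q ^ 2 * ln (card (range c)) + r k * label_entropy M (itinerary f q c)
           + real q * real (r k) * integral\<^sup>L M \<phi> + q * ln 2"
    have "good k M"
      unfolding good_def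
    proof (intro conjI allI impI)
      fix \<psi> :: "'a \<Rightarrow> real" and B assume "continuous_on UNIV \<psi>" "\<forall>x. \<bar>\<psi> x\<bar> \<le> B"
      then show "\<bar>integral\<^sup>L M (\<lambda>x. \<psi> (f x)) - integral\<^sup>L M \<psi>\<bar> \<le> 2 * B / r k" by (intro M(2)) auto
    next
      fix c :: "'a \<Rightarrow> 'a set" and q :: nat
      assume "simple_function borel c" "\<forall>x y. c x = c y \<longrightarrow> dist x y < e" "q \<ge> 1"
      then show "q * ln (?Z (r k)) \<le> real q ^ 2 * ln (card (range c)) + r k * label_entropy M (itinerary f q c)
           + real q * real (r k) * integral\<^sup>L M \<phi> + q * ln 2" by (intro M(3)) auto
    qed (rule M(1))
    then show "\<exists>M. good k M" ..
    qed
  qed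
  then obtain Q where Q: "\<And>k. good k (Q k)" by metis
  have Qp: "borel_prob (Q k)" for k using Q[of k] unfolding good_def by blast
  have Qinv: "\<bar>integral\<^sup>L (Q k) (\<lambda>x. \<psi> (f x)) - integral\<^sup>L (Q k) \<psi>\<bar> \<le> 2 * B / r k"
    if "continuous_on UNIV \<psi>" "\<And>x. \<bar>\<psi> x\<bar> \<le> B" for \<psi> B k
    using Q[of k] that unfolding good_def by blast
  have Qent: "q * ln (?Z (r k)) \<le> real q ^ 2 * ln (card (range c)) + r k * label_entropy (Q k) (itinerary f q c)
         + real q * real (r k) * integral\<^sup>L (Q k) \<phi> + q * ln 2"
    if "simple_function borel c" "\<And>x y. c x = c y \<Longrightarrow> dist x y < e" "q \<ge> 1" for c :: "'a \<Rightarrow> 'a set" and q k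
    using Q[of k] that unfolding good_def by blast
  obtain s \<mu> where s: "strict_mono (s :: nat \<Rightarrow> nat)" and mp: "borel_prob \<mu>" and conv: "weakly_converges (Q \<circ> s) \<mu>"
    by (rule weak_sequential_compactness[OF cmp Qp])
  have rs: "r (s k) \<ge> Suc k" for k
    using r1[of "s k"] strict_mono_imp_increasing[OF s, of k] by simp
  have inv_lim: "(\<lambda>k. C / r (s k)) \<longlonglongrightarrow> 0" for C
  proof -
    have "filterlim (\<lambda>k. r (s k)) at_top sequentially"
      by (rule filterlim_at_top_mono[OF filterlim_Suc]) (use rs in auto)
    then have "filterlim (\<lambda>k. real (r (s k))) at_top sequentially"
      by (rule filterlim_compose[OF filterlim_real_sequentially])
    then show ?thesis by (rule real_tendsto_divide_at_top[OF tendsto_const])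
  qed
  have mu: "\<mu> \<in> invariant_measures f"
  proof (rule weak_limit_invariant[OF cmp f mp conv])
    fix \<psi> :: "'a \<Rightarrow> real" assume \<psi>: "continuous_on UNIV \<psi>"
    obtain B where B: "\<And>x. \<bar>\<psi> x\<bar> \<le> B"
      using compact_imp_bounded[OF compact_continuous_image[OF \<psi> cmp]] by (auto simp: bounded_iff)
    show "(\<lambda>n. integral\<^sup>L ((Q \<circ> s) n) (\<lambda>x. \<psi> (f x)) - integral\<^sup>L ((Q \<circ> s) n) \<psi>) \<longlonglongrightarrow> 0"
      by (rule Lim_null_comparison[OF _ inv_lim[of "2 * B"]])
         (use Qinv[OF \<psi> B] in \<open>simp add: comp_def\<close>)
  qed
  interpret borel_prob \<mu> by (rule mp)
  obtain c :: "'a \<Rightarrow> 'a set" where c: "simple_function borel c" "\<And>x y. c x = c y \<Longrightarrow> dist x y < e"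
    "\<And>q. \<exists>N. closed N \<and> measure \<mu> N = 0 \<and> (\<forall>W. open (itinerary f q c -` W - N))"
    by (rule null_boundary_labelling[OF cmp f mu e], rule that; assumption)
  let ?H = "\<lambda>q. label_entropy \<mu> (itinerary f q c)" and ?I = "integral\<^sup>L \<mu> \<phi>"
  have bound: "?P \<le> ereal (?H q / q + ?I)" if q: "q \<ge> 1" for q
  proof -
    obtain N where N: "closed N" "measure \<mu> N = 0" "\<And>W. open (itinerary f q c -` W - N)"
      using c(3)[of q] by blast
    have Hlim: "(\<lambda>k. label_entropy ((Q \<circ> s) k) (itinerary f q c)) \<longlonglongrightarrow> ?H q"
      by (rule label_entropy_weak_limit[OF cmp _ mp conv simple_function_itinerary[OF c(1) fm] N])
         (simp add: Qp)
    have Ilim: "(\<lambda>k. integral\<^sup>L ((Q \<circ> s) k) \<phi>) \<longlonglongrightarrow> ?I" by (rule weakly_convergesD[OF conv \<phi>])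
    let ?L = "real q * ln (card (range c)) + ln 2"
    let ?Y = "\<lambda>k. ?L / r (s k) + label_entropy ((Q \<circ> s) k) (itinerary f q c) / q + integral\<^sup>L ((Q \<circ> s) k) \<phi>"
    have "?Y \<longlonglongrightarrow> 0 + ?H q / q + ?I"
      by (intro tendsto_add inv_lim Ilim tendsto_divide Hlim tendsto_const) (use q in simp)
    then have Ylim: "(\<lambda>k. ereal (?Y k)) \<longlonglongrightarrow> ereal (?H q / q + ?I)" by simp
    have "ln (?Z (r (s k))) / r (s k) \<le> ?Y k" for k
    proof -
      let ?n = "r (s k)"
      have n: "real ?n > 0" using rs[of k] by simp
      have "q * ln (?Z ?n) \<le> real q ^ 2 * ln (card (range c)) + ?n * label_entropy (Q (s k)) (itinerary f q c)
         + real q * real ?n * integral\<^sup>L (Q (s k)) \<phi> + q * ln 2"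
        by (rule Qent[OF c(1,2) q])
      also have "\<dots> = q * (?n * ?Y k)"
        using n q by (simp add: field_simps power2_eq_square)
      finally have "q * ln (?Z ?n) \<le> q * (?n * ?Y k)" .
      then have "ln (?Z ?n) \<le> ?n * ?Y k" using q by simp
      then show ?thesis using n by (simp add: divide_le_eq mult.commute)
    qed
    then have le: "(\<lambda>k. ?u (r k)) (s k) \<le> ereal (?Y k)" for k by simp
    have "((\<lambda>k. ?u (r k)) \<circ> s) \<longlonglongrightarrow> ?P" by (rule LIMSEQ_subseq_LIMSEQ[OF rlim s])
    then have "(\<lambda>k. (\<lambda>k. ?u (r k)) (s k)) \<longlonglongrightarrow> ?P" by (simp add: comp_def)
    from LIMSEQ_le[OF this Ylim] show ?thesis using le by blast
  qed
  let ?h = "entropy_wrt_partition f \<mu> (fibres c)"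
  have "(\<lambda>q. ereal (?H q / real q + ?I)) \<longlonglongrightarrow> ereal (?h + ?I)"
    by (intro tendsto_ereal tendsto_add entropy_of_labelling(1)[OF mu fm c(1)] tendsto_const)
  then have "?P \<le> ereal (?h + ?I)"
    by (rule LIMSEQ_le_const) (use bound in blast)
  also have "\<dots> = ereal ?h + ereal ?I" by simp
  also have "\<dots> \<le> measure_pressure f \<mu> \<phi>"
    unfolding measure_pressure_def by (intro add_right_mono entropy_of_labelling_le c(1))
  finally show ?thesis using mu by (intro that) auto
qed

section \<open>Existence of equilibrium states\<close>

text \<open>Integrals of continuous functions converge along the sequence, and this property passes from the
  generating sets to finite intersections and arbitrary unions.\<close>
lemma weak_star_open_eventually:
  assumes U: "openin (weak_star_topology f) U" and mu: "\<mu> \<in> U" "\<mu> \<in> invariant_measures f"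
    and Q: "\<And>n. Q n \<in> invariant_measures f" and conv: "weakly_converges Q \<mu>"
  shows "\<forall>\<^sub>F n in sequentially. Q n \<in> U"
  using U[unfolded weak_star_topology_def, THEN openin_topology_generated_by] mu(1)
proof induction
  case (Int a b)
  then show ?case by (auto intro: eventually_conj)
next
  case (UN K)
  then obtain k where k: "k \<in> K" "\<mu> \<in> k" by blast
  then have "\<forall>\<^sub>F n in sequentially. Q n \<in> k" using UN.IH by blast
  then show ?case by eventually_elim (use k in blast)
next
  case (Basis s)
  then obtain \<phi> V where s: "s = {\<mu> \<in> invariant_measures f. integral\<^sup>L \<mu> \<phi> \<in> V}"
    "continuous_on UNIV \<phi>" "open (V :: real set)" by blast
  have "\<forall>\<^sub>F n in sequentially. integral\<^sup>L (Q n) \<phi> \<in> V"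
    using weakly_convergesD[OF conv s(2)] s(3) Basis by (intro topological_tendstoD) (auto simp: s(1))
  then show ?case using Q by (simp add: s(1))
qed simp

lemma metric_entropy_eventually_less:
  assumes usc: "upper_semicontinuous_map (weak_star_topology f) (metric_entropy f)"
    and mu: "\<mu> \<in> invariant_measures f" and Q: "\<And>n. Q n \<in> invariant_measures f"
    and conv: "weakly_converges Q \<mu>" and c: "metric_entropy f \<mu> < c"
  shows "\<forall>\<^sub>F n in sequentially. metric_entropy f (Q n) < c"
proof -
  let ?T = "weak_star_topology f"
  have "{\<mu>\<in>invariant_measures f. integral\<^sup>L \<mu> (\<lambda>_. 0) \<in> (UNIV :: real set)} \<subseteq> topspace ?T"
    unfolding weak_star_topology_def topology_generated_by_topspace by (rule Union_upper) force
  then have "\<mu> \<in> {x \<in> topspace ?T. metric_entropy f x < c}" using mu c by auto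
  moreover have "openin ?T {x \<in> topspace ?T. metric_entropy f x < c}"
    using usc by (simp add: upper_semicontinuous_map_def)
  ultimately have "\<forall>\<^sub>F n in sequentially. Q n \<in> {x \<in> topspace ?T. metric_entropy f x < c}"
    using weak_star_open_eventually[OF _ _ mu Q conv] by blast
  then show ?thesis by eventually_elim simp
qed

text \<open>Upper semicontinuity is used in sequential form: bounds from above persist along weakly convergent
  sequences.\<close>
lemma measure_pressure_eventually_less:
  fixes f :: "'a::metric_space \<Rightarrow> 'a"
  assumes f: "continuous_on UNIV f" and \<phi>: "continuous_on UNIV \<phi>"
    and usc: "upper_semicontinuous_map (weak_star_topology f) (metric_entropy f)"
    and mu: "\<mu> \<in> invariant_measures f" and Q: "\<And>n. Q n \<in> invariant_measures f"
    and conv: "weakly_converges Q \<mu>" and c: "measure_pressure f \<mu> \<phi> < ereal c"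
  shows "\<forall>\<^sub>F n in sequentially. measure_pressure f (Q n) \<phi> < ereal c"
proof -
  have fm: "f \<in> borel_measurable borel" by (rule borel_measurable_continuous_onI[OF f])
  have nonneg: "metric_entropy f \<nu> \<ge> 0" if "\<nu> \<in> invariant_measures f" for \<nu>
    using metric_entropy_nonneg[OF that fm] .
  obtain h where h: "metric_entropy f \<mu> = ereal h"
    using c nonneg[OF mu] unfolding measure_pressure_def by (cases "metric_entropy f \<mu>") auto
  define d where "d = (h + (c - integral\<^sup>L \<mu> \<phi>)) / 2"
  have d: "h < d" "integral\<^sup>L \<mu> \<phi> < c - d" using c by (auto simp: measure_pressure_def h d_def field_simps)
  have "\<forall>\<^sub>F n in sequentially. metric_entropy f (Q n) < ereal d"
    by (rule metric_entropy_eventually_less[OF usc mu Q conv]) (simp add: h d)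
  moreover have "\<forall>\<^sub>F n in sequentially. integral\<^sup>L (Q n) \<phi> < c - d"
    using weakly_convergesD[OF conv \<phi>] d(2) by (rule order_tendstoD)
  ultimately show ?thesis
  proof eventually_elim
    case (elim n)
    then show ?case using nonneg[OF Q[of n]]
      unfolding measure_pressure_def by (cases "metric_entropy f (Q n)") auto
  qed
qed

lemma invariant_measures_nonempty:
  fixes f :: "'a::metric_space \<Rightarrow> 'a"
  assumes cmp: "compact (UNIV :: 'a set)" and f: "continuous_on UNIV f"
  shows "invariant_measures f \<noteq> {}"
  using pressure_at_le_measure_pressure[OF cmp f, of "\<lambda>_. 0" 1] by fastforce

text \<open>Choose measures whose pressure is at least the pressure at scale \<open>1 / Suc j\<close>. By upper semicontinuity a
  weak limit has pressure at least the supremum over all scales, and it cannot have more.\<close>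
theorem equilibrium_states_nonempty:
  fixes f :: "'a::metric_space \<Rightarrow> 'a"
  assumes cmp: "compact (UNIV :: 'a set)" and f: "continuous_on UNIV f" and \<phi>: "continuous_on UNIV \<phi>"
    and usc: "upper_semicontinuous_map (weak_star_topology f) (metric_entropy f)"
  shows "equilibrium_states f \<phi> \<noteq> {}"
proof -
  let ?F = "\<lambda>e. limsup (\<lambda>n. ereal (ln (separated_partition_function f \<phi> n e) / real n))"
  let ?P = "topological_pressure f \<phi>"
  have "\<exists>\<mu>. \<mu> \<in> invariant_measures f \<and> ?F (1 / Suc j) \<le> measure_pressure f \<mu> \<phi>" for j
    by (rule pressure_at_le_measure_pressure[OF cmp f \<phi>, of "1 / Suc j"]) auto
  then obtain Q where Q: "\<And>j. Q j \<in> invariant_measures f" "\<And>j. ?F (1 / Suc j) \<le> measure_pressure f (Q j) \<phi>"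
    by metis
  obtain r \<mu> where r: "strict_mono (r :: nat \<Rightarrow> nat)" and mu: "\<mu> \<in> invariant_measures f"
    and conv: "weakly_converges (Q \<circ> r) \<mu>"
    by (rule invariant_measures_sequentially_compact[OF cmp f Q(1)])
  have "?P \<le> measure_pressure f \<mu> \<phi>"
  proof (rule ccontr)
    assume "\<not> ?thesis"
    then obtain c where c: "measure_pressure f \<mu> \<phi> < ereal c" "ereal c < ?P"
      using ereal_dense2[of "measure_pressure f \<mu> \<phi>" ?P] unfolding not_le by blast
    then obtain e where e: "e > 0" "ereal c < ?F e"
      unfolding topological_pressure_eq_SUP[OF cmp f \<phi>] by (auto simp: less_SUP_iff)
    obtain m where m: "1 / Suc m < e" using e(1) nat_approx_posE by blast
    have "ereal c < measure_pressure f (Q j) \<phi>" if "j \<ge> m" for j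
    proof -
      have "1 / real (Suc j) \<le> 1 / real (Suc m)" using that by (intro divide_left_mono) auto
      then have "?F e \<le> ?F (1 / Suc j)"
        using m by (intro pressure_at_antimono[OF cmp f \<phi>]) auto
      with e(2) Q(2)[of j] show ?thesis by simp
    qed
    moreover have "\<forall>\<^sub>F n in sequentially. measure_pressure f ((Q \<circ> r) n) \<phi> < ereal c"
      by (rule measure_pressure_eventually_less[OF f \<phi> usc mu _ conv c(1)]) (simp add: Q(1))
    then obtain n where "\<And>k. k \<ge> n \<Longrightarrow> measure_pressure f (Q (r k)) \<phi> < ereal c"
      by (auto simp: eventually_sequentially)
    moreover have "r (max n m) \<ge> m" using strict_mono_imp_increasing[OF r, of "max n m"] by simp
    ultimately show False by (meson max.cobounded1 less_asym)
  qed
  with measure_pressure_le_topological_pressure[OF cmp f \<phi> mu] mu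
  show ?thesis by (auto simp: equilibrium_states_def)
qed

lemma equilibrium_states_eq_argmax:
  fixes f :: "'a::metric_space \<Rightarrow> 'a"
  assumes cmp: "compact (UNIV :: 'a set)" and f: "continuous_on UNIV f" and \<phi>: "continuous_on UNIV \<phi>"
    and usc: "upper_semicontinuous_map (weak_star_topology f) (metric_entropy f)"
  shows "equilibrium_states f \<phi> = {\<mu> \<in> invariant_measures f.
    \<forall>\<nu>\<in>invariant_measures f. measure_pressure f \<nu> \<phi> \<le> measure_pressure f \<mu> \<phi>}"
proof -
  obtain \<mu>0 where "\<mu>0 \<in> equilibrium_states f \<phi>" using equilibrium_states_nonempty[OF cmp f \<phi> usc] by blast
  then have \<mu>0: "\<mu>0 \<in> invariant_measures f" "measure_pressure f \<mu>0 \<phi> = topological_pressure f \<phi>"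
    by (auto simp: equilibrium_states_def)
  note le = measure_pressure_le_topological_pressure[OF cmp f \<phi>]
  show ?thesis
    unfolding equilibrium_states_def
  proof (intro set_eqI iffI; clarsimp)
    show "measure_pressure f \<nu> \<phi> \<le> topological_pressure f \<phi>" if "\<nu> \<in> invariant_measures f" for \<nu>
      by (rule le[OF that])
    fix \<mu> assume "\<mu> \<in> invariant_measures f"
      and "\<forall>\<nu>\<in>invariant_measures f. measure_pressure f \<nu> \<phi> \<le> measure_pressure f \<mu> \<phi>"
    then show "measure_pressure f \<mu> \<phi> = topological_pressure f \<phi>"
      using le[of \<mu>] \<mu>0 by (metis antisym)
  qed
qed

section \<open>Ergodic measures in closed faces\<close>

text \<open>A closed extremal set of the convex set of invariant measures: it contains the components of each
  proper convex combination that it contains. Measures carry no linear structure, so the combination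
  is expressed by its values on Borel sets; the roles of \<open>P\<close> and \<open>Q\<close> are symmetric.\<close>
definition closed_face :: "('a::metric_space \<Rightarrow> 'a) \<Rightarrow> 'a measure set \<Rightarrow> bool" where
  "closed_face f K \<longleftrightarrow> K \<subseteq> invariant_measures f \<and>
     (\<forall>Q \<mu>. (\<forall>n. Q n \<in> K) \<longrightarrow> weakly_converges Q \<mu> \<longrightarrow> \<mu> \<in> invariant_measures f \<longrightarrow> \<mu> \<in> K) \<and>
     (\<forall>\<mu>\<in>K. \<forall>P\<in>invariant_measures f. \<forall>Q\<in>invariant_measures f. \<forall>s. 0 < s \<longrightarrow> s < 1 \<longrightarrow>
        (\<forall>A\<in>sets borel. measure \<mu> A = s * measure P A + (1 - s) * measure Q A) \<longrightarrow> P \<in> K)"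

lemma closed_faceD:
  assumes "closed_face f K"
  shows "K \<subseteq> invariant_measures f"
    "(\<And>n. Q n \<in> K) \<Longrightarrow> weakly_converges Q \<mu> \<Longrightarrow> \<mu> \<in> invariant_measures f \<Longrightarrow> \<mu> \<in> K"
    "\<mu> \<in> K \<Longrightarrow> P \<in> invariant_measures f \<Longrightarrow> P' \<in> invariant_measures f \<Longrightarrow> 0 < s \<Longrightarrow> s < 1 \<Longrightarrow>
        (\<And>A. A \<in> sets borel \<Longrightarrow> measure \<mu> A = s * measure P A + (1 - s) * measure P' A) \<Longrightarrow> P \<in> K"
    "\<mu> \<in> K \<Longrightarrow> P \<in> invariant_measures f \<Longrightarrow> P' \<in> invariant_measures f \<Longrightarrow> 0 < s \<Longrightarrow> s < 1 \<Longrightarrow>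
        (\<And>A. A \<in> sets borel \<Longrightarrow> measure \<mu> A = s * measure P A + (1 - s) * measure P' A) \<Longrightarrow> P' \<in> K"
proof -
  note face = assms[unfolded closed_face_def]
  show "K \<subseteq> invariant_measures f" using face by blast
  show "(\<And>n. Q n \<in> K) \<Longrightarrow> weakly_converges Q \<mu> \<Longrightarrow> \<mu> \<in> invariant_measures f \<Longrightarrow> \<mu> \<in> K"
    using face by blast
  show P: "P \<in> K" if "\<mu> \<in> K" "P \<in> invariant_measures f" "P' \<in> invariant_measures f" "0 < s" "s < 1"
    "\<And>A. A \<in> sets borel \<Longrightarrow> measure \<mu> A = s * measure P A + (1 - s) * measure P' A" for \<mu> P P' and s :: real
    using face that by blast
  show "\<mu> \<in> K \<Longrightarrow> P \<in> invariant_measures f \<Longrightarrow> P' \<in> invariant_measures f \<Longrightarrow> 0 < s \<Longrightarrow> s < 1 \<Longrightarrow>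
        (\<And>A. A \<in> sets borel \<Longrightarrow> measure \<mu> A = s * measure P A + (1 - s) * measure P' A) \<Longrightarrow> P' \<in> K"
    using P[of \<mu> P' P "1 - s"] by (simp add: add.commute)
qed

lemma closed_face_invariant_measures: "closed_face f (invariant_measures f)"
  by (auto simp: closed_face_def)

lemma integral_attains_max:
  fixes f :: "'a::metric_space \<Rightarrow> 'a" and g :: "'a \<Rightarrow> real"
  assumes cmp: "compact (UNIV :: 'a set)" and f: "continuous_on UNIV f" and g: "continuous_on UNIV g"
    and K: "closed_face f K" "K \<noteq> {}"
  obtains \<mu> where "\<mu> \<in> K" "\<And>\<nu>. \<nu> \<in> K \<Longrightarrow> integral\<^sup>L \<nu> g \<le> integral\<^sup>L \<mu> g"
proof -
  obtain B where B: "\<And>x. \<bar>g x\<bar> \<le> B"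
    using compact_imp_bounded[OF compact_continuous_image[OF g cmp]] by (auto simp: bounded_iff)
  let ?S = "(\<lambda>\<nu>. integral\<^sup>L \<nu> g) ` K"
  have "integral\<^sup>L \<nu> g \<le> B" if "\<nu> \<in> K" for \<nu>
  proof -
    interpret borel_prob \<nu> using closed_faceD(1)[OF K(1)] that by (blast intro: invariant_borel_prob)
    show ?thesis
      using B by (intro integral_le_const continuous_integrable[OF cmp g]) (auto simp: abs_le_iff)
  qed
  then have bdd: "bdd_above ?S" by (intro bdd_aboveI2)
  have "\<exists>\<nu>\<in>K. Sup ?S - 1 / Suc j < integral\<^sup>L \<nu> g" for j
  proof -
    obtain t where "t \<in> ?S" "Sup ?S - 1 / Suc j < t"
      using less_cSupE[of "Sup ?S - 1 / Suc j" ?S] K(2) by auto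
    then show ?thesis by blast
  qed
  then obtain Q where Q: "\<And>j. Q j \<in> K" "\<And>j. Sup ?S - 1 / Suc j < integral\<^sup>L (Q j) g" by metis
  have Qi: "Q j \<in> invariant_measures f" for j using Q(1) closed_faceD(1)[OF K(1)] by blast
  obtain r \<mu> where r: "strict_mono (r :: nat \<Rightarrow> nat)" and mu: "\<mu> \<in> invariant_measures f"
    and conv: "weakly_converges (Q \<circ> r) \<mu>"
    by (rule invariant_measures_sequentially_compact[OF cmp f Qi])
  have "\<mu> \<in> K" by (rule closed_faceD(2)[OF K(1) _ conv mu]) (simp add: Q(1))
  moreover have sup: "Sup ?S \<le> integral\<^sup>L \<mu> g"
  proof (rule LIMSEQ_le)
    have "(\<lambda>k. Sup ?S - 1 / real (Suc k)) \<longlonglongrightarrow> Sup ?S - 0"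
      by (intro tendsto_diff tendsto_const LIMSEQ_Suc[OF lim_1_over_n])
    then show "(\<lambda>k. Sup ?S - 1 / real (Suc k)) \<longlonglongrightarrow> Sup ?S" by simp
    show "(\<lambda>k. integral\<^sup>L ((Q \<circ> r) k) g) \<longlonglongrightarrow> integral\<^sup>L \<mu> g" by (rule weakly_convergesD[OF conv g])
    have "Sup ?S - 1 / real (Suc k) \<le> integral\<^sup>L ((Q \<circ> r) k) g" for k
    proof -
      have "1 / real (Suc (r k)) \<le> 1 / real (Suc k)"
        using strict_mono_imp_increasing[OF r, of k] by (intro divide_left_mono) auto
      with Q(2)[of "r k"] show ?thesis by simp
    qed
    then show "\<exists>N. \<forall>n\<ge>N. Sup ?S - 1 / real (Suc n) \<le> integral\<^sup>L ((Q \<circ> r) n) g" by blast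
  qed
  have "integral\<^sup>L \<nu> g \<le> integral\<^sup>L \<mu> g" if "\<nu> \<in> K" for \<nu>
    using cSup_upper[OF imageI[OF that] bdd] sup by (rule order_trans)
  ultimately show ?thesis by (rule that)
qed

lemma integral_invariant_combination:
  fixes f :: "'a::metric_space \<Rightarrow> 'a"
  assumes cmp: "compact (UNIV :: 'a set)" and g: "continuous_on UNIV (g :: 'a \<Rightarrow> real)"
    and mu: "\<mu> \<in> invariant_measures f" and P: "P \<in> invariant_measures f" and Q: "Q \<in> invariant_measures f"
    and s: "0 < s" "s < 1"
    and comb: "\<And>A. A \<in> sets borel \<Longrightarrow> measure \<mu> A = s * measure P A + (1 - s) * measure Q A"
  shows "integral\<^sup>L \<mu> g = s * integral\<^sup>L P g + (1 - s) * integral\<^sup>L Q g"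
  using s compact_imp_bounded[OF compact_continuous_image[OF g cmp]]
  by (intro integral_convex_combination invariant_borel_prob[OF P] invariant_borel_prob[OF Q]
      invariant_borel_prob[OF mu] comb borel_measurable_continuous_onI[OF g]) auto

text \<open>The integral is affine, so both components of a maximiser are maximisers.\<close>
lemma closed_face_argmax:
  fixes f :: "'a::metric_space \<Rightarrow> 'a" and g :: "'a \<Rightarrow> real"
  assumes cmp: "compact (UNIV :: 'a set)" and g: "continuous_on UNIV g" and K: "closed_face f K"
  shows "closed_face f {\<mu> \<in> K. \<forall>\<nu>\<in>K. integral\<^sup>L \<nu> g \<le> integral\<^sup>L \<mu> g}"
  unfolding closed_face_def
proof (intro conjI allI impI ballI)
  show "{\<mu> \<in> K. \<forall>\<nu>\<in>K. integral\<^sup>L \<nu> g \<le> integral\<^sup>L \<mu> g} \<subseteq> invariant_measures f"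
    using closed_faceD(1)[OF K] by blast
next
  fix Q \<mu> assume Q: "\<forall>n. Q n \<in> {\<mu> \<in> K. \<forall>\<nu>\<in>K. integral\<^sup>L \<nu> g \<le> integral\<^sup>L \<mu> g}"
    and conv: "weakly_converges Q \<mu>" and mu: "\<mu> \<in> invariant_measures f"
  have "\<mu> \<in> K" using closed_faceD(2)[OF K _ conv mu] Q by blast
  moreover have "integral\<^sup>L \<nu> g \<le> integral\<^sup>L \<mu> g" if "\<nu> \<in> K" for \<nu>
    using Q that by (intro LIMSEQ_le_const[OF weakly_convergesD[OF conv g]]) blast
  ultimately show "\<mu> \<in> {\<mu> \<in> K. \<forall>\<nu>\<in>K. integral\<^sup>L \<nu> g \<le> integral\<^sup>L \<mu> g}" by blast
next
  fix \<mu> P Q and s :: real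
  assume m: "\<mu> \<in> {\<mu> \<in> K. \<forall>\<nu>\<in>K. integral\<^sup>L \<nu> g \<le> integral\<^sup>L \<mu> g}"
    and P: "P \<in> invariant_measures f" and Q: "Q \<in> invariant_measures f" and s: "0 < s" "s < 1"
    and c: "\<forall>A\<in>sets borel. measure \<mu> A = s * measure P A + (1 - s) * measure Q A"
  have mu: "\<mu> \<in> K" "\<mu> \<in> invariant_measures f" using m closed_faceD(1)[OF K] by blast+
  have PK: "P \<in> K" and QK: "Q \<in> K"
    using closed_faceD(3)[OF K mu(1) P Q s] closed_faceD(4)[OF K mu(1) P Q s] c by blast+
  have "integral\<^sup>L \<mu> g = s * integral\<^sup>L P g + (1 - s) * integral\<^sup>L Q g"
    using integral_invariant_combination[OF cmp g mu(2) P Q s] c by blast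
  moreover have "(1 - s) * integral\<^sup>L Q g \<le> (1 - s) * integral\<^sup>L \<mu> g"
    using m QK s by (intro mult_left_mono) auto
  ultimately have "s * integral\<^sup>L \<mu> g \<le> s * integral\<^sup>L P g" by (simp add: algebra_simps)
  then have "integral\<^sup>L \<mu> g \<le> integral\<^sup>L P g" using s by simp
  then show "P \<in> {\<mu> \<in> K. \<forall>\<nu>\<in>K. integral\<^sup>L \<nu> g \<le> integral\<^sup>L \<mu> g}"
    using m PK by fastforce
qed

lemma conditional_measure_invariant:
  fixes f :: "'a::topological_space \<Rightarrow> 'a"
  assumes mu: "\<mu> \<in> invariant_measures f" and f: "f \<in> borel_measurable borel"
    and A: "A \<in> sets borel" "f -` A = A" and pos: "measure \<mu> A > 0"
  shows "uniform_measure \<mu> A \<in> invariant_measures f"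
    and "\<And>B. B \<in> sets borel \<Longrightarrow> measure (uniform_measure \<mu> A) B = measure \<mu> (A \<inter> B) / measure \<mu> A"
proof -
  interpret borel_prob \<mu> by (rule invariant_borel_prob[OF mu])
  have em: "emeasure \<mu> A \<noteq> 0" "emeasure \<mu> A \<noteq> \<infinity>" using pos by (auto simp: emeasure_eq_measure)
  show m: "measure (uniform_measure \<mu> A) B = measure \<mu> (A \<inter> B) / measure \<mu> A" if "B \<in> sets borel" for B
    using measure_uniform_measure[OF em] that by simp
  have "measure (uniform_measure \<mu> A) (f -` B) = measure (uniform_measure \<mu> A) B" if B: "B \<in> sets borel" for B
  proof -
    have fB: "f -` B \<in> sets borel" using measurable_sets[OF f B] by simp
    have "A \<inter> f -` B = f -` (A \<inter> B)" using A(2) by auto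
    then have "measure \<mu> (A \<inter> f -` B) = measure \<mu> (A \<inter> B)"
      using invariant_measuresD(4)[OF mu, of "A \<inter> B"] A(1) B by simp
    then show ?thesis using m[OF B] m[OF fB] by simp
  qed
  then show "uniform_measure \<mu> A \<in> invariant_measures f"
    using prob_space_uniform_measure[OF em] by (simp add: invariant_measures_def)
qed

text \<open>Maximising the integrals of a determining sequence of continuous functions one after the other
  gives a decreasing sequence of closed faces, whose intersection is a single measure \<open>\<mu>\<close>. If an
  invariant set \<open>A\<close> had measure strictly between 0 and 1, then \<open>\<mu>\<close> would be a proper combination of
  its conditional measures on \<open>A\<close> and on the complement. These would belong to the same faces and
  hence both be equal to \<open>\<mu>\<close>, although they disagree on \<open>A\<close>.\<close>
theorem closed_face_contains_ergodic:
  fixes f :: "'a::metric_space \<Rightarrow> 'a"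
  assumes cmp: "compact (UNIV :: 'a set)" and f: "continuous_on UNIV f"
    and K: "closed_face f K" "K \<noteq> {}"
  obtains \<mu> where "\<mu> \<in> K" "\<mu> \<in> ergodic_measures f"
proof -
  have fm: "f \<in> borel_measurable borel" by (rule borel_measurable_continuous_onI[OF f])
  obtain G :: "nat \<Rightarrow> 'a \<Rightarrow> real" where G: "\<And>k. continuous_on UNIV (G k)"
    and det: "\<And>M N. borel_prob M \<Longrightarrow> borel_prob N \<Longrightarrow> (\<And>k. integral\<^sup>L M (G k) = integral\<^sup>L N (G k)) \<Longrightarrow> M = N"
    by (rule continuous_determining_family[OF cmp]) blast
  \<comment> \<open>\<open>F (Suc k)\<close> consists of the maximisers of the integral of \<open>G k\<close> in \<open>F k\<close>\<close>
  define F where "F = rec_nat K (\<lambda>k L. {\<mu> \<in> L. \<forall>\<nu>\<in>L. integral\<^sup>L \<nu> (G k) \<le> integral\<^sup>L \<mu> (G k)})"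
  have F0: "F 0 = K" by (simp add: F_def)
  have FS: "F (Suc k) = {\<mu> \<in> F k. \<forall>\<nu>\<in>F k. integral\<^sup>L \<nu> (G k) \<le> integral\<^sup>L \<mu> (G k)}" for k
    by (simp add: F_def)
  have F: "closed_face f (F k) \<and> F k \<noteq> {}" for k
  proof (induction k)
    case (Suc k)
    obtain \<mu> where "\<mu> \<in> F k" "\<And>\<nu>. \<nu> \<in> F k \<Longrightarrow> integral\<^sup>L \<nu> (G k) \<le> integral\<^sup>L \<mu> (G k)"
      using integral_attains_max[OF cmp f G, of "F k" k] Suc by blast
    then have "\<mu> \<in> F (Suc k)" unfolding FS by blast
    moreover have "closed_face f (F (Suc k))"
      unfolding FS using closed_face_argmax[OF cmp G] Suc by blast
    ultimately show ?case by blast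
  qed (use K F0 in simp)
  then have Fface: "closed_face f (F k)" for k by blast
  have dec: "F l \<subseteq> F k" if "k \<le> l" for k l
    using that by (induction rule: dec_induct) (auto simp: FS)
  have "\<exists>Q. \<forall>k. Q k \<in> F k" using F by (intro choice) blast
  then obtain Q where Q: "\<And>k. Q k \<in> F k" by blast
  have Qi: "Q k \<in> invariant_measures f" for k using Q closed_faceD(1)[OF Fface] by blast
  obtain r \<mu> where r: "strict_mono (r :: nat \<Rightarrow> nat)" and mu: "\<mu> \<in> invariant_measures f"
    and conv: "weakly_converges (Q \<circ> r) \<mu>"
    by (rule invariant_measures_sequentially_compact[OF cmp f Qi])
  have muF: "\<mu> \<in> F k" for k
  proof (rule closed_faceD(2)[OF Fface _ _ mu])
    have "strict_mono (\<lambda>n::nat. n + k)" by (rule strict_monoI) simp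
    then show "weakly_converges ((Q \<circ> r) \<circ> (\<lambda>n. n + k)) \<mu>" by (rule weakly_converges_subseq[OF conv])
    fix n
    have "k \<le> r (n + k)" using strict_mono_imp_increasing[OF r, of "n + k"] by simp
    then show "((Q \<circ> r) \<circ> (\<lambda>n. n + k)) n \<in> F k" using Q[of "r (n + k)"] dec[of k "r (n + k)"] by auto
  qed
  have unique: "\<nu> = \<mu>" if "\<And>k. \<nu> \<in> F k" for \<nu>
  proof (rule det)
    have "\<nu> \<in> invariant_measures f" using that[of 0] closed_faceD(1)[OF Fface] by blast
    then show "borel_prob \<nu>" "borel_prob \<mu>" using mu by (auto intro: invariant_borel_prob)
    show "integral\<^sup>L \<nu> (G k) = integral\<^sup>L \<mu> (G k)" for k
      using that[of "Suc k"] muF[of "Suc k"] unfolding FS by (auto intro: antisym)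
  qed
  interpret borel_prob \<mu> by (rule invariant_borel_prob[OF mu])
  have "measure \<mu> A = 0 \<or> measure \<mu> A = 1" if A: "A \<in> sets borel" "f -` A = A" for A
  proof (rule ccontr)
    assume "\<not> ?thesis"
    then have s: "0 < measure \<mu> A" "measure \<mu> A < 1"
      using prob_le_1[of A] by (auto simp: order_less_le)
    have comp: "measure \<mu> (- A) = 1 - measure \<mu> A"
      using prob_compl[of A] A(1) by (simp add: Compl_eq_Diff_UNIV)
    have nA: "- A \<in> sets borel" "f -` (- A) = - A" using A by (auto simp: vimage_Compl)
    note P = conditional_measure_invariant[OF mu fm A s(1)]
    have "measure \<mu> (- A) > 0" using comp s by simp
    note P' = conditional_measure_invariant[OF mu fm nA this]
    have split: "measure \<mu> B = measure \<mu> A * measure (uniform_measure \<mu> A) B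
        + (1 - measure \<mu> A) * measure (uniform_measure \<mu> (- A)) B" if B: "B \<in> sets borel" for B
    proof -
      have "measure \<mu> B = measure \<mu> (A \<inter> B) + measure \<mu> (- A \<inter> B)"
        using A(1) B by (subst finite_measure_Union[symmetric]) (auto intro: arg_cong[where f = prob])
      then show ?thesis using P(2)[OF B] P'(2)[OF B] comp s by simp
    qed
    have "uniform_measure \<mu> A \<in> F k" for k
      by (rule closed_faceD(3)[OF Fface muF P(1) P'(1) s split])
    then have "uniform_measure \<mu> A = \<mu>" by (rule unique)
    then show False using P(2)[OF A(1)] s by simp
  qed
  then have "\<mu> \<in> ergodic_measures f" using mu by (auto simp: ergodic_measures_def)
  with muF[of 0] show ?thesis unfolding F0 by (rule that)
qed

section \<open>Finiteness of the entropy function\<close>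

text \<open>If \<open>\<mu>\<close> had infinite entropy, so would all its proper combinations with \<open>m\<close>. These approach \<open>m\<close>,
  and upper semicontinuity bounds their entropy near \<open>m\<close>. So a single measure of finite entropy
  makes real-valued pressures available.\<close>
lemma entropy_finite_if_somewhere_finite:
  fixes f :: "'a::metric_space \<Rightarrow> 'a"
  assumes cmp: "compact (UNIV :: 'a set)" and f: "continuous_on UNIV f"
    and usc: "upper_semicontinuous_map (weak_star_topology f) (metric_entropy f)"
    and m: "m \<in> invariant_measures f" "metric_entropy f m < \<infinity>" and mu: "\<mu> \<in> invariant_measures f"
  shows "metric_entropy f \<mu> < \<infinity>"
proof -
  have fm: "f \<in> borel_measurable borel" by (rule borel_measurable_continuous_onI[OF f])
  note bm = invariant_borel_prob[OF m(1)] and bmu = invariant_borel_prob[OF mu]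
  define s where "s k = 1 - 1 / real (k + 2)" for k
  have s: "0 < s k" "s k < 1" for k by (auto simp: s_def field_simps)
  have "\<exists>N. borel_prob N \<and> (\<forall>A\<in>sets borel. measure N A = s k * measure m A + (1 - s k) * measure \<mu> A)" for k
    by (rule convex_combination_exists[OF bm bmu, of "s k"]) (use s[of k] in auto)
  then obtain N where N: "\<And>k. borel_prob (N k)"
    "\<And>k A. A \<in> sets borel \<Longrightarrow> measure (N k) A = s k * measure m A + (1 - s k) * measure \<mu> A" by metis
  have Ni: "N k \<in> invariant_measures f" for k
  proof -
    interpret borel_prob "N k" by (rule N(1))
    have "measure (N k) (f -` A) = measure (N k) A" if A: "A \<in> sets borel" for A
    proof -
      have "f -` A \<in> sets borel" using measurable_sets[OF fm A] by simp
      then show ?thesis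
        using N(2)[of _ k] A invariant_measuresD(4)[OF m(1) A] invariant_measuresD(4)[OF mu A] by simp
    qed
    then show ?thesis using prob_space_axioms by (simp add: invariant_measures_def)
  qed
  have conv: "weakly_converges N m"
    unfolding weakly_converges_def
  proof (intro allI impI)
    fix g :: "'a \<Rightarrow> real" assume g: "continuous_on UNIV g"
    have eq: "integral\<^sup>L (N k) g = s k * integral\<^sup>L m g + (1 - s k) * integral\<^sup>L \<mu> g" for k
      by (rule integral_invariant_combination[OF cmp g Ni m(1) mu s N(2)])
    have "(\<lambda>k. 1 / real (k + 2)) \<longlonglongrightarrow> 0" using LIMSEQ_ignore_initial_segment[OF lim_1_over_n, of 2] .
    then have "s \<longlonglongrightarrow> 1 - 0" unfolding s_def[abs_def] by (intro tendsto_diff tendsto_const)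
    then have "(\<lambda>k. s k * integral\<^sup>L m g + (1 - s k) * integral\<^sup>L \<mu> g)
        \<longlonglongrightarrow> 1 * integral\<^sup>L m g + (1 - 1) * integral\<^sup>L \<mu> g"
      by (intro tendsto_intros) simp_all
    then show "(\<lambda>k. integral\<^sup>L (N k) g) \<longlonglongrightarrow> integral\<^sup>L m g" unfolding eq by simp
  qed
  have "\<forall>\<^sub>F k in sequentially. metric_entropy f (N k) < \<infinity>"
    by (rule metric_entropy_eventually_less[OF usc m(1) Ni conv m(2)])
  then obtain k where k: "metric_entropy f (N k) < \<infinity>" by (auto simp: eventually_sequentially)
  have "ereal (1 - s k) * metric_entropy f \<mu> \<le> metric_entropy f (N k)"
    by (rule metric_entropy_convex_combination(2)[OF m(1) mu Ni fm s N(2)])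
  with k s[of k] show ?thesis by (cases "metric_entropy f \<mu>") auto
qed

section \<open>Intermediate values of the pressure\<close>

theorem theorem1p2:
  fixes f :: "'a::metric_space \<Rightarrow> 'a"
    and \<psi> \<phi> :: "'a \<Rightarrow> real"
    and \<alpha> :: real
  assumes "compact (UNIV :: 'a set)"
    and "continuous_on UNIV f"
    and "upper_semicontinuous_map (weak_star_topology f) (metric_entropy f)"
    and "continuous_on UNIV \<psi>"
    and "continuous_on UNIV \<phi>"
    and "\<And>t::real. t \<ge> 0 \<Longrightarrow> (\<lambda>x. \<psi> x + t * \<phi> x) \<in> constant_pressure_potentials f \<psi>"
    and "\<And>\<mu>. \<mu> \<in> maximizing_measures f \<phi> \<Longrightarrow> measure_pressure f \<mu> \<psi> \<le> ereal \<alpha>"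
  shows "{measure_pressure f \<mu> \<psi> | \<mu>. \<mu> \<in> ergodic_measures f}
           \<supseteq> {ereal \<alpha> .. topological_pressure f \<psi>}"
proof -
  note cmp = assms(1) and f = assms(2) and usc = assms(3) and \<psi> = assms(4) and \<phi> = assms(5)
  have fm: "f \<in> borel_measurable borel" by (rule borel_measurable_continuous_onI[OF f])
  let ?M = "invariant_measures f"
  define a where "a \<mu> = integral\<^sup>L \<mu> \<phi>" for \<mu>
  have maximizing: "\<mu> \<in> maximizing_measures f \<phi>" if "\<mu> \<in> ?M" "\<And>\<nu>. \<nu> \<in> ?M \<Longrightarrow> a \<nu> \<le> a \<mu>" for \<mu>
  proof -
    have "(SUP \<nu>\<in>?M. integral\<^sup>L \<nu> \<phi>) = integral\<^sup>L \<mu> \<phi>"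
      using that by (intro cSup_eq_maximum) (auto simp: a_def)
    then show ?thesis using that(1) by (simp add: maximizing_measures_def)
  qed
  obtain m where m: "m \<in> ?M" "\<And>\<nu>. \<nu> \<in> ?M \<Longrightarrow> a \<nu> \<le> a m"
    unfolding a_def
    using integral_attains_max[OF cmp f \<phi> closed_face_invariant_measures invariant_measures_nonempty[OF cmp f]] by blast
  \<comment> \<open>the bound \<open>\<alpha>\<close> on maximizing measures excludes infinite entropy\<close>
  have "metric_entropy f m < \<infinity>"
    using assms(7)[OF maximizing[OF m]] unfolding measure_pressure_def
    by (cases "metric_entropy f m") auto
  then have fin: "metric_entropy f \<mu> < \<infinity>" if "\<mu> \<in> ?M" for \<mu>
    using entropy_finite_if_somewhere_finite[OF cmp f usc m(1)] that by blast
  define h where "h \<mu> = real_of_ereal (metric_entropy f \<mu>)" for \<mu>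
  have h: "metric_entropy f \<mu> = ereal (h \<mu>)" if "\<mu> \<in> ?M" for \<mu>
    using fin[OF that] metric_entropy_nonneg[OF that fm] unfolding h_def
    by (cases "metric_entropy f \<mu>") auto
  define p where "p \<mu> = h \<mu> + integral\<^sup>L \<mu> \<psi>" for \<mu>
  have pressure: "measure_pressure f \<mu> \<psi> = ereal (p \<mu>)" if "\<mu> \<in> ?M" for \<mu>
    by (simp add: measure_pressure_def h[OF that] p_def)
  have cont: "continuous_on UNIV (\<lambda>x. \<psi> x + t * \<phi> x)" for t :: real
    by (intro continuous_intros \<psi> \<phi>)
  have pressure_t: "measure_pressure f \<mu> (\<lambda>x. \<psi> x + t * \<phi> x) = ereal (p \<mu> + t * a \<mu>)" if mu: "\<mu> \<in> ?M" for \<mu> t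
  proof -
    interpret borel_prob \<mu> by (rule invariant_borel_prob[OF mu])
    have "integral\<^sup>L \<mu> (\<lambda>x. \<psi> x + t * \<phi> x) = integral\<^sup>L \<mu> \<psi> + t * a \<mu>"
      unfolding a_def using continuous_integrable[OF cmp \<psi>] continuous_integrable[OF cmp \<phi>] by simp
    then show ?thesis by (simp add: measure_pressure_def h[OF mu] p_def)
  qed
  have p_usc: "\<forall>\<^sub>F n in sequentially. p (Q n) < c"
    if "\<And>n. Q n \<in> ?M" "weakly_converges Q \<mu>" "\<mu> \<in> ?M" "p \<mu> < c" for Q \<mu> c
    using measure_pressure_eventually_less[OF f \<psi> usc that(3,1,2), of c] that pressure by simp
  have a_cont: "(\<lambda>n. a (Q n)) \<longlonglongrightarrow> a \<mu>" if "weakly_converges Q \<mu>" for Q \<mu>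
    unfolding a_def by (rule weakly_convergesD[OF that \<phi>])
  have affine: "p \<mu> \<le> s * p P + (1 - s) * p Q" "a \<mu> = s * a P + (1 - s) * a Q"
    if mem: "\<mu> \<in> ?M" "P \<in> ?M" "Q \<in> ?M" and s: "0 < s" "s < 1"
      and comb: "\<forall>A\<in>sets borel. measure \<mu> A = s * measure P A + (1 - s) * measure Q A" for \<mu> P Q s
  proof -
    have int: "integral\<^sup>L \<mu> g = s * integral\<^sup>L P g + (1 - s) * integral\<^sup>L Q g" if "continuous_on UNIV g" for g :: "'a \<Rightarrow> real"
      using comb by (intro integral_invariant_combination[OF cmp that mem s]) blast
    then show "a \<mu> = s * a P + (1 - s) * a Q" unfolding a_def using \<phi> by blast
    have "metric_entropy f \<mu> \<le> ereal s * metric_entropy f P + ereal (1 - s) * metric_entropy f Q"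
      using comb by (intro metric_entropy_convex_combination(1)[OF mem(2,3,1) fm s]) blast
    then have "h \<mu> \<le> s * h P + (1 - s) * h Q" by (simp add: h mem)
    then show "p \<mu> \<le> s * p P + (1 - s) * p Q"
      unfolding p_def int[OF \<psi>] by (simp add: algebra_simps)
  qed
  define E where "E t = {\<mu> \<in> ?M. \<forall>\<nu>\<in>?M. p \<nu> + t * a \<nu> \<le> p \<mu> + t * a \<mu>}" for t
  have E_eq: "equilibrium_states f (\<lambda>x. \<psi> x + t * \<phi> x) = E t" for t
    unfolding equilibrium_states_eq_argmax[OF cmp f cont usc] E_def by (auto simp: pressure_t)
  have E_ne: "E t \<noteq> {}" for t
    using equilibrium_states_nonempty[OF cmp f cont usc, of t] unfolding E_eq .
  have EM: "E t \<subseteq> ?M" for t by (auto simp: E_def)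
  \<comment> \<open>Upper semicontinuity bounds the limes superior of \<open>p (Q n)\<close> by \<open>p \<mu>\<close>; maximality of \<open>Q n\<close>
     in comparison with \<open>\<mu>\<close> bounds the limes inferior.\<close>
  have E_limit: "\<mu> \<in> E t" "(\<lambda>n. p (Q n)) \<longlonglongrightarrow> p \<mu>"
    if Q: "\<And>n. Q n \<in> E (\<tau> n)" and \<tau>: "\<tau> \<longlonglongrightarrow> t" and conv: "weakly_converges Q \<mu>" and mu: "\<mu> \<in> ?M" for Q \<tau> t \<mu>
  proof -
    have QM: "Q n \<in> ?M" for n using Q EM by blast
    have Qmax: "p \<nu> + \<tau> n * a \<nu> \<le> p (Q n) + \<tau> n * a (Q n)" if "\<nu> \<in> ?M" for \<nu> n
      using Q[of n] that by (simp add: E_def)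
    note ac = a_cont[OF conv]
    have "p \<nu> + t * a \<nu> \<le> p \<mu> + t * a \<mu>" if nu: "\<nu> \<in> ?M" for \<nu>
    proof (rule field_le_epsilon)
      fix e :: real assume "e > 0"
      then have "\<forall>\<^sub>F n in sequentially. p (Q n) < p \<mu> + e" using p_usc[OF QM conv mu] by simp
      then have "\<forall>\<^sub>F n in sequentially. p \<nu> + \<tau> n * a \<nu> \<le> p \<mu> + e + \<tau> n * a (Q n)"
      proof eventually_elim
        case (elim n)
        with Qmax[OF nu, of n] show ?case by simp
      qed
      moreover have "(\<lambda>n. p \<nu> + \<tau> n * a \<nu>) \<longlonglongrightarrow> p \<nu> + t * a \<nu>" by (intro tendsto_intros \<tau>)
      moreover have "(\<lambda>n. p \<mu> + e + \<tau> n * a (Q n)) \<longlonglongrightarrow> p \<mu> + e + t * a \<mu>" by (intro tendsto_intros \<tau> ac)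
      ultimately have "p \<nu> + t * a \<nu> \<le> p \<mu> + e + t * a \<mu>"
        by (intro tendsto_le[OF sequentially_bot])
      then show "p \<nu> + t * a \<nu> \<le> p \<mu> + t * a \<mu> + e" by simp
    qed
    with mu show "\<mu> \<in> E t" by (simp add: E_def)
    show "(\<lambda>n. p (Q n)) \<longlonglongrightarrow> p \<mu>"
    proof (rule order_tendstoI)
      fix c assume "p \<mu> < c"
      then show "\<forall>\<^sub>F n in sequentially. p (Q n) < c" by (rule p_usc[OF QM conv mu])
    next
      fix c assume c: "c < p \<mu>"
      have "(\<lambda>n. p \<mu> + \<tau> n * (a \<mu> - a (Q n))) \<longlonglongrightarrow> p \<mu> + t * (a \<mu> - a \<mu>)"
        by (intro tendsto_intros \<tau> ac)
      then have "\<forall>\<^sub>F n in sequentially. c < p \<mu> + \<tau> n * (a \<mu> - a (Q n))"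
        using c by (intro order_tendstoD(1)) auto
      then show "\<forall>\<^sub>F n in sequentially. c < p (Q n)"
      proof eventually_elim
        case (elim n)
        with Qmax[OF mu, of n] show ?case by (simp add: algebra_simps)
      qed
    qed
  qed
  have E_face: "closed_face f (E t)" for t
    unfolding closed_face_def
  proof (intro conjI allI impI ballI EM)
    fix Q \<mu> assume "\<forall>n. Q n \<in> E t" "weakly_converges Q \<mu>" "\<mu> \<in> ?M"
    then show "\<mu> \<in> E t" using E_limit(1)[of Q "\<lambda>_. t" t \<mu>] by simp
  next
    fix \<mu> P Q and s :: real
    assume mu: "\<mu> \<in> E t" and P: "P \<in> ?M" and Q: "Q \<in> ?M" and s: "0 < s" "s < 1"
      and c: "\<forall>A\<in>sets borel. measure \<mu> A = s * measure P A + (1 - s) * measure Q A"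
    let ?v = "\<lambda>\<nu>. p \<nu> + t * a \<nu>"
    have muM: "\<mu> \<in> ?M" using mu EM by blast
    have "?v \<mu> \<le> s * ?v P + (1 - s) * ?v Q"
      using affine(1)[OF muM P Q s c] unfolding affine(2)[OF muM P Q s c] by (simp add: algebra_simps)
    moreover have "(1 - s) * ?v Q \<le> (1 - s) * ?v \<mu>"
      using mu Q s by (intro mult_left_mono) (auto simp: E_def)
    ultimately have "s * ?v \<mu> \<le> s * ?v P" by (simp add: algebra_simps)
    then have "?v \<mu> \<le> ?v P" using s by simp
    then show "P \<in> E t" using mu P unfolding E_def by fastforce
  qed
  define eq where "eq t = (SOME \<mu>. \<mu> \<in> E t)" for t
  have eq: "eq t \<in> E t" for t unfolding eq_def using E_ne some_in_eq by blast
  \<comment> \<open>the common value of the pressure of \<open>\<psi>\<close> on \<open>E t\<close>\<close>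
  define g where "g t = p (eq t)" for t
  have g: "p \<mu> = g t" if "t \<ge> 0" "\<mu> \<in> E t" for t \<mu>
  proof -
    have "\<forall>\<mu>\<in>E t. \<forall>\<nu>\<in>E t. measure_pressure f \<mu> \<psi> = measure_pressure f \<nu> \<psi>"
      using assms(6)[OF that(1)] unfolding constant_pressure_potentials_def mem_Collect_eq E_eq
      by (rule conjunct2)
    then have "measure_pressure f \<mu> \<psi> = measure_pressure f (eq t) \<psi>" using that(2) eq by blast
    then show ?thesis using that(2) eq[of t] EM by (simp add: pressure g_def subset_iff)
  qed
  have g_cont: "continuous_on {0..} g"
    unfolding continuous_on_sequentially
  proof (intro allI ballI impI, elim conjE)
    fix \<tau> and t :: real assume t: "t \<in> {0..}" and \<tau>0: "\<forall>n. \<tau> n \<in> {0..}" and \<tau>: "\<tau> \<longlonglongrightarrow> t"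
    show "(g \<circ> \<tau>) \<longlonglongrightarrow> g t"
    proof (rule ccontr)
      assume "\<not> ?thesis"
      then obtain e where e: "e > 0" "\<not> (\<forall>\<^sub>F n in sequentially. dist ((g \<circ> \<tau>) n) (g t) < e)"
        by (auto simp: tendsto_iff)
      then have "infinite {n. \<not> dist ((g \<circ> \<tau>) n) (g t) < e}"
        by (simp add: not_eventually INFM_iff_infinite cofinite_eq_sequentially[symmetric])
      from infinite_enumerate[OF this] obtain q
        where q: "strict_mono (q :: nat \<Rightarrow> nat)" "\<And>n. \<not> dist (g (\<tau> (q n))) (g t) < e"
        by auto
      have QM: "eq (\<tau> (q n)) \<in> ?M" for n using eq EM by blast
      obtain r \<mu> where r: "strict_mono (r :: nat \<Rightarrow> nat)" and mu: "\<mu> \<in> ?M"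
        and conv: "weakly_converges ((\<lambda>n. eq (\<tau> (q n))) \<circ> r) \<mu>"
        by (rule invariant_measures_sequentially_compact[OF cmp f QM])
      have "(\<tau> \<circ> (q \<circ> r)) \<longlonglongrightarrow> t" by (rule LIMSEQ_subseq_LIMSEQ[OF \<tau> strict_mono_o[OF q(1) r]])
      then have \<tau>': "(\<lambda>n. \<tau> (q (r n))) \<longlonglongrightarrow> t" by (simp add: comp_def)
      note lim = E_limit[OF _ \<tau>' conv mu]
      have "\<mu> \<in> E t" by (rule lim(1)) (simp add: eq)
      then have "p \<mu> = g t" using g t by simp
      moreover have "(\<lambda>n. p (((\<lambda>n. eq (\<tau> (q n))) \<circ> r) n)) \<longlonglongrightarrow> p \<mu>" by (rule lim(2)) (simp add: eq)
      ultimately have "(\<lambda>n. g (\<tau> (q (r n)))) \<longlonglongrightarrow> g t" by (simp add: g_def)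
      then have "\<forall>\<^sub>F n in sequentially. dist (g (\<tau> (q (r n)))) (g t) < e" using e(1) by (rule tendstoD)
      then show False using q(2) by (auto simp: eventually_sequentially)
    qed
  qed
  have P0: "topological_pressure f \<psi> = ereal (g 0)" and p_le: "\<And>\<mu>. \<mu> \<in> ?M \<Longrightarrow> p \<mu> \<le> g 0"
  proof -
    have "eq 0 \<in> equilibrium_states f \<psi>" using eq[of 0] E_eq[of 0] by simp
    then show "topological_pressure f \<psi> = ereal (g 0)"
      using pressure[of "eq 0"] by (simp add: equilibrium_states_def g_def)
    show "p \<mu> \<le> g 0" if "\<mu> \<in> ?M" for \<mu> using eq[of 0] that by (simp add: E_def g_def)
  qed
  have "\<exists>\<mu>\<in>ergodic_measures f. p \<mu> = b" if b: "\<alpha> \<le> b" "b \<le> g 0" for b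
  proof (cases "\<exists>n::nat. g n \<le> b")
    case True
    then obtain n :: nat where "g n \<le> b" by blast
    then obtain t where t: "0 \<le> t" "g t = b"
      using IVT2'[of g "real n" b 0] b(2) continuous_on_subset[OF g_cont, of "{0..real n}"] by auto
    obtain \<mu> where "\<mu> \<in> E t" "\<mu> \<in> ergodic_measures f"
      by (rule closed_face_contains_ergodic[OF cmp f E_face E_ne])
    then show ?thesis using g t by blast
  next
    case False
    \<comment> \<open>All values \<open>g n\<close> exceed \<open>b\<close>; dividing the maximality of \<open>Q n\<close> by \<open>n\<close> shows that limits of
       \<open>Q n\<close> are maximizing for \<open>\<phi>\<close>. This is possible only for \<open>b = \<alpha>\<close>.\<close>
    define Q where "Q n = eq (real n)" for n
    have QE: "Q n \<in> E (real n)" for n by (simp add: Q_def eq)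
    have QM: "Q n \<in> ?M" for n using QE EM by blast
    have Qb: "p (Q n) > b" for n using False by (simp add: Q_def g_def not_le)
    obtain r \<mu> where r: "strict_mono (r :: nat \<Rightarrow> nat)" and mu: "\<mu> \<in> ?M"
      and conv: "weakly_converges (Q \<circ> r) \<mu>"
      by (rule invariant_measures_sequentially_compact[OF cmp f QM])
    have amax: "a \<nu> \<le> a \<mu>" if nu: "\<nu> \<in> ?M" for \<nu>
    proof (rule LIMSEQ_le)
      have "filterlim (\<lambda>n. real (r n)) at_top sequentially"
        by (intro filterlim_compose[OF filterlim_real_sequentially] filterlim_subseq r)
      then have "(\<lambda>n. (g 0 - p \<nu>) / real (r n)) \<longlonglongrightarrow> 0" by (rule real_tendsto_divide_at_top[OF tendsto_const])
      then have "(\<lambda>n. a \<nu> - (g 0 - p \<nu>) / real (r n)) \<longlonglongrightarrow> a \<nu> - 0" by (intro tendsto_intros)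
      then show "(\<lambda>n. a \<nu> - (g 0 - p \<nu>) / real (r n)) \<longlonglongrightarrow> a \<nu>" by simp
      show "(\<lambda>n. a ((Q \<circ> r) n)) \<longlonglongrightarrow> a \<mu>" by (rule a_cont[OF conv])
      have "a \<nu> - (g 0 - p \<nu>) / real (r n) \<le> a ((Q \<circ> r) n)" if n: "n \<ge> 1" for n
      proof -
        have rn: "real (r n) > 0" using strict_mono_imp_increasing[OF r, of n] n by simp
        have "p \<nu> + real (r n) * a \<nu> \<le> p (Q (r n)) + real (r n) * a (Q (r n))"
          using QE[of "r n"] nu by (simp add: E_def)
        then have "real (r n) * a \<nu> - (g 0 - p \<nu>) \<le> real (r n) * a (Q (r n))"
          using p_le[OF QM[of "r n"]] by simp
        then show ?thesis using rn by (simp add: field_simps)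
      qed
      then show "\<exists>N. \<forall>n\<ge>N. a \<nu> - (g 0 - p \<nu>) / real (r n) \<le> a ((Q \<circ> r) n)" by blast
    qed
    have p_max: "p \<nu> \<le> \<alpha>" if "\<nu> \<in> ?M" "\<And>\<nu>'. \<nu>' \<in> ?M \<Longrightarrow> a \<nu>' \<le> a \<nu>" for \<nu>
      using assms(7)[OF maximizing[OF that]] pressure[OF that(1)] by simp
    have "b \<le> p \<mu>"
    proof (rule ccontr)
      assume "\<not> b \<le> p \<mu>"
      then have "\<forall>\<^sub>F n in sequentially. p ((Q \<circ> r) n) < b" using QM by (intro p_usc[OF _ conv mu]) auto
      then show False using Qb by (auto simp: eventually_sequentially dest: less_asym)
    qed
    then have b_eq: "b = \<alpha>" "p \<mu> = \<alpha>" using b(1) p_max[OF mu amax] by auto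
    \<comment> \<open>a limit of the \<open>Q n\<close> need not be ergodic, but it shows that this face is nonempty\<close>
    define K where "K = {\<nu> \<in> ?M. (\<forall>\<nu>'\<in>?M. a \<nu>' \<le> a \<nu>) \<and> \<alpha> \<le> p \<nu>}"
    have "closed_face f K"
      unfolding closed_face_def
    proof (intro conjI allI impI ballI)
      show "K \<subseteq> ?M" by (auto simp: K_def)
    next
      fix R \<nu> assume R: "\<forall>n. R n \<in> K" and conv: "weakly_converges R \<nu>" and nu: "\<nu> \<in> ?M"
      have "a \<nu>' \<le> a \<nu>" if "\<nu>' \<in> ?M" for \<nu>'
        using R that by (intro LIMSEQ_le_const[OF a_cont[OF conv]]) (auto simp: K_def)
      moreover have "\<alpha> \<le> p \<nu>"
      proof (rule ccontr)
        assume "\<not> \<alpha> \<le> p \<nu>"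
        then have "\<forall>\<^sub>F n in sequentially. p (R n) < \<alpha>"
          using R by (intro p_usc[OF _ conv nu]) (auto simp: K_def)
        then obtain n where "p (R n) < \<alpha>" by (auto simp: eventually_sequentially)
        moreover have "\<alpha> \<le> p (R n)" using R by (simp add: K_def)
        ultimately show False by simp
      qed
      ultimately show "\<nu> \<in> K" using nu by (simp add: K_def)
    next
      fix \<nu> P R and s :: real
      assume nu: "\<nu> \<in> K" and P: "P \<in> ?M" and R: "R \<in> ?M" and s: "0 < s" "s < 1"
        and c: "\<forall>A\<in>sets borel. measure \<nu> A = s * measure P A + (1 - s) * measure R A"
      have nuM: "\<nu> \<in> ?M" and numax: "\<And>\<nu>'. \<nu>' \<in> ?M \<Longrightarrow> a \<nu>' \<le> a \<nu>" using nu by (auto simp: K_def)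
      note aff = affine[OF nuM P R s c]
      have "s * a P \<le> s * a \<nu>" "(1 - s) * a R \<le> (1 - s) * a \<nu>"
        using numax[OF P] numax[OF R] s by (auto intro: mult_left_mono)
      moreover have "s * a P + (1 - s) * a R = s * a \<nu> + (1 - s) * a \<nu>"
        using aff(2) by (simp add: algebra_simps)
      ultimately have "s * a P = s * a \<nu>" "(1 - s) * a R = (1 - s) * a \<nu>" by linarith+
      then have aP: "a P = a \<nu>" "a R = a \<nu>" using s by auto
      have "p R \<le> \<alpha>" using p_max[OF R] numax aP(2) by simp
      then have "(1 - s) * p R \<le> (1 - s) * \<alpha>" using s by (intro mult_left_mono) auto
      moreover have "\<alpha> \<le> s * p P + (1 - s) * p R" using aff(1) nu by (simp add: K_def)
      ultimately have "s * \<alpha> \<le> s * p P" by (simp add: algebra_simps)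
      then have "\<alpha> \<le> p P" using s by simp
      then show "P \<in> K" using P numax aP(1) by (simp add: K_def)
    qed
    moreover have "\<mu> \<in> K" using mu amax b_eq by (simp add: K_def)
    ultimately obtain \<nu> where nu: "\<nu> \<in> K" "\<nu> \<in> ergodic_measures f"
      using closed_face_contains_ergodic[OF cmp f, of K] by blast
    have "p \<nu> = \<alpha>" using nu(1) p_max[of \<nu>] by (auto simp: K_def intro: antisym)
    then show ?thesis using nu(2) b_eq(1) by blast
  qed
  note attained = this
  show ?thesis
  proof
    fix x assume x: "x \<in> {ereal \<alpha> .. topological_pressure f \<psi>}"
    then obtain b where b: "x = ereal b" "\<alpha> \<le> b" "b \<le> g 0" unfolding P0 by (cases x) auto
    then obtain \<mu> where mu: "\<mu> \<in> ergodic_measures f" "p \<mu> = b" using attained by blast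
    then have "measure_pressure f \<mu> \<psi> = x" using pressure b(1) by (simp add: ergodic_measures_def)
    with mu(1) show "x \<in> {measure_pressure f \<mu> \<psi> | \<mu>. \<mu> \<in> ergodic_measures f}" by blast
  qed
qed

end
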